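(* For each $n\in\{7,13,19\}$, there is a balanced triangle design in $\mathbb{F}_{2^n}$ (viewed as an $n$-dimensional vector space over $\mathbb{F}_2$) that is invariant under the action of the multiplicative group $\mathbb{F}_{2^n}^*$ (by multiplication) and under the action of the automorphism group $\mathrm{Aut}(\mathbb{F}_{2^n})$ of the field.
   Context: For a vector space $V$ over $\mathbb{F}_2$, a triangle is a set $\{\langle a,b\rangle,\langle b,c\rangle,\langle c,a\rangle\}$ of three $2$-dimensional subspaces, with $a,b,c$ linearly independent. A triangle design in $V$ is a set of triangles such that every $2$-dimensional subspace of $V$ belongs to exactly one triangle of the set. A triangle covers a nonzero vector $x$ if $x$ lies in one of its three subspaces; a triangle design is balanced if every nonzero vector is covered by the same number of its triangles. Invariance under a group of $\mathbb{F}_2$-linear maps means each map sends the set of triangles onto itself. *)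

theory Defs
  imports
    "HOL-Library.Z2"
    "HOL-Library.Cardinality"
    "HOL-Number_Theory.Number_Theory"
begin

locale f2_vector_space = vector_space scale
  for scale :: "bit \<Rightarrow> 'v::ab_group_add \<Rightarrow> 'v"
begin

definition planes :: "'v set set" where
  "planes = {U. subspace U \<and> dim U = 2}"

definition triangles :: "'v set set set" where
  "triangles = {{span {a, b}, span {b, c}, span {c, a}} | a b c.
     distinct [a, b, c] \<and> independent {a, b, c}}"

definition triangle_design :: "'v set set set \<Rightarrow> bool" where
  "triangle_design D \<longleftrightarrow>
     D \<subseteq> triangles \<and> (\<forall>U \<in> planes. \<exists>!T. T \<in> D \<and> U \<in> T)"

end

definition covers :: "'v set set \<Rightarrow> 'v \<Rightarrow> bool" where
  "covers T x \<longleftrightarrow> (\<exists>U \<in> T. x \<in> U)"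

(* The number of covering triangles is a genuine count only when it is finite,
   in particular whenever the space itself is finite. *)
definition balanced :: "'v::zero set set set \<Rightarrow> bool" where
  "balanced D \<longleftrightarrow> (\<exists>k. \<forall>x. x \<noteq> 0 \<longrightarrow> card {T \<in> D. covers T x} = k)"

(* f acts on subspaces, triangles and sets of triangles by iterated direct image. *)
definition invariant_under :: "('v \<Rightarrow> 'v) \<Rightarrow> 'v set set set \<Rightarrow> bool" where
  "invariant_under f D \<longleftrightarrow> (`) ((`) f) ` D = D"

(* Scalar multiplication through the prime field; a vector space structure in characteristic 2. *)
definition f2_scale :: "bit \<Rightarrow> 'a::field \<Rightarrow> 'a" where
  "f2_scale c x = of_bit c * x"

definition field_automorphisms :: "('a::field \<Rightarrow> 'a) set" where
  "field_automorphisms = {\<sigma>. bij \<sigma> \<and> \<sigma> 1 = 1 \<and>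
     (\<forall>x y. \<sigma> (x + y) = \<sigma> x + \<sigma> y) \<and> (\<forall>x y. \<sigma> (x * y) = \<sigma> x * \<sigma> y)}"

lemma CHAR_eq_2_if_CARD:
  assumes "CARD('a::finite_field) = 2 ^ n"
  shows "CHAR('a) = 2"
proof -
  have p: "prime CHAR('a)"
    by (rule prime_CHAR_semidom) simp
  have "CHAR('a) dvd 2 ^ n"
    using CHAR_dvd_CARD[where ?'a = 'a] assms by simp
  then have "CHAR('a) dvd 2"
    using p prime_dvd_power by blast
  then show ?thesis
    using p primes_dvd_imp_eq two_is_prime_nat by blast
qed

lemma f2_vector_space_f2_scale:
  assumes "CHAR('a::field) = 2"
  shows "f2_vector_space (f2_scale :: bit \<Rightarrow> 'a \<Rightarrow> 'a)"
proof -
  have two: "x + x = 0" for x :: 'a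
    using uminus_CHAR_2[OF assms, of x] by (metis add.right_inverse)
  show ?thesis
  proof
    fix a b :: bit and x y :: 'a
    show "f2_scale a (x + y) = f2_scale a x + f2_scale a y"
      by (simp add: f2_scale_def algebra_simps)
    show "f2_scale (a + b) x = f2_scale a x + f2_scale b x"
      by (cases a; cases b) (simp_all add: f2_scale_def two)
    show "f2_scale a (f2_scale b x) = f2_scale (a * b) x"
      by (cases a; cases b) (simp_all add: f2_scale_def)
    show "f2_scale 1 x = x"
      by (simp add: f2_scale_def)
  qed
qed

end

theory Submission
  imports Defs "HOL-Computational_Algebra.Computational_Algebra"
begin

text \<open>Multiplications and automorphisms generate the group of semilinear maps, which acts on planes.
  Since multiplications are transitive on nonzero vectors, an invariant design is balanced.
  The plane spanned by \<open>a\<close> and \<open>b\<close> is determined up to multiplication by the invariant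
  \<open>(r ^ 2 + r + 1) ^ 3 / (r ^ 2 + r) ^ 2\<close> of the ratio \<open>r = b / a\<close>, which plays the role of the
  j-invariant; automorphisms act on it. If the sides of \<open>N\<close> base triangles have \<open>3 * N\<close> invariants
  in distinct orbits of full size \<open>n\<close>, then the images of these sides under the semilinear maps are
  distinct, and for \<open>18 * n * N = 2 ^ n - 2\<close> there are as many of them as planes. So the images of
  the base triangles form a design.

  For \<open>n = 7, 13, 19\<close> we need 1, 35 and 1533 base triangles, found by computer. In coordinates with
  respect to a normal basis, the Frobenius map is a rotation, so the orbits of full size
  correspond to binary Lyndon words of length \<open>n\<close>.\<close>

section \<open>Semilinear images of triangles\<close>

text \<open>The aim is a free action of the semilinear group, of order
  \<open>n * (2 ^ n - 1)\<close>, on the sides of the triangles. As \<open>n\<close> is odd, there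
  is no element of order 3, so no plane is fixed by a multiplication other than by 1, and exactly
  six ratios share each invariant. The condition that \<open>18 * n\<close> divides
  \<open>2 ^ n - 2\<close> holds for primes \<open>n\<close> congruent to 1 modulo 6, of which 7, 13
  and 19 are the smallest. The search has to group all \<open>3 * N\<close> orbits of invariants
  into triples realised by ratios \<open>x\<close>, \<open>y\<close>, \<open>x * y\<close>. Two
  obstacles shape the verification. The field is an arbitrary type of which only the size is known,
  so concrete arithmetic must be transferred to it by evaluation at a root, and the existence of the
  root is itself read off from a computation. And the checks run by rewriting, so comparing
  thousands of Frobenius orbits pairwise must be cheap: each invariant comes with the Lyndon word of
  its orbit, coded as a number, so that distinct orbits amount to distinct numerals.\<close>

locale binary_field =
  fixes n :: nat and field_type :: "'a::finite_field itself"
  assumes card_field: "CARD('a) = 2 ^ n" and odd_n: "odd n"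
begin

section \<open>Arithmetic in characteristic 2\<close>

lemma CHAR_2: "CHAR('a) = 2"
  using CHAR_eq_2_if_CARD card_field .

sublocale f2_vector_space "f2_scale :: bit \<Rightarrow> 'a \<Rightarrow> 'a"
  by (rule f2_vector_space_f2_scale[OF CHAR_2])

lemma add_self: "x + x = (0 :: 'a)"
  using uminus_CHAR_2[OF CHAR_2, of x] by (metis add.right_inverse)

lemma two_eq_0: "2 = (0 :: 'a)"
  using add_self[of 1] by simp

lemma add_self_left: "x + (x + y) = (y :: 'a)"
  by (simp add: add_self flip: add.assoc)

lemma add_eq_0_iff_eq: "x + y = 0 \<longleftrightarrow> x = (y :: 'a)"
  by (metis add_self add_self_left)

lemma minus_eq_add: "x - y = x + (y :: 'a)"
  by (simp add: diff_conv_add_uminus uminus_CHAR_2[OF CHAR_2] del: add_uminus_conv_diff)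

lemma power2_add: "(x + y) ^ 2 = x ^ 2 + (y :: 'a) ^ 2"
  using freshmans_dream[where ?'a = 'a] CHAR_2 two_is_prime_nat by simp

text \<open>As \<open>n\<close> is odd, \<open>2 ^ n\<close> is 2 modulo 3, so for
  \<open>c ^ 3 = 1\<close> the identity \<open>c ^ (2 ^ n) = c\<close> reads
  \<open>c ^ 2 = c\<close>. This is what makes the multiplier of a semilinear map recoverable from
  its effect on \<open>power_sum 3\<close>.\<close>

lemma cube_inject:
  fixes x y :: 'a
  assumes "x ^ 3 = y ^ 3"
  shows "x = y"
proof (cases "y = 0")
  case True
  with assms show ?thesis by simp
next
  case False
  define c where "c = x / y"
  have c: "c ^ 3 = 1" using assms False by (simp add: c_def power_divide)
  then have "c \<noteq> 0" by auto
  have "[2 ^ n = 2 ^ 1] (mod (3::nat))"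
  proof -
    obtain k where k: "n = Suc (2 * k)" using odd_n by (auto elim: oddE)
    have "[4 ^ k = 1 ^ k] (mod (3::nat))" by (rule cong_pow) (simp add: cong_def)
    then have "[2 * 4 ^ k = 2 * 1] (mod (3::nat))" by (intro cong_mult) auto
    then show ?thesis by (simp add: k power_mult)
  qed
  then have "2 ^ n mod 3 = (2::nat)" by (simp add: cong_def)
  then have "2 ^ n = 3 * (2 ^ n div 3) + (2::nat)" by presburger
  then have "c ^ (2 ^ n) = c ^ (3 * (2 ^ n div 3) + 2)" by simp
  also have "\<dots> = c ^ 2" by (simp add: power_add power_mult c power2_eq_square)
  finally have "c ^ 2 = c"
    using finite_field_power_card_eq_same[of c] by (simp add: card_field)
  then have "c = 1" using \<open>c \<noteq> 0\<close> by (simp add: power2_eq_square)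
  then show ?thesis using False by (simp add: c_def)
qed

section \<open>Planes, their number and their invariant\<close>

definition plane :: "'a \<Rightarrow> 'a \<Rightarrow> 'a set" where
  "plane a b = {0, a, b, a + b}"

lemma span_pair: "span {a, b} = plane a b"
proof -
  have ex: "(\<exists>k. P k) \<longleftrightarrow> P (0::bit) \<or> P 1" for P by (metis (full_types) bit_not_zero_iff)
  have "x \<in> span {a, b} \<longleftrightarrow> x \<in> plane a b" for x
    by (simp add: span_breakdown_eq f2_scale_def ex minus_eq_add add.assoc add_eq_0_iff_eq plane_def) blast
  then show ?thesis by blast
qed

lemma independent_pair: "independent {a, b} \<and> a \<noteq> b \<longleftrightarrow> a \<noteq> 0 \<and> b \<noteq> 0 \<and> a \<noteq> b"
proof -
  have "span {b} = {0, b}" using span_pair[of b b] by (simp add: plane_def add_self insert_commute)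
  then show ?thesis by (auto simp: independent_insert)
qed

lemma planes_eq: "planes = {plane a b | a b. a \<noteq> 0 \<and> b \<noteq> 0 \<and> a \<noteq> b}"
proof (intro equalityI subsetI)
  fix U assume "U \<in> planes"
  then have U: "subspace U" "dim U = 2" by (auto simp: planes_def)
  obtain B where B: "B \<subseteq> U" "independent B" "U \<subseteq> span B" "card B = dim U"
    using basis_exists by blast
  then obtain a b where ab: "B = {a, b}" "a \<noteq> b" using U by (metis card_2_iff)
  have "span B = U" using B U by (metis span_minimal subset_antisym)
  then show "U \<in> {plane a b | a b. a \<noteq> 0 \<and> b \<noteq> 0 \<and> a \<noteq> b}"
    using ab B independent_pair[of a b] by (auto simp: span_pair)
next
  fix U assume "U \<in> {plane a b | a b. a \<noteq> 0 \<and> b \<noteq> 0 \<and> a \<noteq> b}"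
  then obtain a b where ab: "U = span {a, b}" "a \<noteq> 0" "b \<noteq> 0" "a \<noteq> b"
    by (auto simp: span_pair)
  then show "U \<in> planes"
    using independent_pair[of a b] by (simp add: planes_def dim_eq_card_independent)
qed

text \<open>Double counting of ordered bases: every plane has at least the six that are listed. An
  upper bound is enough, since the images of the base sides will supply the matching lower
  bound.\<close>

lemma card_planes_le: "6 * card planes \<le> (2 ^ n - 1) * (2 ^ n - 2)"
proof -
  define Q :: "('a \<times> 'a) set" where "Q = (SIGMA a:-{0}. -{0, a})"
  have card_Q: "card Q = (2 ^ n - 1) * (2 ^ n - 2)"
  proof -
    have "card (-{0, a}) = 2 ^ n - 2" if "a \<noteq> 0" for a :: 'a
      using that card_field by (simp add: Compl_eq_Diff_UNIV card_Diff_subset)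
    then have "card Q = (\<Sum>a\<in>-{0::'a}. 2 ^ n - 2)"
      unfolding Q_def by (subst card_SigmaI) auto
    then show ?thesis using card_field by (simp add: Compl_eq_Diff_UNIV card_Diff_subset)
  qed
  have "6 \<le> card {p \<in> Q. case_prod plane p = U}" if U: "U \<in> planes" for U
  proof -
    obtain a b where ab: "U = plane a b" "a \<noteq> 0" "b \<noteq> 0" "a \<noteq> b"
      using U unfolding planes_eq by blast
    have *: "a + b \<noteq> 0" "a + b \<noteq> a" "a + b \<noteq> b" "a \<noteq> a + b" "b \<noteq> a + b"
      using ab by (auto simp: add_eq_0_iff_eq)
    have sums: "b + a = a + b" "a + (a + b) = b" "(a + b) + a = b" "b + (a + b) = a" "(a + b) + b = a"
      by (metis add_self_left add.commute)+
    have "plane b a = U" "plane a (a + b) = U" "plane (a + b) a = U" "plane b (a + b) = U" "plane (a + b) b = U"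
      unfolding ab(1) plane_def sums by blast+
    then have sub: "{(a, b), (b, a), (a, a + b), (a + b, a), (b, a + b), (a + b, b)}
        \<subseteq> {p \<in> Q. case_prod plane p = U}"
      using ab * by (simp add: Q_def)
    moreover have "card {(a, b), (b, a), (a, a + b), (a + b, a), (b, a + b), (a + b, b)} = 6"
      using ab * by simp
    ultimately show ?thesis using card_mono[OF finite sub] by (simp only:)
  qed
  then have "(\<Sum>U\<in>planes. 6) \<le> (\<Sum>U\<in>planes. card {p \<in> Q. case_prod plane p = U})"
    by (intro sum_mono) auto
  also have "\<dots> = card (\<Union>U\<in>planes. {p \<in> Q. case_prod plane p = U})"
    by (rule card_UN_disjoint[symmetric]) auto
  also have "\<dots> \<le> card Q"
    by (intro card_mono) auto
  finally show ?thesis using card_Q by (simp add: mult.commute)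
qed

text \<open>On the plane spanned by \<open>a\<close> and \<open>b\<close> the sums of third and fifth powers are
  \<open>a * b * (a + b)\<close> and \<open>a * b * (a + b) * (a ^ 2 + a * b + b ^ 2)\<close>. In terms of such sums the
  invariant is a function of the plane alone, and its behaviour under semilinear maps is clear.\<close>

definition power_sum :: "nat \<Rightarrow> 'a set \<Rightarrow> 'a" where
  "power_sum k U = (\<Sum>v\<in>U. v ^ k)"

text \<open>Numerator and denominator are homogeneous of the same degree 15, so a multiplier
  cancels. The exponents 3 and 5 are the first for which the power sum of a plane is not identically
  zero: additivity kills the exponents 1, 2 and 4.\<close>

definition plane_invariant :: "'a set \<Rightarrow> 'a" where
  "plane_invariant U = power_sum 5 U ^ 3 / power_sum 3 U ^ 5"

text \<open>The ratio of two vectors of a plane is determined up to the six substitutions generated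
  by passing from \<open>r\<close> to \<open>r + 1\<close> and to \<open>1 / r\<close>. This
  function of degree six is fixed by them; in terms of \<open>u = r ^ 2 + r\<close> it is
  \<open>(u + 1) ^ 3 / u ^ 2\<close>.\<close>

definition ratio_invariant :: "'a \<Rightarrow> 'a" where
  "ratio_invariant r = (r ^ 2 + r + 1) ^ 3 / (r ^ 2 + r) ^ 2"

text \<open>In characteristic 2 the product \<open>u * (u + 1)\<close> with
  \<open>u = r ^ 2 + r\<close> collapses to \<open>r ^ 4 + r\<close>. The odd powers of
  \<open>1 + r\<close> are expanded by splitting off one factor, which leaves an iterated
  square.\<close>

lemma power_sum_plane:
  assumes "r \<noteq> 0" "r \<noteq> 1"
  shows "power_sum 3 (plane 1 r) = r ^ 2 + r"
    and "power_sum 5 (plane 1 r) = (r ^ 2 + r) * (r ^ 2 + r + 1)"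
proof -
  have "1 + r \<noteq> 0" using assms by (auto simp: add_eq_0_iff_eq)
  then have s: "power_sum k (plane 1 r) = 0 ^ k + (1 + (r ^ k + (1 + r) ^ k))" for k
    using assms by (auto simp: plane_def power_sum_def)
  have 3: "(1 + r) ^ 3 = 1 + r + r ^ 2 + r ^ 3"
  proof -
    have "(1 + r) ^ 3 = (1 + r) * (1 + r) ^ 2" by (simp add: power3_eq_cube power2_eq_square)
    also have "\<dots> = (1 + r) * (1 + r ^ 2)" by (simp add: power2_add)
    finally show ?thesis by (simp add: ring_distribs eval_nat_numeral ac_simps)
  qed
  have 5: "(1 + r) ^ 5 = 1 + r + r ^ 4 + r ^ 5"
  proof -
    have "(1 + r) ^ 5 = (1 + r) * ((1 + r) ^ 2) ^ 2" by (simp add: eval_nat_numeral)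
    also have "\<dots> = (1 + r) * (1 + r ^ 4)" by (simp add: power2_add flip: power_mult)
    finally show ?thesis by (simp add: ring_distribs eval_nat_numeral ac_simps)
  qed
  show "power_sum 3 (plane 1 r) = r ^ 2 + r"
    by (simp add: s 3 ac_simps add_self add_self_left)
  have "power_sum 5 (plane 1 r) = r + r ^ 4"
    by (simp add: s 5 ac_simps add_self add_self_left)
  also have "\<dots> = (r ^ 2 + r) * (r ^ 2 + r + 1)"
    by (simp add: algebra_simps eval_nat_numeral two_eq_0)
  finally show "power_sum 5 (plane 1 r) = (r ^ 2 + r) * (r ^ 2 + r + 1)" .
qed

lemma plane_invariant_plane:
  assumes "r \<noteq> 0" "r \<noteq> 1"
  shows "plane_invariant (plane 1 r) = ratio_invariant r"
proof -
  have "r ^ 2 + r = r * (r + 1)" by (simp add: power2_eq_square algebra_simps)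
  then have "r ^ 2 + r \<noteq> 0" using assms by (simp add: add_eq_0_iff_eq)
  then show ?thesis
    by (simp add: plane_invariant_def power_sum_plane[OF assms] ratio_invariant_def power_mult_distrib
        divide_simps flip: power_add)
qed


section \<open>Field automorphisms and semilinear maps\<close>

lemma automorphismD:
  assumes "\<sigma> \<in> field_automorphisms"
  shows "bij \<sigma>" "\<sigma> 0 = 0" "\<sigma> 1 = 1" "\<sigma> (x + y) = \<sigma> x + \<sigma> y" "\<sigma> (x * y) = \<sigma> x * \<sigma> y"
    "\<sigma> (x ^ k) = \<sigma> x ^ k" "\<sigma> (x / y) = \<sigma> x / \<sigma> (y :: 'a)" "\<sigma> (sum f A) = (\<Sum>a\<in>A. \<sigma> (f a))"
    "\<sigma> x = \<sigma> y \<longleftrightarrow> x = y"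
proof -
  show bij: "bij \<sigma>" and one: "\<sigma> 1 = 1" and add: "\<sigma> (x + y) = \<sigma> x + \<sigma> y"
    and mult: "\<sigma> (x * y) = \<sigma> x * \<sigma> y" for x y
    using assms by (auto simp: field_automorphisms_def)
  show inj: "\<sigma> x = \<sigma> y \<longleftrightarrow> x = y" for x y
    using bij by (metis bij_pointE)
  show zero: "\<sigma> 0 = 0" using add[of 0 0] by (metis add_0 add_self)
  show "\<sigma> (x ^ k) = \<sigma> x ^ k" by (induction k) (simp_all add: one mult)
  show "\<sigma> (x / y) = \<sigma> x / \<sigma> y"
  proof (cases "y = 0")
    case False
    then have "\<sigma> y \<noteq> 0" using inj[of y 0] zero by simp
    moreover have "\<sigma> x = \<sigma> (x / y) * \<sigma> y" using False by (simp flip: mult)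
    ultimately show ?thesis by simp
  qed (simp add: zero)
  show "\<sigma> (sum f A) = (\<Sum>a\<in>A. \<sigma> (f a))"
    by (induction A rule: infinite_finite_induct) (simp_all add: zero add)
qed

lemma automorphism_comp:
  "\<sigma> \<in> field_automorphisms \<Longrightarrow> \<tau> \<in> field_automorphisms \<Longrightarrow> \<sigma> \<circ> \<tau> \<in> (field_automorphisms :: ('a \<Rightarrow> 'a) set)"
  by (auto simp: field_automorphisms_def intro: bij_comp)

lemma automorphism_inv:
  assumes "\<sigma> \<in> field_automorphisms"
  shows "inv_into UNIV \<sigma> \<in> (field_automorphisms :: ('a \<Rightarrow> 'a) set)"
proof -
  have s: "\<sigma> (inv_into UNIV \<sigma> x) = x" for x
    using automorphismD(1)[OF assms] by (simp add: bij_is_surj surj_f_inv_f)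
  have "bij (inv_into UNIV \<sigma>)" using automorphismD(1)[OF assms] by (rule bij_imp_bij_inv)
  moreover have "inv_into UNIV \<sigma> 1 = 1" "inv_into UNIV \<sigma> (x + y) = inv_into UNIV \<sigma> x + inv_into UNIV \<sigma> y"
    "inv_into UNIV \<sigma> (x * y) = inv_into UNIV \<sigma> x * inv_into UNIV \<sigma> y" for x y
    by (simp_all add: s automorphismD[OF assms] flip: automorphismD(9)[OF assms])
  ultimately show ?thesis by (simp add: field_automorphisms_def)
qed

definition semilinear :: "'a \<Rightarrow> ('a \<Rightarrow> 'a) \<Rightarrow> 'a \<Rightarrow> 'a" where
  "semilinear c \<sigma> v = c * \<sigma> v"

context
  fixes c :: 'a and \<sigma> :: "'a \<Rightarrow> 'a"
  assumes c: "c \<noteq> 0" and \<sigma>: "\<sigma> \<in> field_automorphisms"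
begin

lemma inj_semilinear: "inj (semilinear c \<sigma>)"
  using c automorphismD[OF \<sigma>] by (auto simp: inj_def semilinear_def)

lemma semilinear_plane: "semilinear c \<sigma> ` plane a b = plane (semilinear c \<sigma> a) (semilinear c \<sigma> b)"
  using automorphismD[OF \<sigma>] by (simp add: plane_def semilinear_def distrib_left)

lemma power_sum_semilinear: "power_sum k (semilinear c \<sigma> ` U) = c ^ k * \<sigma> (power_sum k U)"
proof -
  have "inj_on (semilinear c \<sigma>) U" using inj_semilinear by (rule inj_on_subset) simp
  then show ?thesis
    by (simp add: power_sum_def sum.reindex)
      (simp add: semilinear_def power_mult_distrib automorphismD[OF \<sigma>] sum_distrib_left)
qed

lemma plane_invariant_semilinear: "plane_invariant (semilinear c \<sigma> ` U) = \<sigma> (plane_invariant U)"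
  using c by (simp add: plane_invariant_def power_sum_semilinear power_mult_distrib automorphismD[OF \<sigma>]
      flip: power_mult)

lemma semilinear_eq_0_iff: "semilinear c \<sigma> v = 0 \<longleftrightarrow> v = 0"
  using c automorphismD(9)[OF \<sigma>, of v 0] automorphismD(2)[OF \<sigma>] by (simp add: semilinear_def)

end

lemma id_automorphism: "id \<in> (field_automorphisms :: ('a \<Rightarrow> 'a) set)"
  by (simp add: field_automorphisms_def)

lemma plane_ratio:
  assumes "a \<noteq> 0"
  shows "plane a b = semilinear a id ` plane 1 (b / a)"
  using assms by (simp add: semilinear_plane[OF assms id_automorphism]) (simp add: semilinear_def)

text \<open>The value is the product of the three nonzero vectors of the plane. It will be cancelled
  when two multipliers are compared through their cubes.\<close>

lemma power_sum_3_plane: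
  assumes "a \<noteq> 0" "b \<noteq> 0" "a \<noteq> b"
  shows "power_sum 3 (plane a b) \<noteq> 0"
proof -
  have r: "b / a \<noteq> 0" "b / a \<noteq> 1" using assms by auto
  have "(b / a) ^ 2 + b / a = (b / a) * (b / a + 1)" by (simp add: power2_eq_square distrib_left)
  then have "(b / a) ^ 2 + b / a \<noteq> 0" using r by (auto simp: add_eq_0_iff_eq)
  then show ?thesis using assms
    by (simp add: plane_ratio[OF assms(1)] power_sum_semilinear[OF _ id_automorphism] power_sum_plane r)
qed

text \<open>Over two scalars, the only way for three distinct nonzero vectors to be dependent is
  \<open>c = a + b\<close>, and then all sides are the same plane. So triangles are recognised by
  two different sides.\<close>

lemma independent_triple:
  assumes "a \<noteq> 0" "b \<noteq> 0" "c \<noteq> 0" "a \<noteq> b" "b \<noteq> c" "a \<noteq> c" "plane a b \<noteq> plane b c"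
  shows "independent {a, b, c}"
proof -
  have "c \<noteq> a + b"
  proof
    assume "c = a + b"
    moreover from this have "b + c = a" by (simp add: add.commute[of a b] add_self_left)
    ultimately have "plane b c = plane a b" by (auto simp: plane_def)
    then show False using assms by simp
  qed
  then have "c \<notin> span {a, b}" using assms by (auto simp: span_pair plane_def)
  then have "independent (insert c {a, b})"
    using independent_pair[of a b] assms by (simp add: independent_insert)
  then show ?thesis by (simp add: insert_commute)
qed

end

text \<open>Closure under \<open>f\<close> gives one inclusion. For the other, the image of
  \<open>T\<close> under the right inverse \<open>g\<close> is a preimage of \<open>T\<close> inside
  \<open>D\<close>.\<close>

lemma invariant_under_comp_image:
  assumes "\<And>T. T \<in> D \<Longrightarrow> (`) f ` T \<in> D" "\<And>T. T \<in> D \<Longrightarrow> (`) g ` T \<in> D" "\<And>x. f (g x) = x"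
  shows "invariant_under f D"
  unfolding invariant_under_def
proof (intro equalityI subsetI)
  fix T assume T: "T \<in> D"
  have "(`) f ` (`) g ` T = T" by (simp add: image_image assms(3))
  then show "T \<in> (`) ((`) f) ` D" using assms(2)[OF T] by (metis imageI)
qed (use assms(1) in auto)

text \<open>Multiplication by \<open>x\<close> carries the triangles of \<open>D\<close> covering 1
  bijectively to those covering \<open>x\<close>.\<close>

lemma balanced_if_mult_invariant:
  fixes D :: "'a::field set set set"
  assumes invar: "\<And>a::'a. a \<noteq> 0 \<Longrightarrow> invariant_under ((*) a) D"
  shows "balanced D"
proof -
  have "card {T \<in> D. covers T x} = card {T \<in> D. covers T 1}" if x: "x \<noteq> 0" for x
  proof -
    let ?f = "\<lambda>T. (`) ((*) x) ` T"
    have "inj ((*) x)" using x by (simp add: inj_def)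
    then have inj: "inj ?f" by (simp add: inj_def inj_image_eq_iff)
    have cov: "covers (?f T) x \<longleftrightarrow> covers T 1" for T
    proof -
      have "x \<in> (*) x ` U \<longleftrightarrow> 1 \<in> U" for U using x by (auto simp: image_iff)
      then show ?thesis by (auto simp: covers_def)
    qed
    have "?f ` D = D" using invar[OF x] by (simp add: invariant_under_def)
    then have "{T \<in> D. covers T x} = {T \<in> ?f ` D. covers T x}" by simp
    also have "\<dots> = ?f ` {T \<in> D. covers (?f T) x}" by blast
    finally have "{T \<in> D. covers T x} = ?f ` {T \<in> D. covers T 1}" unfolding cov .
    then show ?thesis by (simp add: card_image inj_on_subset[OF inj])
  qed
  then show ?thesis unfolding balanced_def by blast
qed


text \<open>An index \<open>s\<close> stands for the triangle with vertices 1, \<open>r s 0\<close>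
  and \<open>r s 2\<close>; by \<open>r2\<close> its sides have the ratios \<open>r s 0\<close>,
  \<open>r s 1\<close>, \<open>r s 2\<close>. The assumption \<open>orbits\<close> packs two
  conditions: \<open>s = t\<close> and \<open>i = j\<close> say that different sides have invariants
  in different orbits, and \<open>\<sigma> = \<tau>\<close> says that each orbit has full
  size.\<close>

lemma (in binary_field) exists_invariant_design:
  fixes S :: "'s set" and r :: "'s \<Rightarrow> nat \<Rightarrow> 'a"
  assumes fin: "finite S" and card_S: "card S * 18 * n = 2 ^ n - 2"
    and card_aut: "card (field_automorphisms :: ('a \<Rightarrow> 'a) set) = n"
    and r2: "\<And>s. s \<in> S \<Longrightarrow> r s 2 = r s 0 * r s 1"
    and r01: "\<And>s i. s \<in> S \<Longrightarrow> i < 3 \<Longrightarrow> r s i \<notin> {0, 1}"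
    and orbits: "\<And>s t i j \<sigma> \<tau>. s \<in> S \<Longrightarrow> t \<in> S \<Longrightarrow> i < 3 \<Longrightarrow> j < 3 \<Longrightarrow>
      \<sigma> \<in> field_automorphisms \<Longrightarrow> \<tau> \<in> field_automorphisms \<Longrightarrow>
      \<sigma> (ratio_invariant (r s i)) = \<tau> (ratio_invariant (r t j)) \<Longrightarrow> s = t \<and> i = j \<and> \<sigma> = \<tau>"
  shows "\<exists>D. triangle_design D \<and> balanced D \<and>
    (\<forall>a. a \<noteq> 0 \<longrightarrow> invariant_under (\<lambda>x. a * x) D) \<and>
    (\<forall>\<sigma> \<in> field_automorphisms. invariant_under \<sigma> D)"
proof -
  define A where "A = (field_automorphisms :: ('a \<Rightarrow> 'a) set)"
  define vertex where "vertex s i = (if i = 0 then 1 else if i = 1 then r s 0 else r s 2)"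
    for s and i :: nat
  have vertex: "vertex s i \<noteq> 0" "vertex s 0 \<noteq> vertex s 1" "vertex s 1 \<noteq> vertex s 2" "vertex s 0 \<noteq> vertex s 2"
    if "s \<in> S" for s i
    using r01[OF that, of 0] r01[OF that, of 1] r01[OF that, of 2] r2[OF that]
    by (auto simp: vertex_def)
  define base where "base s i = plane (vertex s i) (vertex s (Suc i mod 3))" for s i
  have i3: "i = 0 \<or> i = 1 \<or> i = 2" if "i < 3" for i :: nat using that by arith
  have vertex_neq: "vertex s i \<noteq> vertex s (Suc i mod 3)" if "s \<in> S" "i < 3" for s i
  proof -
    have "Suc 0 mod 3 = 1" "Suc 1 mod 3 = 2" "Suc 2 mod 3 = (0 :: nat)" by simp_all
    then show ?thesis using vertex(2-4)[OF that(1)] i3[OF that(2)] by metis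
  qed
  have power_sum_base: "power_sum 3 (base s i) \<noteq> 0" if "s \<in> S" "i < 3" for s i
    using vertex[OF that(1)] vertex_neq[OF that] by (simp add: base_def power_sum_3_plane)
  have base_invariant: "plane_invariant (base s i) = ratio_invariant (r s i)" if si: "s \<in> S" "i < 3" for s i
  proof -
    have *: "plane_invariant (plane 1 (r s i)) = ratio_invariant (r s i)"
      using r01[OF si] by (simp add: plane_invariant_plane)
    consider "i = 0" | "i = 1" | "i = 2" using i3[OF si(2)] by blast
    then show ?thesis
    proof cases
      case 1
      then show ?thesis using * by (simp add: base_def vertex_def)
    next
      case 2
      have "r s 0 \<noteq> 0" using r01[OF si(1), of 0] by auto
      then have "base s i = semilinear (r s 0) id ` plane 1 (r s i)"
        using 2 r2[OF si(1)] by (simp add: base_def vertex_def plane_ratio[OF \<open>r s 0 \<noteq> 0\<close>])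
      then show ?thesis using * \<open>r s 0 \<noteq> 0\<close> by (simp add: plane_invariant_semilinear id_automorphism)
    next
      case 3
      then have "base s i = plane 1 (r s i)"
        by (auto simp: base_def vertex_def plane_def add.commute)
      then show ?thesis using * by simp
    qed
  qed
  \<comment> \<open>Planes are indexed by base triangle, side, automorphism and multiplier. Once
    this indexing is bijective, a plane determines the triangle of which it is a side.\<close>
  define G where "G = (\<lambda>(s, i, \<sigma>, c). semilinear c \<sigma> ` base s i)"
  define I where "I = S \<times> {..<3::nat} \<times> A \<times> (-{0::'a})"
  have inj: "inj_on G I"
  proof (rule inj_onI)
    fix p q assume pq: "p \<in> I" "q \<in> I" "G p = G q"
    obtain s i \<sigma> c t j \<tau> d where p: "p = (s, i, \<sigma>, c)" and q: "q = (t, j, \<tau>, d)"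
      by (metis surj_pair)
    have I: "s \<in> S" "t \<in> S" "i < 3" "j < 3" "c \<noteq> 0" "d \<noteq> 0"
      "\<sigma> \<in> field_automorphisms" "\<tau> \<in> field_automorphisms"
      using pq by (auto simp: I_def p q A_def)
    have eq: "semilinear c \<sigma> ` base s i = semilinear d \<tau> ` base t j"
      using pq by (simp add: G_def p q)
    \<comment> \<open>The invariant forgets the multipliers, so it identifies the side and the
      automorphism. The third power sum then shows that \<open>c\<close> and \<open>d\<close> have
      the same cube.\<close>
    then have "\<sigma> (plane_invariant (base s i)) = \<tau> (plane_invariant (base t j))"
      using I by (metis plane_invariant_semilinear)
    then have same: "s = t" "i = j" "\<sigma> = \<tau>" using orbits[of s t i j \<sigma> \<tau>] I by (auto simp: base_invariant)
    have "\<sigma> (power_sum 3 (base s i)) \<noteq> 0"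
      using power_sum_base[of s i] I automorphismD(9)[of \<sigma> _ 0] automorphismD(2)[of \<sigma>] by auto
    moreover have "c ^ 3 * \<sigma> (power_sum 3 (base s i)) = d ^ 3 * \<sigma> (power_sum 3 (base s i))"
      using eq I same by (metis power_sum_semilinear)
    ultimately have "c = d" by (auto intro: cube_inject)
    then show "p = q" using same p q by simp
  qed
  \<comment> \<open>The number \<open>6 * card I\<close> is
    \<open>6 * card S * 3 * n * (2 ^ n - 1)\<close>, which by \<open>card_S\<close> is the bound for
    \<open>6 * card planes\<close>; hence injectivity forces surjectivity.\<close>
  have G_planes: "G ` I = planes"
  proof (rule card_seteq)
    show "G ` I \<subseteq> planes"
    proof
      fix U assume "U \<in> G ` I"
      then obtain s i \<sigma> c where I: "s \<in> S" "i < 3" "\<sigma> \<in> field_automorphisms" "c \<noteq> 0"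
        and U: "U = semilinear c \<sigma> ` base s i" by (auto simp: G_def I_def A_def)
      let ?f = "semilinear c \<sigma>"
      have "?f (vertex s i) \<noteq> 0" "?f (vertex s (Suc i mod 3)) \<noteq> 0" "?f (vertex s i) \<noteq> ?f (vertex s (Suc i mod 3))"
        using I vertex vertex_neq inj_semilinear[of c \<sigma>] by (auto simp: semilinear_eq_0_iff inj_eq)
      then show "U \<in> planes" unfolding planes_eq U base_def using I by (auto simp: semilinear_plane)
    qed
    have "card (G ` I) = card I" using inj by (rule card_image)
    also have "\<dots> = card S * (3 * (n * (2 ^ n - 1)))"
      using card_field card_aut by (simp add: I_def A_def card_cartesian_product Compl_eq_Diff_UNIV card_Diff_subset)
    finally have "6 * card (G ` I) = (2 ^ n - 1) * (card S * 18 * n)" by (simp add: mult_ac)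
    then show "card planes \<le> card (G ` I)" using card_planes_le card_S by simp
  qed (rule finite)
  define tri where "tri c \<sigma> s = (\<lambda>i. semilinear c \<sigma> ` base s i) ` {..<3}" for c \<sigma> s
  define D where "D = {tri c \<sigma> s | c \<sigma> s. c \<noteq> 0 \<and> \<sigma> \<in> A \<and> s \<in> S}"
  have "D \<subseteq> triangles"
  proof
    fix T assume "T \<in> D"
    then obtain c \<sigma> s where I: "s \<in> S" "\<sigma> \<in> field_automorphisms" "c \<noteq> 0" and T: "T = tri c \<sigma> s"
      by (auto simp: D_def A_def)
    let ?f = "semilinear c \<sigma>"
    define v where "v i = ?f (vertex s i)" for i
    have v: "v i \<noteq> 0" "v 0 \<noteq> v 1" "v 1 \<noteq> v 2" "v 0 \<noteq> v 2" for i
      unfolding v_def using I vertex[OF I(1)] inj_semilinear[of c \<sigma>] by (auto simp: semilinear_eq_0_iff inj_eq)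
    have "{..<3::nat} = {0, 1, 2}" by auto
    then have T_eq: "T = {plane (v 0) (v 1), plane (v 1) (v 2), plane (v 2) (v 0)}"
      using I by (simp add: T tri_def base_def v_def semilinear_plane numeral_2_eq_2)
    \<comment> \<open>Dependent vertices would make all sides equal, contrary to the injectivity of
      \<open>G\<close>.\<close>
    have "G (s, 0, \<sigma>, c) \<noteq> G (s, 1, \<sigma>, c)"
      using inj_onD[OF inj, of "(s, 0, \<sigma>, c)" "(s, 1, \<sigma>, c)"] I by (auto simp: I_def A_def)
    then have "plane (v 0) (v 1) \<noteq> plane (v 1) (v 2)"
      using I by (simp add: G_def base_def v_def semilinear_plane numeral_2_eq_2)
    then have "independent {v 0, v 1, v 2}" using v by (intro independent_triple) auto
    moreover have "distinct [v 0, v 1, v 2]" using v by auto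
    ultimately show "T \<in> triangles" unfolding triangles_def T_eq span_pair[symmetric] by blast
  qed
  moreover have "\<exists>!T. T \<in> D \<and> U \<in> T" if "U \<in> planes" for U
  proof -
    have "U \<in> G ` I" using that G_planes by simp
    then obtain s i \<sigma> c where I: "(s, i, \<sigma>, c) \<in> I" and U: "U = G (s, i, \<sigma>, c)"
      by (metis imageE surj_pair)
    show ?thesis
    proof (rule ex1I[of _ "tri c \<sigma> s"])
      show "tri c \<sigma> s \<in> D \<and> U \<in> tri c \<sigma> s"
        using I U by (auto simp: D_def I_def G_def tri_def)
    next
      fix T assume T: "T \<in> D \<and> U \<in> T"
      then obtain d \<tau> t j where J: "(t, j, \<tau>, d) \<in> I" "T = tri d \<tau> t" "U = G (t, j, \<tau>, d)"
        by (auto simp: D_def I_def G_def tri_def)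
      then have "(t, j, \<tau>, d) = (s, i, \<sigma>, c)" using inj_onD[OF inj] I U by metis
      then show "T = tri c \<sigma> s" using J by simp
    qed
  qed
  ultimately have "triangle_design D" unfolding triangle_design_def by blast
  have image_D: "(`) f ` T \<in> D"
    if hyp: "T \<in> D" "f = semilinear a \<rho>" "a \<noteq> 0" "\<rho> \<in> A" for f a \<rho> T
  proof -
    obtain c \<sigma> s where T: "T = tri c \<sigma> s" "c \<noteq> 0" "\<sigma> \<in> A" "s \<in> S" using hyp by (auto simp: D_def)
    \<comment> \<open>This is the product in the semilinear group: the outer automorphism also acts
      on the inner multiplier.\<close>
    have "f (semilinear c \<sigma> v) = semilinear (a * \<rho> c) (\<rho> \<circ> \<sigma>) v" for v
      using hyp by (simp add: semilinear_def A_def automorphismD mult.assoc)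
    then have "(`) f ` T = tri (a * \<rho> c) (\<rho> \<circ> \<sigma>) s" by (simp add: T tri_def image_image)
    moreover have "\<rho> c \<noteq> 0" using hyp T automorphismD(9)[of \<rho> c 0] automorphismD(2)[of \<rho>] by (simp add: A_def)
    moreover have "\<rho> \<circ> \<sigma> \<in> A" using hyp T automorphism_comp by (simp add: A_def)
    moreover have "a * \<rho> c \<noteq> 0" using calculation(2) hyp(3) by simp
    ultimately show ?thesis using T(4) unfolding D_def by blast
  qed
  have id_A: "id \<in> A" using id_automorphism by (simp add: A_def)
  have mult: "invariant_under ((*) a) D" if a: "a \<noteq> 0" for a
  proof (rule invariant_under_comp_image)
    show "a * (inverse a * x) = x" for x using a by simp
    have "(*) b = semilinear b id" for b :: 'a by (simp add: fun_eq_iff semilinear_def)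
    then show "(`) ((*) a) ` T \<in> D" "(`) ((*) (inverse a)) ` T \<in> D" if "T \<in> D" for T
      using image_D[OF that _ _ id_A] a by auto
  qed
  have "invariant_under \<sigma> D" if \<sigma>: "\<sigma> \<in> field_automorphisms" for \<sigma>
  proof (rule invariant_under_comp_image)
    show "\<sigma> (inv_into UNIV \<sigma> x) = x" for x
      using automorphismD(1)[OF \<sigma>] by (simp add: bij_is_surj surj_f_inv_f)
    have *: "\<tau> = semilinear 1 \<tau>" for \<tau> by (simp add: fun_eq_iff semilinear_def)
    show "(`) \<sigma> ` T \<in> D" "(`) (inv_into UNIV \<sigma>) ` T \<in> D" if "T \<in> D" for T
      by (rule image_D[OF that *]; use \<sigma> automorphism_inv[OF \<sigma>] in \<open>simp add: A_def\<close>)+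
  qed
  moreover have "balanced D" using mult by (rule balanced_if_mult_invariant)
  ultimately show ?thesis using \<open>triangle_design D\<close> mult by blast
qed

section \<open>Arithmetic of binary words\<close>

text \<open>A word lists the coefficients of a polynomial over the field with two elements, constant
  term first. Words stand for field elements through evaluation at a root of
  \<open>X ^ n + q\<close>, and they are reduced by substituting \<open>q\<close> for \<open>X ^ n\<close>.\<close>

type_synonym word = "bool list"

primrec word_eval :: "'a::comm_ring_1 \<Rightarrow> word \<Rightarrow> 'a" where
  "word_eval t [] = 0"
| "word_eval t (b # p) = of_bool b + t * word_eval t p"

fun word_add :: "word \<Rightarrow> word \<Rightarrow> word" where
  "word_add [] q = q"
| "word_add p [] = p"
| "word_add (True # p) (True # q) = False # word_add p q"
| "word_add (True # p) (False # q) = True # word_add p q"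
| "word_add (False # p) (True # q) = True # word_add p q"
| "word_add (False # p) (False # q) = False # word_add p q"

text \<open>Intermediate words are bound by \<open>let\<close> before they are passed on. This
  imposes strict evaluation on the simplifier, which will run these functions.\<close>

fun word_mult :: "word \<Rightarrow> word \<Rightarrow> word" where
  "word_mult [] q = []"
| "word_mult (True # p) q = (let r = word_mult p q; s = False # r in word_add q s)"
| "word_mult (False # p) q = (let r = word_mult p q in False # r)"

text \<open>Squaring is additive in characteristic 2 and fixes the coefficients, so it only spreads
  them out.\<close>

fun word_square :: "word \<Rightarrow> word" where
  "word_square [] = []"
| "word_square (b # p) = b # False # word_square p"

fun word_zero :: "word \<Rightarrow> bool" where
  "word_zero [] \<longleftrightarrow> True"
| "word_zero (False # p) \<longleftrightarrow> word_zero p"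
| "word_zero (True # p) \<longleftrightarrow> False"

definition word_fold :: "nat \<Rightarrow> word \<Rightarrow> word \<Rightarrow> word" where
  "word_fold n q w = (let h = drop n w; r = word_mult q h; l = take n w in word_add l r)"

text \<open>Two rounds bring a product of two reduced words below degree \<open>n\<close> when \<open>q\<close> has low degree.
  Nothing depends on this: zero tests ignore trailing zeros, and reduction is sound in any case.\<close>

definition word_reduce :: "nat \<Rightarrow> word \<Rightarrow> word \<Rightarrow> word" where
  "word_reduce n q w = (let v = word_fold n q w in word_fold n q v)"

definition square_mod :: "nat \<Rightarrow> word \<Rightarrow> word \<Rightarrow> word" where
  "square_mod n q w = (let s = word_square w in word_reduce n q s)"

definition mult_mod :: "nat \<Rightarrow> word \<Rightarrow> word \<Rightarrow> word \<Rightarrow> word" where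
  "mult_mod n q v w = (let s = word_mult v w in word_reduce n q s)"

text \<open>These facts are needed in the field and also in its polynomial ring, where \<open>t\<close> is the
  indeterminate and \<open>t ^ n + q\<close> does not vanish.\<close>

context
  fixes t :: "'a::comm_ring_1"
  assumes one_add_one: "1 + 1 = (0 :: 'a)"
begin

lemma char_2_add_self: "x + x = (0 :: 'a)"
  by (metis one_add_one distrib_left mult_1_right mult_zero_right)

lemma char_2_add_self_left: "x + (x + y) = (y :: 'a)"
  by (simp add: char_2_add_self flip: add.assoc)

lemma word_eval_add: "word_eval t (word_add p q) = word_eval t p + word_eval t q"
  by (induction p q rule: word_add.induct)
    (simp_all add: distrib_left add_ac char_2_add_self char_2_add_self_left)

lemma word_eval_mult: "word_eval t (word_mult p q) = word_eval t p * word_eval t q"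
  by (induction p q rule: word_mult.induct) (simp_all add: word_eval_add algebra_simps)

lemma word_eval_square: "word_eval t (word_square p) = word_eval t p ^ 2"
proof (induction p)
  case (Cons b p)
  have "(of_bool b + t * x) ^ 2 = of_bool b + t * (t * x ^ 2)" for x
    by (cases b) (simp_all add: power2_eq_square algebra_simps char_2_add_self_left)
  with Cons show ?case by simp
qed simp

lemma word_eval_take_drop: "word_eval t w = word_eval t (take n w) + t ^ n * word_eval t (drop n w)"
proof (induction n arbitrary: w)
  case (Suc n)
  then show ?case
  proof (cases w)
    case (Cons b v)
    then show ?thesis using Suc[of v] by (simp add: distrib_left mult.assoc)
  qed simp
qed simp

text \<open>A congruence is written as divisibility of a sum, which in characteristic 2 is also the
  difference. Here the low parts cancel and the high part is left, multiplied by the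
  modulus.\<close>

lemma word_eval_fold: "t ^ n + word_eval t q dvd word_eval t (word_fold n q w) + word_eval t w"
proof -
  have "word_eval t (word_fold n q w) + word_eval t w =
      word_eval t (take n w) + word_eval t q * word_eval t (drop n w)
      + (word_eval t (take n w) + t ^ n * word_eval t (drop n w))"
    using word_eval_take_drop[of w n] by (simp add: word_fold_def Let_def word_eval_add word_eval_mult)
  also have "\<dots> = (t ^ n + word_eval t q) * word_eval t (drop n w)"
    by (simp add: distrib_right add_ac char_2_add_self_left)
  finally show ?thesis by simp
qed

text \<open>The two congruences telescope: the intermediate value occurs twice and vanishes.\<close>

lemma word_eval_reduce: "t ^ n + word_eval t q dvd word_eval t (word_reduce n q w) + word_eval t w"
proof -
  have "t ^ n + word_eval t q dvd
      (word_eval t (word_fold n q (word_fold n q w)) + word_eval t (word_fold n q w))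
      + (word_eval t (word_fold n q w) + word_eval t w)"
    by (intro dvd_add word_eval_fold)
  then show ?thesis by (simp add: word_reduce_def Let_def add.assoc char_2_add_self_left)
qed

lemma word_eval_zero: "word_zero w \<Longrightarrow> word_eval t w = 0"
  by (induction w rule: word_zero.induct) simp_all

text \<open>The list \<open>xs\<close> is only a counter. Applied to the word of the indeterminate,
  this computes \<open>X ^ 2 ^ n\<close> modulo \<open>X ^ n + q\<close>.\<close>

lemma square_mod_iterate:
  "t ^ n + word_eval t q dvd word_eval t (fold (\<lambda>_. square_mod n q) xs w) + word_eval t w ^ (2 ^ length xs)"
proof (induction xs arbitrary: w)
  case Nil
  then show ?case by (simp add: char_2_add_self)
next
  case (Cons x xs)
  let ?m = "t ^ n + word_eval t q" and ?v = "square_mod n q w"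
  have sq: "(y + z) ^ 2 = y ^ 2 + (z :: 'a) ^ 2" for y z
    by (simp add: power2_eq_square algebra_simps char_2_add_self_left)
  have frob: "(y + z) ^ (2 ^ k) = y ^ (2 ^ k) + (z :: 'a) ^ (2 ^ k)" for y z k
    by (induction k) (simp_all add: power_mult sq mult.commute[of 2])
  have "?m dvd word_eval t ?v + word_eval t w ^ 2"
    using word_eval_reduce[of n q "word_square w"] by (simp add: square_mod_def word_eval_square)
  \<comment> \<open>A divisor of a sum divides its \<open>2 ^ k\<close>-th power, which is the sum
    of the \<open>2 ^ k\<close>-th powers.\<close>
  then have "?m dvd (word_eval t ?v + word_eval t w ^ 2) ^ (2 ^ length xs)"
    by (rule dvd_trans[OF _ dvd_power]) simp
  then have "?m dvd word_eval t ?v ^ (2 ^ length xs) + word_eval t w ^ (2 ^ length (x # xs))"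
    by (simp add: frob flip: power_mult)
  then have "?m dvd (word_eval t (fold (\<lambda>_. square_mod n q) xs ?v) + word_eval t ?v ^ (2 ^ length xs))
      + (word_eval t ?v ^ (2 ^ length xs) + word_eval t w ^ (2 ^ length (x # xs)))"
    by (rule dvd_add[OF Cons.IH])
  then show ?case by (simp add: add.assoc char_2_add_self_left)
qed

end

text \<open>The third argument counts the squarings, \<open>w\<close> runs through the iterated
  squares and \<open>s\<close> accumulates their sum. The degree is given as
  \<open>length B\<close>, so that no numeral has to be decremented.\<close>

fun word_trace :: "word \<Rightarrow> word list \<Rightarrow> word list \<Rightarrow> word \<Rightarrow> word \<Rightarrow> word" where
  "word_trace q B [] w s = s"
| "word_trace q B (_ # R) w s =
     (let v = square_mod (length B) q w; r = word_add s w in word_trace q B R v r)"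

text \<open>Neighbours are compared without closing the cycle; that the square of the last conjugate
  is the first one follows from \<open>x ^ (2 ^ n) = x\<close> in the field.\<close>

fun frobenius_chain :: "word \<Rightarrow> word list \<Rightarrow> word list \<Rightarrow> bool" where
  "frobenius_chain q B (b # c # R) \<longleftrightarrow>
     (let v = square_mod (length B) q b; s = word_add v c in
      word_zero s \<and> frobenius_chain q B (c # R))"
| "frobenius_chain q B _ \<longleftrightarrow> True"

text \<open>The words in \<open>B\<close> represent the conjugates of an element \<open>\<beta>\<close>. The first test says that
  \<open>X ^ n + q\<close> divides \<open>X ^ 2 ^ n + X\<close>, which provides a root in the field; the last one says that
  the conjugates of \<open>\<beta>\<close> form a basis that is its own dual under the trace form.\<close>

definition self_dual_normal :: "word \<Rightarrow> word list \<Rightarrow> bool" where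
  "self_dual_normal q B \<longleftrightarrow> length q \<le> length B \<and>
     (let x = fold (\<lambda>_. square_mod (length B) q) B [False, True]; d = word_add x [False, True]
      in word_zero d) \<and>
     frobenius_chain q B B \<and>
     (let b = hd B; R = tl B; p = mult_mod (length B) q b b; t = word_trace q B B p []; d = word_add t [True]
      in word_zero d \<and>
        list_all (\<lambda>c. let p = mult_mod (length B) q b c; t = word_trace q B B p [] in word_zero t) R)"

text \<open>This passes from coordinates in the normal basis to coefficients of a
  polynomial.\<close>

fun word_combine :: "word \<Rightarrow> word list \<Rightarrow> word" where
  "word_combine (True # w) (b # B) = (let s = word_combine w B in word_add b s)"
| "word_combine (False # w) (b # B) = word_combine w B"
| "word_combine _ _ = []"

text \<open>Lexicographic order, except that a word and a prefix of it are incomparable. The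
  comparison is thus always decided at a position inside both words and survives appending.\<close>

fun word_less :: "word \<Rightarrow> word \<Rightarrow> bool" where
  "word_less (False # p) (True # q) \<longleftrightarrow> True"
| "word_less (True # p) (False # q) \<longleftrightarrow> False"
| "word_less (False # p) (False # q) \<longleftrightarrow> word_less p q"
| "word_less (True # p) (True # q) \<longleftrightarrow> word_less p q"
| "word_less _ _ \<longleftrightarrow> False"

fun less_suffixes :: "word \<Rightarrow> word \<Rightarrow> bool" where
  "less_suffixes w (b # c # s) \<longleftrightarrow> word_less w (c # s) \<and> less_suffixes w (c # s)"
| "less_suffixes w _ \<longleftrightarrow> True"

text \<open>This is the characterisation of Lyndon words by their proper nonempty suffixes instead
  of their rotations. A suffix that is also a prefix fails the test here, as it does for the usual
  order.\<close>

definition lyndon :: "word \<Rightarrow> bool" where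
  "lyndon w \<longleftrightarrow> less_suffixes w w"

section \<open>Rotations of Lyndon words\<close>

lemma not_word_less_Nil: "\<not> word_less p []"
  by (cases p rule: list.exhaust; cases "hd p") auto

lemma word_less_asym: "word_less p q \<Longrightarrow> \<not> word_less q p"
  by (induction p q rule: word_less.induct) (auto simp: not_word_less_Nil)

lemma word_less_append: "word_less p q \<Longrightarrow> word_less p (q @ s)"
  by (induction p q rule: word_less.induct) auto

lemma less_suffixesD:
  assumes "less_suffixes w s" "0 < m" "m < length s"
  shows "word_less w (drop m s)"
  using assms
proof (induction w s arbitrary: m rule: less_suffixes.induct)
  case (1 w b c s)
  show ?case
  proof (cases "m = 1")
    case False
    then obtain k where "m = Suc k" "0 < k" using "1.prems" by (cases m) auto
    then show ?thesis using 1 by simp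
  qed (use 1 in simp)
qed auto

text \<open>A nontrivial rotation starts with a proper suffix of \<open>w\<close>, and the
  comparison is settled within this suffix.\<close>

lemma lyndon_less_rotate:
  assumes "lyndon w" "w \<noteq> []" "m mod length w \<noteq> 0"
  shows "word_less w (rotate m w)"
proof -
  have "0 < m mod length w" "m mod length w < length w"
    using assms by simp_all
  then have "word_less w (drop (m mod length w) w)"
    using assms by (intro less_suffixesD) (simp_all add: lyndon_def)
  then show ?thesis by (simp add: rotate_drop_take word_less_append)
qed

text \<open>For words of length \<open>n\<close>, rotating by \<open>n - d mod n\<close> thus undoes
  rotating by \<open>d\<close>.\<close>

lemma complement_mod:
  assumes "0 < n"
  shows "(n - d mod n + d) mod n = (0::nat)"
proof -
  have "d mod n < n" using assms by simp
  then have "n - d mod n + d = n + n * (d div n)"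
    using mult_div_mod_eq[of n d] by linarith
  then show ?thesis by simp
qed

text \<open>If \<open>v\<close> were a nontrivial rotation of \<open>w\<close>, then
  \<open>w\<close> would be one of \<open>v\<close>, and each would be less than the other. The case
  \<open>v = w\<close> is included: a Lyndon word has no rotational symmetry, which is why it
  represents an orbit of full size.\<close>

lemma lyndon_rotate_eqD:
  assumes v: "lyndon v" "length v = n" and w: "lyndon w" "length w = n" and "0 < n"
    and eq: "rotate i v = rotate j w"
  shows "v = w" "i mod n = j mod n"
proof -
  have ne: "v \<noteq> []" "w \<noteq> []" using v w \<open>0 < n\<close> by auto
  have id: "rotate k u = u" if "k mod n = 0" "length u = n" for k and u :: word
    using that by (metis rotate_conv_mod rotate0 id_apply)
  have "rotate (n - i mod n) (rotate i v) = v"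
    by (simp only: rotate_rotate complement_mod \<open>0 < n\<close> id v)
  then have v_eq: "v = rotate (n - i mod n + j) w" by (simp add: eq rotate_rotate)
  have d: "(n - i mod n + j) mod n = 0"
  proof (rule ccontr)
    assume d: "(n - i mod n + j) mod n \<noteq> 0" (is "?d mod n \<noteq> 0")
    then have "word_less w v" using lyndon_less_rotate[OF w(1) ne(2), of ?d] w v_eq by simp
    have "w = rotate (n - ?d mod n) v"
      by (simp only: v_eq rotate_rotate complement_mod \<open>0 < n\<close> id w)
    moreover have "(n - ?d mod n) mod n \<noteq> 0"
    proof -
      have "0 < ?d mod n" "?d mod n < n" using d \<open>0 < n\<close> by simp_all
      then have "n - ?d mod n < n" "n - ?d mod n \<noteq> 0" by linarith+
      then show ?thesis by (metis mod_less)
    qed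
    ultimately have "word_less v w" using lyndon_less_rotate[OF v(1) ne(1), of "n - ?d mod n"] v by metis
    then show False using word_less_asym \<open>word_less w v\<close> by blast
  qed
  then show "v = w" using v_eq id w by metis
  have "(n - i mod n + j mod n) mod n = 0" using d by (simp add: mod_simps)
  moreover have "i mod n < n" "j mod n < n" using \<open>0 < n\<close> by simp_all
  ultimately show "i mod n = j mod n"
    by (cases "i mod n \<le> j mod n") (auto simp: le_mod_geq)
qed


section \<open>Cyclic sums, and words as polynomials\<close>

lemma sum_lessThan_cyclic:
  fixes f :: "nat \<Rightarrow> 'a::ab_group_add"
  assumes "f n = f 0"
  shows "(\<Sum>i<n. f (Suc i)) = (\<Sum>i<n. f i)"
proof -
  have "f 0 + (\<Sum>i<n. f (Suc i)) = (\<Sum>i<n. f i) + f n"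
    by (simp flip: sum.lessThan_Suc_shift)
  then show ?thesis using assms by (simp add: add.commute)
qed

lemma poly_word_eval: "poly (word_eval [:0, 1:] w) a = word_eval a w"
  by (induction w) simp_all

lemma degree_word_eval: "length w \<le> n \<Longrightarrow> 0 < n \<Longrightarrow> degree (word_eval [:0, 1 :: 'a::field:] w) < n"
proof (induction w arbitrary: n)
  case (Cons b w)
  show ?case
  proof (cases "length w = 0")
    case False
    then have "degree (word_eval [:0, 1 :: 'a:] w) < n - 1"
      using Cons.IH[of "n - 1"] Cons.prems by (cases w) auto
    then have "degree ([:0, 1:] * word_eval [:0, 1 :: 'a:] w) < n"
      using degree_pCons_le[of 0 "word_eval [:0, 1 :: 'a:] w"] by simp
    then show ?thesis using Cons.prems by (cases b) (auto intro: degree_add_less)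
  qed (use Cons.prems in \<open>cases b; simp\<close>)
qed simp

section \<open>Normal bases and field automorphisms\<close>

lemma (in binary_field) power_order_eq_self: "x ^ (2 ^ n) = (x :: 'a)"
  using finite_field_power_card_eq_same[of x] by (simp add: card_field)

lemma (in binary_field) power_2_power_add: "(x + y) ^ (2 ^ k) = x ^ (2 ^ k) + (y :: 'a) ^ (2 ^ k)"
  by (induction k) (simp_all add: power_mult power2_add mult.commute[of 2])

text \<open>The zero test yields a factorisation of \<open>X ^ 2 ^ n + X\<close> into
  \<open>P = X ^ n + q\<close> and a cofactor of degree \<open>2 ^ n - n\<close>. If
  \<open>P\<close> had no root, all \<open>2 ^ n\<close> elements of the field would be roots of the
  cofactor, which are too many.\<close>

lemma (in binary_field) exists_root:
  assumes "length B = n" and q: "length q \<le> n"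
    and zero: "word_zero (word_add (fold (\<lambda>_. square_mod n q) B [False, True]) [False, True])"
  shows "\<exists>a::'a. a ^ n = word_eval a q"
proof (rule ccontr)
  assume no_root: "\<nexists>a::'a. a ^ n = word_eval a q"
  define X :: "'a poly" where "X = [:0, 1:]"
  define P where "P = X ^ n + word_eval X q"
  have "0 < n" using odd_n by (cases n) auto
  have XX: "X ^ k = monom 1 k" for k by (simp add: X_def monom_altdef)
  have degree_P: "degree P = n"
    unfolding P_def using degree_word_eval[OF q \<open>0 < n\<close>, where ?'a = 'a, folded X_def]
    by (subst degree_add_eq_left) (simp_all add: XX degree_monom_eq)
  have char: "1 + 1 = (0 :: 'a poly)" using add_self[of 1] by (simp add: one_pCons)
  have "word_eval X (word_add (fold (\<lambda>_. square_mod n q) B [False, True]) [False, True]) = 0"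
    using zero by (rule word_eval_zero[OF char])
  then have "word_eval X (fold (\<lambda>_. square_mod n q) B [False, True]) = X"
    unfolding word_eval_add[OF char] using char_2_add_self_left[OF char]
    by (simp add: add_eq_0_iff2)
  moreover have "P dvd word_eval X (fold (\<lambda>_. square_mod n q) B [False, True]) + X ^ (2 ^ n)"
    using square_mod_iterate[OF char, of X n q B "[False, True]"] assms(1) by (simp add: P_def)
  ultimately have "P dvd X + X ^ (2 ^ n)" by simp
  then obtain Q where Q: "X + X ^ (2 ^ n) = P * Q" by (elim dvdE)
  have "1 < (2 ^ n :: nat)" using \<open>0 < n\<close> by (simp add: one_less_power del: One_nat_def)
  moreover have "degree X = 1" by (simp add: X_def)
  ultimately have degree: "degree (X + X ^ (2 ^ n)) = 2 ^ n"
    by (subst degree_add_eq_right) (simp_all add: XX degree_monom_eq \<open>degree X = 1\<close>)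
  then have "Q \<noteq> 0" "P \<noteq> 0" using Q by auto
  then have "n + degree Q = 2 ^ n" using degree degree_P by (simp add: Q degree_mult_eq)
  \<comment> \<open>Every element is a root of the product, and by assumption not of
    \<open>P\<close>.\<close>
  moreover have "poly Q a = 0" for a
  proof -
    have "poly P a \<noteq> 0"
      using no_root add_eq_0_iff_eq by (auto simp: P_def X_def poly_word_eval)
    moreover have "poly (X + X ^ (2 ^ n)) a = 0"
      by (simp add: X_def power_order_eq_self add_self)
    ultimately show ?thesis by (simp add: Q)
  qed
  then have "CARD('a) \<le> degree Q" using card_poly_roots_bound[OF \<open>Q \<noteq> 0\<close>] by simp
  ultimately show False using card_field \<open>0 < n\<close> by simp
qed

locale normal_basis = binary_field n field_type for n and field_type :: "'a::finite_field itself" +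
  fixes q :: word and B :: "word list" and \<alpha> :: 'a
  assumes length_B: "length B = n" and self_dual: "self_dual_normal q B"
    and root: "\<alpha> ^ n = word_eval \<alpha> q"
begin

lemma n_pos: "0 < n"
  using odd_n by (cases n) auto

lemma self_dualD:
  "length q \<le> n" "frobenius_chain q B B"
  "word_zero (word_add (word_trace q B B (mult_mod n q (hd B) (hd B)) []) [True])"
  "b \<in> set (tl B) \<Longrightarrow> word_zero (word_trace q B B (mult_mod n q (hd B) b) [])"
  using self_dual unfolding self_dual_normal_def Let_def length_B list_all_iff by blast+

abbreviation ev :: "word \<Rightarrow> 'a" where
  "ev \<equiv> word_eval \<alpha>"

lemma one_add_one: "1 + 1 = (0 :: 'a)"
  by (rule add_self)

lemmas ev_simps = word_eval_add[OF one_add_one] word_eval_mult[OF one_add_one] word_eval_square[OF one_add_one]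

text \<open>The modulus vanishes at the root, so divisibility by it turns into equality.\<close>

lemma ev_reduce: "ev (word_reduce n q w) = ev w"
  using word_eval_reduce[OF one_add_one, of \<alpha> n q w] by (simp add: root add_self add_eq_0_iff_eq)

lemma ev_square_mod: "ev (square_mod n q w) = ev w ^ 2"
  by (simp add: square_mod_def ev_reduce ev_simps)

lemma ev_mult_mod: "ev (mult_mod n q v w) = ev v * ev w"
  by (simp add: mult_mod_def ev_reduce ev_simps)

lemma ev_eq_0: "word_zero w \<Longrightarrow> ev w = 0"
  by (rule word_eval_zero[OF one_add_one])

definition \<beta> :: 'a where
  "\<beta> = ev (hd B)"

section \<open>The trace form and coordinates in the normal basis\<close>

definition trace :: "'a \<Rightarrow> 'a" where
  "trace z = (\<Sum>l<n. z ^ (2 ^ l))"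

lemma ev_chain:
  "frobenius_chain q B R \<Longrightarrow> i < length R \<Longrightarrow> ev (R ! i) = ev (hd R) ^ (2 ^ i)"
proof (induction R arbitrary: i)
  case (Cons b R)
  show ?case
  proof (cases R)
    case Nil
    then show ?thesis using Cons.prems by simp
  next
    case R: (Cons c R')
    have "word_zero (word_add (square_mod n q b) c)" "frobenius_chain q B R"
      using Cons.prems by (simp_all add: R Let_def length_B)
    then have c: "ev c = ev b ^ 2"
      using ev_eq_0[of "word_add (square_mod n q b) c"]
      by (simp add: ev_simps ev_square_mod add_eq_0_iff_eq)
    show ?thesis
    proof (cases i)
      case (Suc j)
      then have "ev (R ! j) = ev (hd R) ^ (2 ^ j)"
        using Cons \<open>frobenius_chain q B R\<close> by simp
      then show ?thesis using Suc by (simp add: R c flip: power_mult)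
    qed simp
  qed
qed simp

lemma ev_B: "i < n \<Longrightarrow> ev (B ! i) = \<beta> ^ (2 ^ i)"
  using ev_chain[OF self_dualD(2), of i] by (simp add: \<beta>_def length_B)

lemma ev_trace: "ev (word_trace q B R w s) = ev s + (\<Sum>l<length R. ev w ^ (2 ^ l))"
proof (induction R arbitrary: w s)
  case (Cons x R)
  then show ?case
    by (simp add: Let_def length_B ev_square_mod ev_simps sum.lessThan_Suc_shift add.assoc
        del: sum.lessThan_Suc flip: power_mult)
qed simp

text \<open>Squaring permutes the summands cyclically, because
  \<open>z ^ (2 ^ n) = z\<close>.\<close>

lemma trace_frobenius: "trace (z ^ (2 ^ k)) = trace z"
proof (induction k arbitrary: z)
  case (Suc k)
  have "trace (z ^ 2) = (\<Sum>l<n. z ^ (2 ^ Suc l))"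
    by (simp add: trace_def flip: power_mult)
  also have "\<dots> = trace z"
    unfolding trace_def by (rule sum_lessThan_cyclic) (simp add: power_order_eq_self)
  finally show ?case using Suc[of "z ^ 2"] by (simp flip: power_mult)
qed simp

lemma trace_add: "trace (x + y) = trace x + trace y"
  by (simp add: trace_def power_2_power_add sum.distrib)

lemma trace_0: "trace 0 = 0"
  by (simp add: trace_def power_0_left)

lemma trace_sum: "trace (sum f A) = (\<Sum>a\<in>A. trace (f a))"
  by (induction A rule: infinite_finite_induct) (simp_all add: trace_0 trace_add)

lemma trace_\<beta>:
  assumes "i < n"
  shows "trace (\<beta> * \<beta> ^ (2 ^ i)) = of_bool (i = 0)"
proof -
  have "trace (\<beta> * \<beta> ^ (2 ^ i)) = ev (word_trace q B B (mult_mod n q (hd B) (B ! i)) [])"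
    using assms by (simp add: ev_trace ev_mult_mod ev_B length_B trace_def flip: \<beta>_def)
  also have "\<dots> = of_bool (i = 0)"
  proof (cases "i = 0")
    case True
    have "word_zero (word_add (word_trace q B B (mult_mod n q (hd B) (hd B)) []) [True])"
      by (rule self_dualD)
    from ev_eq_0[OF this] have "ev (word_trace q B B (mult_mod n q (hd B) (hd B)) []) = 1"
      by (simp add: ev_simps add_eq_0_iff_eq)
    moreover have "B ! 0 = hd B" using length_B n_pos by (cases B) auto
    ultimately show ?thesis using True by simp
  next
    case False
    then have "B ! i \<in> set (tl B)"
      using assms length_B by (cases B; cases i) auto
    then have "word_zero (word_trace q B B (mult_mod n q (hd B) (B ! i)) [])"
      by (rule self_dualD)
    then show ?thesis using False by (simp add: ev_eq_0)
  qed
  finally show ?thesis .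
qed

text \<open>For \<open>i \<le> j\<close> the product is the image of
  \<open>\<beta> * \<beta> ^ (2 ^ (j - i))\<close> under a Frobenius power, which preserves the
  trace. So the first row of the Gram matrix, the only one tested, determines all of it.\<close>

lemma trace_dual:
  assumes "i < n" "j < n"
  shows "trace (\<beta> ^ (2 ^ i) * \<beta> ^ (2 ^ j)) = of_bool (i = j)"
proof -
  have le: "trace (\<beta> ^ (2 ^ i) * \<beta> ^ (2 ^ j)) = of_bool (i = j)" if "i \<le> j" "j < n" for i j
  proof -
    have "(\<beta> * \<beta> ^ (2 ^ (j - i))) ^ (2 ^ i) = \<beta> ^ (2 ^ i) * \<beta> ^ (2 ^ (j - i) * 2 ^ i)"
      by (simp add: power_mult_distrib flip: power_mult)
    also have "2 ^ (j - i) * 2 ^ i = (2 ^ j :: nat)" using that by (simp flip: power_add)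
    finally have "trace (\<beta> ^ (2 ^ i) * \<beta> ^ (2 ^ j)) = trace (\<beta> * \<beta> ^ (2 ^ (j - i)))"
      by (metis trace_frobenius)
    then show ?thesis using that by (auto simp: trace_\<beta>)
  qed
  show ?thesis
  proof (cases "i \<le> j")
    case False
    then show ?thesis using le[of j i] assms by (simp add: mult.commute eq_commute[of i j])
  qed (use le assms in simp)
qed

definition normal :: "word \<Rightarrow> 'a" where
  "normal w = (\<Sum>i<n. of_bool (w ! i) * \<beta> ^ (2 ^ i))"

text \<open>Self-duality lets the trace against a basis element read off a coordinate, which gives
  uniqueness of coordinates at once.\<close>

lemma trace_normal:
  assumes "j < n"
  shows "trace (normal w * \<beta> ^ (2 ^ j)) = of_bool (w ! j)"
proof -
  have "trace (of_bool (w ! i) * \<beta> ^ (2 ^ i) * \<beta> ^ (2 ^ j)) = (if i = j then of_bool (w ! j) else 0)"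
    if "i < n" for i
    using trace_dual[OF that assms] by (cases "w ! i"; cases "i = j") (simp_all add: trace_0)
  then have "trace (normal w * \<beta> ^ (2 ^ j)) = (\<Sum>i<n. if i = j then of_bool (w ! j) else 0)"
    by (simp add: normal_def sum_distrib_right trace_sum del: sum_of_bool_mult_eq)
  then show ?thesis using assms by simp
qed

lemma normal_inject:
  assumes "normal v = normal w" "length v = n" "length w = n"
  shows "v = w"
proof (rule nth_equalityI)
  fix j assume "j < length v"
  then have "of_bool (v ! j) = (of_bool (w ! j) :: 'a)"
    using trace_normal[of j v] trace_normal[of j w] assms by simp
  then show "v ! j = w ! j" by (cases "v ! j"; cases "w ! j") simp_all
qed (use assms in simp)

text \<open>Spanning comes from counting: the words of length \<open>n\<close> and the field have
  the same size, and \<open>normal\<close> is injective.\<close>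

lemma normal_surj: "\<exists>w. length w = n \<and> normal w = x"
proof -
  let ?W = "{w :: word. set w \<subseteq> UNIV \<and> length w = n}"
  have "inj_on normal ?W" using normal_inject by (auto intro: inj_onI)
  then have "card (normal ` ?W) = CARD('a)"
    using card_lists_length_eq[of "UNIV :: bool set" n] by (simp add: card_image card_field)
  then have "normal ` ?W = UNIV" by (intro card_subset_eq) auto
  then show ?thesis by (metis (mono_tags, lifting) UNIV_I imageE mem_Collect_eq)
qed

text \<open>Squaring moves the coefficient of \<open>\<beta> ^ (2 ^ i)\<close> to the next
  conjugate, a rotation to the right, whereas \<open>rotate\<close> turns to the left; so the two
  cancel.\<close>

lemma normal_rotate: "length w = n \<Longrightarrow> normal (rotate k w) ^ (2 ^ k) = normal w"
proof (induction k)
  case (Suc k)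
  have square_sum: "(sum f A) ^ 2 = (\<Sum>a\<in>A. f a ^ 2)" for f :: "nat \<Rightarrow> 'a" and A
    by (induction A rule: infinite_finite_induct) (simp_all add: power2_add)
  have "normal (rotate1 v) ^ 2 = normal v" if v: "length v = n" for v
  proof -
    have "normal (rotate1 v) ^ 2 = (\<Sum>i<n. (of_bool (rotate1 v ! i) * \<beta> ^ (2 ^ i)) ^ 2)"
      by (simp only: normal_def square_sum)
    also have "\<dots> = (\<Sum>i<n. of_bool (v ! (Suc i mod n)) * \<beta> ^ (2 ^ Suc i))"
    proof (rule sum.cong)
      fix i assume "i \<in> {..<n}"
      then have "rotate1 v ! i = v ! (Suc i mod n)" using v by (simp add: nth_rotate1)
      then show "(of_bool (rotate1 v ! i) * \<beta> ^ (2 ^ i)) ^ 2 = of_bool (v ! (Suc i mod n)) * \<beta> ^ (2 ^ Suc i)"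
        by (cases "v ! (Suc i mod n)") (simp_all add: mult.commute flip: power_mult)
    qed simp
    also have "\<dots> = (\<Sum>i<n. of_bool (v ! (i mod n)) * \<beta> ^ (2 ^ i))"
      by (rule sum_lessThan_cyclic) (simp add: power_order_eq_self)
    also have "\<dots> = normal v" unfolding normal_def by (intro sum.cong) simp_all
    finally show ?thesis .
  qed
  from this[of "rotate k w"] Suc show ?case by (simp add: power_mult)
qed simp

lemma ev_combine: "length w = n \<Longrightarrow> ev (word_combine w B) = normal w"
proof -
  have "length w = length R \<Longrightarrow> ev (word_combine w R) = (\<Sum>i<length R. of_bool (w ! i) * ev (R ! i))" for w R
    by (induction w R rule: word_combine.induct)
      (simp_all add: Let_def ev_simps sum.lessThan_Suc_shift del: sum.lessThan_Suc sum_of_bool_mult_eq)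
  then show "length w = n \<Longrightarrow> ev (word_combine w B) = normal w"
    by (simp add: length_B normal_def ev_B)
qed

section \<open>The automorphisms are the \<open>n\<close> Frobenius powers\<close>

lemma word_eval_frobenius: "word_eval (t ^ (2 ^ i)) w = word_eval t w ^ (2 ^ i)" for t :: 'a
proof (induction w)
  case (Cons b w)
  then show ?case by (cases b) (simp_all add: power_2_power_add power_mult_distrib)
qed (simp add: power_0_left)

lemma frobenius_automorphism: "(\<lambda>x. x ^ (2 ^ i)) \<in> (field_automorphisms :: ('a \<Rightarrow> 'a) set)"
proof -
  have "x = y" if "x ^ (2 ^ i) = y ^ (2 ^ i)" for x y :: 'a
  proof -
    have "(x + y) ^ (2 ^ i) = 0" using that by (simp add: power_2_power_add add_self)
    then show ?thesis by (simp add: add_eq_0_iff_eq)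
  qed
  then have "bij (\<lambda>x :: 'a. x ^ (2 ^ i))"
    by (intro finite_UNIV_inj_surj[THEN bijI[rotated]] injI) auto
  then show ?thesis
    by (simp add: field_automorphisms_def power_2_power_add power_mult_distrib)
qed

text \<open>The conjugates of \<open>\<beta>\<close> are distinct, since the trace form takes
  different values on them.\<close>

lemma inj_frobenius: "inj_on (\<lambda>i (x :: 'a). x ^ (2 ^ i)) {..<n}"
proof (rule inj_onI)
  fix i j assume ij: "i \<in> {..<n}" "j \<in> {..<n}" "(\<lambda>x :: 'a. x ^ (2 ^ i)) = (\<lambda>x. x ^ (2 ^ j))"
  then have "\<beta> ^ (2 ^ i) = \<beta> ^ (2 ^ j)" by metis
  then have "(of_bool (i = j) :: 'a) = 1" using trace_dual[of i i] trace_dual[of i j] ij by simp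
  then show "i = j" by (cases "i = j") simp_all
qed

text \<open>An automorphism sends \<open>\<alpha>\<close> to a root of \<open>X ^ n + q\<close>. The
  \<open>n\<close> conjugates of \<open>\<alpha>\<close> are all the roots, and every element is a
  polynomial in \<open>\<alpha>\<close>, so the automorphism agrees everywhere with a Frobenius
  power.\<close>

lemma field_automorphisms_eq:
  "(field_automorphisms :: ('a \<Rightarrow> 'a) set) = (\<lambda>i x. x ^ (2 ^ i)) ` {..<n}"
proof (intro equalityI subsetI)
  fix \<sigma> :: "'a \<Rightarrow> 'a" assume \<sigma>: "\<sigma> \<in> field_automorphisms"
  define P where "P = monom 1 n + word_eval [:0, 1 :: 'a:] q"
  have P: "poly P a = a ^ n + word_eval a q" for a by (simp add: P_def poly_monom poly_word_eval)
  then have degree: "degree P = n"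
    unfolding P_def using degree_word_eval[of q n] n_pos self_dualD(1)
    by (subst degree_add_eq_left) (simp_all add: degree_monom_eq)
  then have "P \<noteq> 0" using n_pos by auto
  define R where "R = (\<lambda>i. \<alpha> ^ (2 ^ i)) ` {..<n}"
  \<comment> \<open>Two Frobenius powers that agree on \<open>\<alpha>\<close> agree on all words
    evaluated at \<open>\<alpha>\<close>, that is, on the whole field.\<close>
  have "inj_on (\<lambda>i. \<alpha> ^ (2 ^ i)) {..<n}"
  proof (rule inj_onI)
    fix i j assume ij: "i \<in> {..<n}" "j \<in> {..<n}" "\<alpha> ^ (2 ^ i) = \<alpha> ^ (2 ^ j)"
    have "x ^ (2 ^ i) = x ^ (2 ^ j)" for x :: 'a
      using normal_surj[of x] ev_combine word_eval_frobenius ij(3) by metis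
    then show "i = j" using inj_onD[OF inj_frobenius, of i j] ij by auto
  qed
  then have "card R = n" by (simp add: R_def card_image)
  moreover have "R \<subseteq> {a. poly P a = 0}"
  proof
    fix a assume "a \<in> R"
    then obtain i where a: "a = \<alpha> ^ (2 ^ i)" by (auto simp: R_def)
    have "a ^ n = (\<alpha> ^ n) ^ (2 ^ i)" by (simp add: a mult.commute flip: power_mult)
    then show "a \<in> {a. poly P a = 0}" by (simp add: P a word_eval_frobenius root add_self)
  qed
  moreover have "card {a. poly P a = 0} \<le> n"
    using card_poly_roots_bound[OF \<open>P \<noteq> 0\<close>] by (simp add: degree)
  ultimately have roots: "R = {a. poly P a = 0}" by (intro card_seteq) auto
  have word: "\<sigma> (ev w) = word_eval (\<sigma> \<alpha>) w" for w
    by (induction w) (simp_all add: automorphismD[OF \<sigma>])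
  have "\<sigma> \<alpha> ^ n = word_eval (\<sigma> \<alpha>) q"
    by (simp add: root word flip: automorphismD(6)[OF \<sigma>])
  then have "\<sigma> \<alpha> \<in> R" unfolding roots by (simp add: P add_self)
  then obtain i where i: "i < n" "\<sigma> \<alpha> = \<alpha> ^ (2 ^ i)" by (auto simp: R_def)
  have "\<sigma> x = x ^ (2 ^ i)" for x
    using normal_surj[of x] ev_combine word_eval_frobenius word i(2) by metis
  then show "\<sigma> \<in> (\<lambda>i x. x ^ (2 ^ i)) ` {..<n}" using i(1) by blast
next
  fix \<sigma> assume "\<sigma> \<in> (\<lambda>i (x :: 'a). x ^ (2 ^ i)) ` {..<n}"
  then show "\<sigma> \<in> field_automorphisms" using frobenius_automorphism by blast
qed

lemma card_field_automorphisms: "card (field_automorphisms :: ('a \<Rightarrow> 'a) set) = n"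
  unfolding field_automorphisms_eq using card_image[OF inj_frobenius] by simp

end

section \<open>Checking a list of triangles\<close>

primrec num_word :: "num \<Rightarrow> word" where
  "num_word num.One = [True]"
| "num_word (num.Bit0 k) = False # num_word k"
| "num_word (num.Bit1 k) = True # num_word k"

text \<open>Binary digits, lowest first, following the syntax of numerals. The case 0 is separate
  because \<open>num_of_nat\<close> sends both 0 and 1 to \<open>num.One\<close>. The highest digit
  is always \<open>True\<close>; so is the last letter of a Lyndon word of length at least two,
  which is therefore coded by a number with exactly as many digits as it has letters.\<close>

definition word :: "nat \<Rightarrow> word" where
  "word k = (if k = 0 then [] else num_word (num_of_nat k))"

lemma num_word_nonempty: "num_word k \<noteq> []"
  by (cases k) auto

lemma num_word_inject: "num_word k = num_word l \<Longrightarrow> k = l"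
proof (induction k arbitrary: l)
  case One
  then show ?case using num_word_nonempty by (cases l) (simp_all add: num_word_nonempty num_word_nonempty[symmetric])
next
  case (Bit0 k)
  then show ?case by (cases l) auto
next
  case (Bit1 k)
  then show ?case using num_word_nonempty[of k] by (cases l) auto
qed

lemma word_inject:
  assumes "word k = word l"
  shows "k = l"
proof (cases "k = 0 \<or> l = 0")
  case True
  then show ?thesis
    using assms by (auto simp: word_def num_word_nonempty num_word_nonempty[symmetric] split: if_splits)
next
  case False
  then have "num_of_nat k = num_of_nat l"
    using assms num_word_inject by (simp add: word_def)
  then have "nat_of_num (num_of_nat k) = nat_of_num (num_of_nat l)" by simp
  then show ?thesis using False by (simp add: num_of_nat_inverse)
qed

text \<open>With \<open>u = r ^ 2 + r\<close> and \<open>K\<close> the element with normal coordinates \<open>rotate m (word k)\<close>, the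
  zero test expresses \<open>K * u ^ 2 = (u + 1) ^ 3\<close>, so that \<open>K\<close> is the invariant of the ratio \<open>r\<close>.
  It fails for \<open>u = 0\<close>, so it also excludes the ratios 0 and 1.\<close>

definition check_ratio :: "word \<Rightarrow> word list \<Rightarrow> word \<Rightarrow> nat \<Rightarrow> nat \<Rightarrow> bool" where
  "check_ratio q B r k m = (let
     w = word k; v = rotate m w; y = word_combine v B;
     r2 = square_mod (length B) q r; u = word_add r2 r; u1 = word_add [True] u;
     u2 = square_mod (length B) q u; u3 = word_add [True] u2;
     s = word_mult y u2; t = word_mult u3 u1; d = word_add s t; e = word_reduce (length B) q d
   in length w = length B \<and> lyndon w \<and> word_zero e)"

text \<open>A row \<open>(x, y, k, m, k', m', k'', m'')\<close> encodes the triangle with vertices \<open>1, x, x * y\<close>,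
  whose sides have the ratios \<open>x, y, x * y\<close>; \<open>(k, m)\<close>, \<open>(k', m')\<close>, \<open>(k'', m'')\<close> certify their
  invariants.\<close>

type_synonym row = "nat \<times> nat \<times> nat \<times> nat \<times> nat \<times> nat \<times> nat \<times> nat"

fun check_row :: "word \<Rightarrow> word list \<Rightarrow> row \<Rightarrow> bool" where
  "check_row q B (x, y, k, m, k', m', k'', m'') = (let
     a = word x; b = word y; c = mult_mod (length B) q a b
   in check_ratio q B a k m \<and> check_ratio q B b k' m' \<and> check_ratio q B c k'' m'')"

fun keys :: "row \<Rightarrow> nat list" where
  "keys (x, y, k, m, k', m', k'', m'') = [k, k', k'']"

text \<open>The keys of successive lists of rows lie in successive intervals, so that distinctness has to be
  tested only within each list.\<close>

definition check_rows :: "word \<Rightarrow> word list \<Rightarrow> nat \<Rightarrow> nat \<Rightarrow> row list \<Rightarrow> bool" where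
  "check_rows q B l h rows \<longleftrightarrow> list_all (check_row q B) rows \<and>
     (let ks = concat (map keys rows) in distinct ks \<and> list_all (\<lambda>k. l \<le> k \<and> k < h) ks)"

text \<open>The rows are hidden behind the quantifier, so that a chain of extensions carries along
  only their number and a bound for their keys.\<close>

definition triangle_system :: "word \<Rightarrow> word list \<Rightarrow> nat \<Rightarrow> nat \<Rightarrow> bool" where
  "triangle_system q B N h \<longleftrightarrow> (\<exists>rows. length rows = N \<and> check_rows q B 0 h rows)"

section \<open>Evaluation of the checks by rewriting\<close>

lemma word_numeral: "word (numeral k) = num_word k"
  by (simp add: word_def)

text \<open>When the simplifier evaluates the checks, the list under \<open>length\<close> acts as a unary numeral.\<close>

lemma take_length_eval:
  "take (length []) w = []" "take (length (x # xs)) [] = []"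
  "take (length (x # xs)) (b # w) = b # take (length xs) w"
  by simp_all

lemma drop_length_eval:
  "drop (length []) w = w" "drop (length (x # xs)) [] = []"
  "drop (length (x # xs)) (b # w) = drop (length xs) w"
  by simp_all

text \<open>The counts 0 and 1 are not of the form \<open>numeral k\<close> and need equations of
  their own; any other literal is lowered by one per rotation.\<close>

lemma rotate_eval:
  "rotate 0 w = w" "rotate 1 (b # w) = w @ [b]"
  "rotate (numeral k) (b # w) = (let v = w @ [b] in rotate (pred_numeral k) v)"
  by (simp_all only: numeral_eq_Suc One_nat_def rotate_Suc rotate1_rotate_swap rotate1.simps rotate0 id_apply Let_def)

lemma length_eval:
  "length [] = length [] \<longleftrightarrow> True" "length (x # xs) = length (y # ys) \<longleftrightarrow> length xs = length ys"
  "length [] \<le> length ys \<longleftrightarrow> True" "length (x # xs) \<le> length (y # ys) \<longleftrightarrow> length xs \<le> length ys"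
  by simp_all

lemma mem_set_eval: "k \<in> set [] \<longleftrightarrow> False" "k \<in> set (l # ls) \<longleftrightarrow> k = l \<or> k \<in> set ls"
  by simp_all

lemmas eval_simps =
  check_rows_def check_row.simps check_ratio_def keys.simps self_dual_normal_def
  frobenius_chain.simps word_trace.simps fold_simps
  word_numeral num_word.simps word_add.simps word_mult.simps word_square.simps word_zero.simps
  word_fold_def word_reduce_def square_mod_def mult_mod_def word_combine.simps
  word_less.simps less_suffixes.simps lyndon_def
  take_length_eval drop_length_eval rotate_eval length_eval mem_set_eval
  append.simps concat.simps list.map list.pred_inject distinct.simps list.sel
  Let_def simp_thms pred_numeral_simps Num.BitM.simps
  numeral_eq_iff numeral_le_iff numeral_less_iff num.inject num.distinct le_num_simps less_num_simps

text \<open>As a congruence rule this lets the simplifier compute the count, a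
  \<open>pred_numeral\<close> term, while leaving the word alone.\<close>

lemma rotate_eval_cong: "k = l \<Longrightarrow> rotate k w = rotate l w"
  by simp

text \<open>A reflexive congruence rule keeps the simplifier from traversing the arguments again at every
  recursive step; arguments are computed by the enclosing \<open>let\<close> instead.\<close>

lemmas eval_congs = let_weak_cong rotate_eval_cong
  refl[of "word_add v w"]
  refl[of "word_mult v w"]
  refl[of "word_square w"]
  refl[of "word_zero w"]
  refl[of "word_fold n q w"]
  refl[of "word_reduce n q w"]
  refl[of "square_mod n q w"]
  refl[of "mult_mod n q v w"]
  refl[of "word_combine w B"]
  refl[of "word_less v w"]
  refl[of "less_suffixes v w"]
  refl[of "lyndon w"]
  refl[of "take n w"]
  refl[of "drop n w"]
  refl[of "v @ w"]
  refl[of "word k"]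
  refl[of "num_word j"]
  refl[of "list_all P xs"]
  refl[of "distinct xs"]
  refl[of "set xs"]
  refl[of "word_trace q B R v w"]
  refl[of "frobenius_chain q B R"]
  refl[of "check_ratio q B w k l"]
  refl[of "check_row q B row"]
  for v w q :: word and R B :: "word list" and row :: row and k l n :: nat
    and j :: num and P :: "'a \<Rightarrow> bool" and xs :: "'a list"

lemma triangle_system_0: "triangle_system q B 0 h"
  by (auto simp: triangle_system_def check_rows_def)

text \<open>Old keys lie below \<open>l\<close> and new ones do not, so distinctness within each
  list gives distinctness of the union.\<close>

lemma triangle_system_extend:
  assumes "triangle_system q B N l" "check_rows q B l h rows" "l \<le> h" "N + length rows = M"
  shows "triangle_system q B M h"
proof -
  obtain rows0 where "length rows0 = N" "check_rows q B 0 l rows0"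
    using assms(1) by (auto simp: triangle_system_def)
  then have "check_rows q B 0 h (rows0 @ rows)" "length (rows0 @ rows) = M"
    using assms(2-4) by (fastforce simp: check_rows_def Let_def list_all_iff)+
  then show ?thesis unfolding triangle_system_def by blast
qed

text \<open>A key determines both the row and the side. In particular rows do not repeat, so the
  number of base triangles is the length of the list.\<close>

lemma distinct_keysD:
  assumes "distinct (concat (map keys rows))"
  shows "distinct rows"
    and "s \<in> set rows \<Longrightarrow> t \<in> set rows \<Longrightarrow> i < 3 \<Longrightarrow> j < 3 \<Longrightarrow> keys s ! i = keys t ! j \<Longrightarrow> s = t \<and> i = j"
proof -
  have len: "length (keys r) = 3" for r by (cases r rule: keys.cases) simp
  then have mem: "i < 3 \<Longrightarrow> keys r ! i \<in> set (keys r)" for r i by (simp add: len)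
  show "distinct rows" using assms
  proof (induction rows)
    case (Cons r rows)
    then have "set (keys r) \<inter> set (concat (map keys rows)) = {}" by auto
    then have "r \<notin> set rows" using mem[of 0 r] by fastforce
    then show ?case using Cons by simp
  qed simp
  show "s \<in> set rows \<Longrightarrow> t \<in> set rows \<Longrightarrow> i < 3 \<Longrightarrow> j < 3 \<Longrightarrow> keys s ! i = keys t ! j \<Longrightarrow> s = t \<and> i = j"
    using assms
  proof (induction rows)
    case (Cons r rows)
    have "keys r ! i \<noteq> keys v ! j" if "v \<in> set rows" "i < 3" "j < 3" for v i j
      using Cons.prems mem[of i r] mem[of j v] that by auto
    note neq = this
    consider "s = r" "t = r" | "s = r" "t \<in> set rows" | "s \<in> set rows" "t = r"
      | "s \<in> set rows" "t \<in> set rows"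
      using Cons.prems by auto
    then show ?case
    proof cases
      case 1
      then show ?thesis using Cons.prems nth_eq_iff_index_eq[of "keys r" i j] len[of r] by simp
    next
      case 2
      then show ?thesis using neq[of t i j] Cons.prems by simp
    next
      case 3
      then show ?thesis using neq[of s j i] Cons.prems by simp
    next
      case 4
      then show ?thesis using Cons by simp
    qed
  qed simp
qed

text \<open>Rows are reindexed by sides, with the ratio of each side and its certificate, in the
  order that \<open>exists_invariant_design\<close> expects.\<close>

fun entry :: "word \<Rightarrow> word list \<Rightarrow> row \<Rightarrow> nat \<Rightarrow> word \<times> nat \<times> nat" where
  "entry q B (x, y, k, m, k', m', k'', m'') i =
     (if i = 0 then (word x, k, m) else if i = 1 then (word y, k', m')
      else (mult_mod (length B) q (word x) (word y), k'', m''))"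

lemma check_entry:
  assumes "check_row q B s" "i < 3" "entry q B s i = (r, k, m)"
  shows "check_ratio q B r k m" "k = keys s ! i"
proof -
  have "i = 0 \<or> i = 1 \<or> i = 2" using assms(2) by arith
  then show "check_ratio q B r k m" "k = keys s ! i"
    using assms by (cases s rule: keys.cases; auto simp: Let_def)+
qed

context normal_basis
begin

lemma check_ratioD:
  assumes "check_ratio q B r k m"
  shows "length (word k) = n" "lyndon (word k)" "ev r \<notin> {0, 1}"
    "ratio_invariant (ev r) = normal (rotate m (word k))"
proof -
  let ?K = "normal (rotate m (word k))" and ?u = "ev r ^ 2 + ev r"
  show len: "length (word k) = n" and "lyndon (word k)"
    using assms by (simp_all add: check_ratio_def Let_def length_B)
  let ?d = "word_add (word_mult (word_combine (rotate m (word k)) B)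
      (square_mod n q (word_add (square_mod n q r) r)))
    (word_mult (word_add [True] (square_mod n q (word_add (square_mod n q r) r)))
      (word_add [True] (word_add (square_mod n q r) r)))"
  have "word_zero (word_reduce n q ?d)"
    using assms by (simp add: check_ratio_def Let_def length_B)
  then have "ev ?d = 0" using ev_eq_0 ev_reduce by metis
  \<comment> \<open>The cube of \<open>u + 1\<close> was computed as its square times itself, the
    square being \<open>1 + u ^ 2\<close>.\<close>
  then have "?K * ?u ^ 2 + (1 + ?u ^ 2) * (1 + ?u) = 0"
    by (simp add: ev_simps ev_square_mod ev_combine len)
  moreover have "1 + ?u ^ 2 = (?u + 1) ^ 2" by (simp add: power2_add add.commute)
  ultimately have eq: "?K * ?u ^ 2 = (?u + 1) ^ 3"
    by (simp add: add_eq_0_iff_eq power3_eq_cube power2_eq_square add.commute)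
  then have "?u \<noteq> 0" by auto
  then show "ev r \<notin> {0, 1}" by (auto simp: add_self)
  show "ratio_invariant (ev r) = ?K"
    using eq \<open>?u \<noteq> 0\<close> by (simp add: ratio_invariant_def field_simps)
qed

text \<open>Conjugate elements have rotated coordinates, so an equation between conjugates becomes
  one between rotations of Lyndon words. The second conclusion needs equal offsets \<open>i\<close>
  and \<open>j\<close>; in the application they belong to the same side.\<close>

lemma normal_frobenius_eqD:
  assumes "lyndon v" "length v = n" "lyndon w" "length w = n" "a < n" "b < n"
    and eq: "normal (rotate i v) ^ (2 ^ a) = normal (rotate j w) ^ (2 ^ b)"
  shows "v = w" "i = j \<Longrightarrow> a = b"
proof -
  \<comment> \<open>A power undoes a rotation by \<open>a\<close>, which is the same as rotating on
    by \<open>n - a\<close>; for \<open>a = 0\<close> this is a full turn.\<close>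
  have pow: "normal (rotate i v) ^ (2 ^ a) = normal (rotate (n - a + i) v)" if "length v = n" "a < n" for i v a
    using normal_rotate[of "rotate (n - a + i) v" a] that
    by (simp add: rotate_rotate) (metis rotate_conv_mod mod_add_self1)
  have rot: "rotate (n - a + i) v = rotate (n - b + j) w"
    using eq assms by (intro normal_inject) (simp_all add: pow)
  show "v = w" using lyndon_rotate_eqD(1)[OF assms(1-4) n_pos rot] .
  show "a = b" if "i = j"
  proof -
    have "[n - a + i = n - b + i] (mod n)"
      using lyndon_rotate_eqD(2)[OF assms(1-4) n_pos rot] that by (simp add: cong_def)
    then have "[n - a = n - b] (mod n)" by (rule cong_add_rcancel_nat[THEN iffD1])
    then have "[(n - a) + a + b = (n - b) + b + a] (mod n)"
      by (metis add.commute add.left_commute cong_add_lcancel_nat cong_def)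
    then have "[b = a] (mod n)" using assms(5,6) by (simp add: cong_def)
    then show ?thesis using assms(5,6) by (simp add: cong_def)
  qed
qed

lemma exists_design_if_triangle_system:
  assumes system: "triangle_system q B N h" and N: "N * 18 * n = 2 ^ n - 2"
  shows "\<exists>D. triangle_design D \<and> balanced D \<and>
    (\<forall>a. a \<noteq> 0 \<longrightarrow> invariant_under (\<lambda>x. a * x) D) \<and>
    (\<forall>\<sigma> \<in> field_automorphisms. invariant_under \<sigma> D)"
proof -
  obtain rows where rows: "length rows = N" "check_rows q B 0 h rows"
    using system by (auto simp: triangle_system_def)
  have check: "check_row q B s" if "s \<in> set rows" for s
    using rows(2) that by (auto simp: check_rows_def list_all_iff)
  have distinct: "distinct (concat (map keys rows))"
    using rows(2) by (simp add: check_rows_def Let_def)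
  define r where "r s i = ev (fst (entry q B s i))" for s i
  define w where "w s i = word (fst (snd (entry q B s i)))" for s i
  define m where "m s i = snd (snd (entry q B s i))" for s i
  have ratio: "length (w s i) = n" "lyndon (w s i)" "r s i \<notin> {0, 1}"
      "ratio_invariant (r s i) = normal (rotate (m s i) (w s i))" "w s i = word (keys s ! i)"
    if "s \<in> set rows" "i < 3" for s i
  proof -
    have "entry q B s i = (fst (entry q B s i), fst (snd (entry q B s i)), m s i)"
      by (simp add: m_def)
    note * = check_entry[OF check[OF that(1)] that(2) this]
    show "length (w s i) = n" "lyndon (w s i)" "r s i \<notin> {0, 1}"
      "ratio_invariant (r s i) = normal (rotate (m s i) (w s i))" "w s i = word (keys s ! i)"
      using check_ratioD[OF *(1)] *(2) by (simp_all add: w_def r_def)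
  qed
  show ?thesis
  proof (rule exists_invariant_design[of "set rows" r])
    show "card (set rows) * 18 * n = 2 ^ n - 2"
      using distinct_keysD(1)[OF distinct] rows(1) N by (simp add: distinct_card)
    show "r s 2 = r s 0 * r s 1" for s
      by (cases s rule: keys.cases) (simp add: r_def ev_mult_mod length_B)
    show "r s i \<notin> {0, 1}" if "s \<in> set rows" "i < 3" for s i
      using ratio(3)[OF that] .
    fix s t i j and \<sigma> \<tau> :: "'a \<Rightarrow> 'a"
    assume st: "s \<in> set rows" "t \<in> set rows" "i < 3" "j < 3"
      and "\<sigma> \<in> field_automorphisms" "\<tau> \<in> field_automorphisms"
      and eq: "\<sigma> (ratio_invariant (r s i)) = \<tau> (ratio_invariant (r t j))"
    then obtain a b where ab: "a < n" "\<sigma> = (\<lambda>x. x ^ (2 ^ a))" "b < n" "\<tau> = (\<lambda>x. x ^ (2 ^ b))"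
      unfolding field_automorphisms_eq by blast
    note s = ratio[OF st(1,3)] and t = ratio[OF st(2,4)]
    have eq': "normal (rotate (m s i) (w s i)) ^ (2 ^ a) = normal (rotate (m t j) (w t j)) ^ (2 ^ b)"
      using eq ab by (simp add: s(4) t(4))
    note * = normal_frobenius_eqD[OF s(2,1) t(2,1) ab(1,3) eq']
    \<comment> \<open>Equal Lyndon words have equal keys, which single out row and side. Then the
      offsets agree too, and so do the Frobenius exponents.\<close>
    have "keys s ! i = keys t ! j" using *(1) s(5) t(5) word_inject by metis
    then have "s = t \<and> i = j" using distinct_keysD(2)[OF distinct st] by simp
    then show "s = t \<and> i = j \<and> \<sigma> = \<tau>" using *(2) ab by auto
  qed (simp_all add: card_field_automorphisms)
qed

end

lemma exists_design:
  assumes "CARD('a::finite_field) = 2 ^ n" "odd n" "length B = n" "self_dual_normal q B"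
    "triangle_system q B N h" "N * 18 * n = 2 ^ n - 2"
  shows "\<exists>D :: 'a set set set.
    f2_vector_space.triangle_design f2_scale D \<and>
    balanced D \<and>
    (\<forall>a. a \<noteq> 0 \<longrightarrow> invariant_under (\<lambda>x. a * x) D) \<and>
    (\<forall>\<sigma> \<in> field_automorphisms. invariant_under \<sigma> D)"
proof -
  interpret binary_field n "TYPE('a)"
    using assms by unfold_locales
  have "length q \<le> n" "word_zero (word_add (fold (\<lambda>_. square_mod n q) B [False, True]) [False, True])"
    using assms(4) unfolding self_dual_normal_def Let_def assms(3) by blast+
  then obtain \<alpha> :: 'a where "\<alpha> ^ n = word_eval \<alpha> q"
    using exists_root[OF assms(3)] by blast
  then interpret normal_basis n "TYPE('a)" q B \<alpha>
    using assms by unfold_locales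
  show ?thesis using assms by (intro exists_design_if_triangle_system)
qed

section \<open>The base triangles\<close>

text \<open>The modulus is \<open>X ^ 7 + X + 1\<close>; in the other degrees it is
  \<open>X ^ 13 + X ^ 4 + X ^ 3 + X + 1\<close> and \<open>X ^ 19 + X ^ 5 + X ^ 2 + X + 1\<close>.
  The low degree of the tails suits the reduction in two rounds.\<close>

definition q7 :: word where
  "q7 = [True, True]"

text \<open>Numbers code coefficients by binary digits: 13 is \<open>1 + X ^ 2 + X ^ 3\<close>, and
  81 is its square \<open>1 + X ^ 4 + X ^ 6\<close>.\<close>

definition B7 :: "word list" where
  "B7 = map word
   [13, 81, 103, 109, 41, 89, 39]"

lemma length_B7: "length B7 = 7"
  by (simp add: B7_def)

lemma self_dual_normal_7: "self_dual_normal q7 B7"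
  by (simp only: q7_def B7_def eval_simps cong: eval_congs)

text \<open>The vertices are 1, \<open>\<alpha> ^ 5\<close> and \<open>\<alpha> ^ 9\<close> for a
  root \<open>\<alpha>\<close> of the modulus. There are \<open>127 * 21 = 3 * (7 * 127)\<close>
  planes, so the three sides represent all semilinear orbits of planes.\<close>

lemma triangles_7: "triangle_system q7 B7 1 119"
  by (rule triangle_system_extend[OF triangle_system_0[where h = 0], where rows =
   "[(32, 16, 104, 0, 112, 4, 118, 4)]"],
    simp only: q7_def B7_def eval_simps cong: eval_congs, simp_all)

definition q13 :: word where
  "q13 = [True, True, False, True, True]"

definition B13 :: "word list" where
  "B13 = map word
   [25, 321, 4313, 2349, 4754, 6664, 3425, 3906, 2087, 4622, 7022, 6573, 2814]"

lemma length_B13: "length B13 = 13"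
  by (simp add: B13_def)

lemma self_dual_normal_13: "self_dual_normal q13 B13"
  by (simp only: q13_def B13_def eval_simps cong: eval_congs)

text \<open>The bound exceeds the largest of the 105 keys by one. All keys have 13 binary digits, so
  they start above \<open>2 ^ 12\<close>.\<close>

lemma triangles_13: "triangle_system q13 B13 35 8177"
  by (rule triangle_system_extend[OF triangle_system_0[where h = 0], where rows =
   "[(7928, 7271, 4288, 6, 6368, 7, 6656, 2),
    (3379, 1298, 4384, 0, 5748, 9, 6640, 9),
    (3186, 3453, 4416, 10, 6536, 5, 7456, 10),
    (3026, 260, 4464, 10, 6968, 11, 7304, 8),
    (776, 5187, 4640, 6, 6996, 11, 8128, 5),
    (3084, 6391, 4696, 12, 6516, 4, 8176, 10),
    (602, 4011, 4720, 9, 5424, 7, 8148, 10),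
    (4718, 7378, 4760, 3, 4936, 6, 7914, 9),
    (406, 3858, 4776, 6, 7136, 6, 8042, 2),
    (7607, 5066, 4832, 0, 5080, 0, 5816, 7),
    (3449, 7224, 4864, 11, 7132, 10, 7888, 8),
    (4001, 3590, 4904, 5, 5940, 8, 8016, 0),
    (8142, 642, 4984, 4, 5468, 7, 8106, 6),
    (7126, 7043, 5008, 10, 5944, 6, 7780, 3),
    (154, 4847, 5024, 2, 6448, 5, 7100, 6),
    (5147, 1002, 5152, 8, 5320, 2, 5792, 2),
    (2, 6610, 5328, 7, 5512, 5, 7476, 3),
    (3875, 4578, 5344, 2, 6840, 12, 6888, 7),
    (1691, 2111, 5448, 10, 6816, 10, 6884, 9),
    (6380, 4300, 5456, 0, 7632, 2, 7984, 2),
    (4591, 7319, 5548, 11, 7160, 7, 7440, 9),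
    (2235, 6344, 5616, 12, 5988, 5, 7712, 2),
    (1893, 1971, 5836, 7, 6580, 11, 7696, 1),
    (7170, 3454, 5860, 6, 5952, 3, 7996, 6),
    (2001, 73, 5920, 4, 7408, 4, 8026, 10),
    (771, 7218, 6000, 0, 7928, 6, 8168, 4),
    (1982, 5712, 6124, 9, 6896, 3, 7606, 5),
    (5960, 3581, 6272, 12, 7340, 7, 7784, 7),
    (7486, 827, 6312, 10, 7328, 10, 8174, 9),
    (1624, 5423, 6320, 12, 7536, 0, 7592, 9),
    (7902, 5081, 6520, 7, 7844, 11, 7960, 12),
    (2322, 4242, 6616, 9, 7868, 3, 7924, 8),
    (5345, 5518, 6828, 3, 7148, 5, 7610, 0),
    (832, 1441, 7360, 10, 7648, 5, 7808, 0),
    (6912, 1207, 8052, 9, 8080, 9, 8164, 6)]"],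
    simp only: q13_def B13_def eval_simps cong: eval_congs, simp_all)

definition q19 :: word where
  "q19 = [True, True, True, False, False, True]"

definition B19 :: "word list" where
  "B19 = map word
   [545, 263169, 393552, 299089, 470270, 75507, 42699, 359307, 522498, 65805,
    385105, 234910, 466356, 8663, 82581, 61201, 288247, 461252, 12409]"

lemma length_B19: "length B19 = 19"
  by (simp add: B19_def)

lemma self_dual_normal_19: "self_dual_normal q19 B19"
  by (simp only: q19_def B19_def eval_simps cong: eval_congs)

text \<open>The 1533 triangles come in 73 batches of 21. Each batch joins 63 keys that are
  consecutive among the 4599 keys in use, and its bound is one more than its largest key. The
  quadratic test for distinctness is thereby confined to 63 numbers at a time.\<close>

lemma triangles_19_1: "triangle_system q19 B19 21 279425"
  by (rule triangle_system_extend[OF triangle_system_0[where h = 0], where rows =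
   "[(19916, 298678, 263424, 3, 273120, 17, 276064, 16),
    (181844, 120778, 264448, 17, 274624, 15, 278368, 4),
    (519416, 2747, 265856, 1, 273024, 4, 273632, 11),
    (310747, 302743, 266944, 4, 273248, 11, 275872, 7),
    (418939, 109401, 267456, 16, 276992, 0, 279328, 9),
    (172959, 224604, 267648, 3, 271360, 12, 277184, 18),
    (469939, 67703, 268288, 11, 272384, 11, 276288, 3),
    (340510, 331769, 268928, 1, 274080, 10, 274752, 2),
    (391156, 282849, 269376, 8, 273152, 18, 275904, 12),
    (185372, 93976, 269760, 0, 273344, 0, 273536, 9),
    (434289, 502045, 269824, 9, 277376, 7, 277792, 1),
    (483337, 46203, 270688, 8, 270752, 14, 275200, 0),
    (520309, 199068, 270848, 8, 271680, 2, 276128, 1),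
    (282545, 55027, 271008, 5, 275584, 5, 278432, 15),
    (482065, 230695, 271040, 12, 272000, 0, 274112, 2),
    (8761, 72822, 271136, 14, 274208, 15, 277888, 0),
    (2439, 108643, 271168, 15, 272960, 7, 276512, 3),
    (346548, 508348, 271552, 8, 274016, 1, 275712, 4),
    (218849, 245233, 271648, 11, 272544, 0, 279424, 17),
    (514400, 218077, 272320, 8, 274528, 5, 278272, 6),
    (195090, 75456, 273664, 14, 274912, 7, 276544, 4)]"],
    simp only: q19_def B19_def eval_simps cong: eval_congs, simp_all)

lemma triangles_19_2: "triangle_system q19 B19 42 285345"
  by (rule triangle_system_extend[OF triangles_19_1, where rows =
   "[(196623, 197003, 279552, 7, 279792, 16, 284352, 16),
    (476347, 420132, 279632, 2, 280896, 6, 281632, 12),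
    (81972, 69742, 279648, 1, 281952, 15, 284640, 3),
    (471165, 184340, 279696, 1, 282992, 6, 284976, 14),
    (407944, 205472, 280016, 15, 281152, 12, 282576, 10),
    (73145, 118025, 280032, 9, 283584, 3, 284304, 4),
    (19017, 416197, 280320, 15, 280464, 14, 281808, 17),
    (168653, 90140, 280416, 15, 284160, 9, 284544, 2),
    (424416, 66871, 280768, 11, 280944, 1, 284064, 4),
    (373622, 196568, 281008, 3, 282016, 16, 282624, 11),
    (407997, 134209, 281104, 7, 282816, 13, 285024, 13),
    (153367, 305202, 281200, 17, 282944, 10, 283152, 4),
    (512373, 485014, 281216, 3, 282352, 6, 284208, 12),
    (495686, 31827, 281296, 1, 284432, 11, 285072, 15),
    (8328, 274084, 281424, 6, 284704, 16, 285008, 12),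
    (108625, 90218, 281728, 4, 283632, 11, 283984, 17),
    (269222, 356213, 281824, 6, 282112, 5, 283488, 11),
    (346808, 53429, 281856, 18, 283776, 5, 285264, 7),
    (504646, 115454, 281904, 15, 282160, 4, 284448, 13),
    (90831, 325207, 282048, 16, 284400, 15, 285184, 9),
    (512477, 352701, 282592, 4, 285168, 0, 285344, 5)]"],
    simp only: q19_def B19_def eval_simps cong: eval_congs, simp_all)

lemma triangles_19_3: "triangle_system q19 B19 63 291473"
  by (rule triangle_system_extend[OF triangles_19_2, where rows =
   "[(248413, 237142, 285376, 8, 285936, 12, 289216, 6),
    (429904, 128644, 285424, 9, 290176, 5, 291472, 3),
    (246283, 508633, 285568, 13, 288416, 16, 290272, 6),
    (445277, 181019, 285616, 11, 290800, 5, 291264, 18),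
    (473625, 488129, 285696, 14, 287952, 3, 288800, 6),
    (309941, 134046, 285792, 12, 287648, 5, 289760, 10),
    (154365, 18859, 285856, 18, 287584, 13, 288992, 18),
    (324288, 413421, 286064, 0, 286416, 1, 287248, 12),
    (74067, 148080, 286240, 1, 287264, 12, 290752, 16),
    (272603, 102539, 286384, 16, 289360, 13, 291216, 11),
    (225426, 33187, 286624, 0, 287040, 12, 288448, 3),
    (228261, 449223, 286656, 6, 289072, 0, 291312, 7),
    (287289, 309676, 286704, 4, 288160, 8, 290064, 2),
    (128526, 23566, 287008, 8, 288048, 3, 288720, 16),
    (296422, 245654, 287184, 18, 287680, 15, 290992, 17),
    (94983, 306692, 287200, 17, 287920, 0, 291408, 11),
    (438633, 134466, 287296, 3, 289184, 2, 291424, 18),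
    (310264, 227093, 287632, 9, 289264, 0, 290512, 2),
    (126092, 218779, 287856, 8, 291152, 16, 291232, 7),
    (447571, 492447, 288352, 0, 288624, 8, 289792, 6),
    (303607, 232720, 288832, 2, 289328, 18, 290704, 15)]"],
    simp only: q19_def B19_def eval_simps cong: eval_congs, simp_all)

lemma triangles_19_4: "triangle_system q19 B19 84 299329"
  by (rule triangle_system_extend[OF triangles_19_3, where rows =
   "[(136453, 115615, 291568, 1, 293008, 0, 296960, 10),
    (457438, 387287, 291648, 1, 292368, 14, 292688, 4),
    (103012, 236553, 291696, 16, 293056, 11, 298112, 12),
    (440862, 313690, 291792, 5, 293792, 4, 296224, 6),
    (346011, 99614, 291936, 13, 292080, 10, 298096, 1),
    (103733, 519483, 292224, 14, 292384, 12, 298640, 2),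
    (81348, 409317, 292416, 1, 297536, 6, 298208, 9),
    (402061, 152187, 292560, 17, 293488, 10, 297248, 2),
    (344636, 145469, 292768, 18, 293728, 18, 298240, 15),
    (407554, 62061, 293248, 9, 293392, 10, 296864, 7),
    (325228, 251618, 293296, 15, 296464, 14, 297872, 13),
    (386818, 380295, 293328, 5, 294384, 11, 296320, 5),
    (127106, 68570, 293440, 5, 297096, 3, 297680, 14),
    (86229, 457102, 293600, 5, 297584, 10, 297888, 17),
    (501431, 453674, 293712, 15, 296128, 9, 297648, 15),
    (159474, 484493, 293776, 8, 299008, 9, 299328, 16),
    (170511, 510344, 294016, 5, 296512, 13, 298960, 7),
    (304849, 387990, 294496, 10, 294640, 1, 298592, 7),
    (344321, 212767, 294560, 3, 298320, 5, 298688, 9),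
    (255462, 111232, 294864, 0, 295168, 12, 298544, 18),
    (348234, 21724, 294880, 0, 295424, 2, 296256, 13)]"],
    simp only: q19_def B19_def eval_simps cong: eval_congs, simp_all)

lemma triangles_19_5: "triangle_system q19 B19 105 303489"
  by (rule triangle_system_extend[OF triangles_19_4, where rows =
   "[(205637, 464983, 299376, 4, 301952, 2, 302160, 16),
    (41016, 503954, 299440, 4, 300096, 4, 300912, 8),
    (408520, 25871, 299584, 9, 301760, 15, 302368, 7),
    (491333, 457008, 299608, 9, 300144, 13, 301880, 15),
    (413178, 285983, 299648, 17, 299816, 7, 300200, 13),
    (432434, 76190, 299688, 8, 300784, 16, 301352, 6),
    (453307, 60510, 299776, 14, 300424, 17, 302312, 3),
    (261417, 313907, 299912, 17, 302424, 9, 303088, 8),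
    (247526, 67175, 299960, 12, 302720, 11, 302920, 5),
    (93111, 295829, 300160, 9, 300688, 12, 301024, 0),
    (439073, 287636, 300240, 17, 300520, 8, 300864, 5),
    (451685, 280057, 300328, 11, 301552, 17, 302000, 8),
    (308683, 194154, 300360, 17, 301048, 14, 301912, 13),
    (290635, 209651, 300384, 17, 300664, 7, 301456, 12),
    (202795, 398475, 300408, 11, 302176, 5, 302744, 14),
    (166643, 393854, 300584, 7, 301408, 17, 301800, 14),
    (390494, 387500, 300728, 0, 301232, 7, 302848, 9),
    (258646, 198287, 300904, 0, 301664, 0, 303488, 16),
    (311713, 306646, 301384, 3, 302264, 9, 302840, 2),
    (94279, 398369, 301472, 10, 302128, 8, 302944, 13),
    (516346, 46574, 302352, 8, 302800, 2, 303264, 4)]"],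
    simp only: q19_def B19_def eval_simps cong: eval_congs, simp_all)

lemma triangles_19_6: "triangle_system q19 B19 126 307649"
  by (rule triangle_system_extend[OF triangles_19_5, where rows =
   "[(401804, 451802, 303728, 17, 304456, 12, 305648, 17),
    (359380, 216165, 303872, 13, 304432, 1, 305664, 14),
    (67151, 420715, 303944, 11, 305552, 15, 306544, 13),
    (346940, 293675, 303952, 9, 305624, 8, 306992, 12),
    (72606, 115424, 303968, 0, 304064, 15, 304600, 6),
    (189015, 377499, 304304, 17, 305760, 4, 306048, 2),
    (87890, 285953, 304336, 15, 305568, 18, 306520, 12),
    (189857, 62849, 304352, 10, 304424, 11, 307648, 15),
    (41770, 440120, 304384, 16, 304544, 14, 307424, 11),
    (522354, 150292, 304504, 18, 304928, 3, 305120, 10),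
    (204481, 126688, 304528, 12, 305544, 1, 306752, 16),
    (419958, 112766, 304616, 5, 304624, 14, 304784, 2),
    (512934, 336611, 304688, 2, 305024, 2, 306944, 1),
    (384128, 212863, 305008, 9, 305528, 3, 306464, 3),
    (79517, 433799, 305064, 18, 305352, 15, 307136, 16),
    (26957, 287881, 305096, 15, 305488, 0, 306864, 13),
    (176194, 10454, 305216, 16, 306536, 16, 306936, 10),
    (503844, 258498, 305848, 18, 306600, 11, 307024, 14),
    (232603, 220463, 305856, 4, 305896, 5, 306368, 10),
    (476443, 319281, 306128, 11, 306224, 0, 306656, 16),
    (514521, 422263, 306144, 16, 306984, 7, 307128, 7)]"],
    simp only: q19_def B19_def eval_simps cong: eval_congs, simp_all)

lemma triangles_19_7: "triangle_system q19 B19 147 311825"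
  by (rule triangle_system_extend[OF triangles_19_6, where rows =
   "[(82930, 475078, 307688, 6, 310376, 6, 310720, 9),
    (270077, 334130, 307784, 3, 308768, 11, 309680, 15),
    (240857, 73157, 307944, 9, 310784, 10, 310832, 5),
    (432007, 420448, 308072, 4, 308680, 17, 310672, 6),
    (135080, 453234, 308096, 18, 309592, 1, 310944, 9),
    (369326, 509653, 308136, 5, 310232, 18, 311264, 9),
    (314929, 21119, 308296, 16, 309488, 13, 310208, 12),
    (103923, 447096, 308320, 8, 308632, 8, 308888, 14),
    (139397, 314682, 308592, 14, 308656, 0, 311096, 0),
    (406930, 340469, 308608, 12, 309872, 6, 311216, 0),
    (203064, 263852, 308728, 15, 309728, 12, 310256, 11),
    (485129, 440384, 308752, 2, 310440, 2, 311248, 15),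
    (154969, 447660, 308904, 4, 309672, 7, 310336, 13),
    (350460, 324608, 309032, 7, 309128, 14, 310976, 15),
    (270614, 433622, 309072, 8, 309792, 17, 310176, 16),
    (459717, 81058, 309136, 9, 309632, 2, 310568, 14),
    (363223, 129280, 309152, 8, 310112, 8, 311488, 10),
    (7695, 268717, 309232, 8, 311144, 16, 311824, 5),
    (22985, 494189, 309560, 17, 309912, 10, 311056, 13),
    (466693, 31453, 309888, 15, 310520, 11, 310664, 0),
    (314809, 111604, 310424, 4, 310648, 13, 310760, 8)]"],
    simp only: q19_def B19_def eval_simps cong: eval_congs, simp_all)

lemma triangles_19_8: "triangle_system q19 B19 168 316329"
  by (rule triangle_system_extend[OF triangles_19_7, where rows =
   "[(382479, 438651, 311872, 8, 313840, 12, 316272, 12),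
    (404376, 149420, 312432, 6, 313120, 7, 314224, 8),
    (166207, 54694, 312496, 9, 314640, 18, 314984, 14),
    (312607, 9616, 312576, 10, 314792, 3, 316328, 0),
    (171100, 267677, 312720, 2, 313784, 6, 313952, 3),
    (140907, 37542, 312976, 13, 314200, 3, 314944, 0),
    (52559, 267451, 313072, 17, 313680, 10, 313792, 13),
    (490497, 497138, 313200, 16, 314504, 3, 316144, 10),
    (167987, 267852, 313216, 8, 313408, 18, 315256, 4),
    (125961, 271439, 313264, 16, 315616, 14, 316192, 7),
    (504343, 515589, 313296, 15, 315376, 3, 315728, 7),
    (148012, 19316, 313472, 9, 314528, 10, 314752, 5),
    (196935, 112142, 313520, 8, 314688, 8, 316064, 8),
    (48258, 118078, 313648, 7, 314176, 9, 315976, 4),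
    (28953, 77931, 313744, 16, 314848, 5, 315088, 11),
    (61174, 173045, 313816, 4, 315080, 5, 315296, 3),
    (373392, 231100, 313928, 0, 314600, 4, 316048, 9),
    (264307, 18104, 314464, 0, 315216, 17, 316216, 7),
    (57949, 185692, 314584, 6, 315128, 2, 315648, 8),
    (38706, 314033, 314608, 17, 315272, 1, 315984, 11),
    (95694, 207430, 315032, 13, 315808, 18, 316024, 18)]"],
    simp only: q19_def B19_def eval_simps cong: eval_congs, simp_all)

lemma triangles_19_9: "triangle_system q19 B19 189 319385"
  by (rule triangle_system_extend[OF triangles_19_8, where rows =
   "[(196720, 470372, 316336, 18, 317256, 0, 317304, 9),
    (339079, 338841, 316368, 5, 316632, 8, 317808, 8),
    (510875, 386521, 316408, 16, 318616, 10, 318816, 13),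
    (16031, 400810, 316496, 14, 316880, 4, 318960, 0),
    (349293, 24384, 316576, 18, 318760, 6, 319192, 8),
    (83954, 175131, 316648, 18, 317376, 1, 318248, 0),
    (263403, 318922, 316656, 12, 316944, 6, 318856, 9),
    (494741, 514089, 316736, 11, 318712, 1, 319120, 12),
    (423783, 288600, 316784, 17, 317680, 14, 317824, 2),
    (380601, 74524, 316824, 10, 317176, 16, 318344, 5),
    (247815, 408904, 316992, 12, 317536, 6, 317944, 8),
    (249476, 466103, 317016, 6, 317280, 7, 318640, 11),
    (445455, 50728, 317032, 12, 317080, 2, 319024, 8),
    (518089, 22853, 317136, 14, 318528, 5, 319384, 15),
    (49025, 454988, 317184, 7, 317208, 14, 317584, 12),
    (398952, 383162, 317232, 14, 317848, 17, 318568, 13),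
    (67331, 225641, 317424, 12, 317656, 11, 317864, 15),
    (438730, 406873, 317520, 11, 319072, 7, 319216, 17),
    (516686, 152975, 318064, 17, 318104, 2, 318632, 8),
    (353471, 89780, 318200, 17, 318864, 4, 319160, 8),
    (9658, 421496, 319048, 16, 319096, 18, 319288, 11)]"],
    simp only: q19_def B19_def eval_simps cong: eval_congs, simp_all)

lemma triangles_19_10: "triangle_system q19 B19 210 323209"
  by (rule triangle_system_extend[OF triangles_19_9, where rows =
   "[(62369, 201400, 319400, 14, 321944, 6, 322256, 4),
    (415069, 500348, 319480, 6, 320752, 11, 322784, 6),
    (141243, 493780, 319936, 5, 320344, 8, 322400, 1),
    (85892, 276527, 320000, 13, 320320, 12, 321440, 15),
    (29957, 426603, 320048, 17, 321248, 0, 321728, 3),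
    (62185, 379927, 320072, 8, 322648, 11, 322952, 8),
    (392234, 168506, 320144, 11, 320992, 16, 322864, 15),
    (258011, 338882, 320272, 15, 320384, 7, 321520, 16),
    (251639, 22900, 320360, 12, 320856, 11, 322728, 13),
    (107938, 147801, 320408, 7, 321224, 17, 322488, 8),
    (472161, 116317, 320464, 11, 320672, 3, 321968, 8),
    (427541, 71457, 320584, 18, 320592, 17, 322936, 1),
    (375673, 423086, 320744, 14, 322304, 13, 322736, 6),
    (9540, 291697, 320920, 18, 322296, 18, 322816, 4),
    (424943, 20469, 321136, 15, 322176, 6, 322272, 17),
    (387736, 452030, 321192, 9, 322808, 13, 322912, 17),
    (28035, 235418, 321200, 2, 321632, 17, 321696, 13),
    (409717, 375060, 321320, 18, 321472, 13, 322064, 8),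
    (37368, 160649, 321616, 1, 321896, 8, 323208, 13),
    (122175, 71191, 321776, 8, 322440, 4, 322624, 12),
    (510794, 492039, 321856, 7, 321920, 14, 322224, 16)]"],
    simp only: q19_def B19_def eval_simps cong: eval_congs, simp_all)

lemma triangles_19_11: "triangle_system q19 B19 231 329281"
  by (rule triangle_system_extend[OF triangles_19_10, where rows =
   "[(83976, 246065, 323216, 10, 324864, 17, 326032, 17),
    (323216, 231450, 323256, 5, 324512, 18, 326704, 18),
    (288496, 230613, 323288, 9, 325352, 16, 327664, 7),
    (82285, 114860, 323480, 13, 326024, 10, 329280, 17),
    (345011, 356831, 323504, 6, 324016, 11, 325528, 10),
    (63012, 364624, 323744, 0, 327496, 7, 328192, 4),
    (98554, 27279, 323904, 11, 324584, 0, 325120, 15),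
    (76377, 114023, 323928, 4, 325216, 13, 327640, 8),
    (100268, 343746, 323968, 6, 324536, 14, 324568, 13),
    (221996, 57755, 324224, 16, 325000, 14, 325440, 9),
    (509551, 436749, 324640, 3, 326800, 2, 327560, 18),
    (14447, 286591, 324760, 7, 325576, 4, 325784, 15),
    (198506, 9751, 324808, 0, 325488, 4, 327544, 2),
    (138034, 28311, 324904, 12, 325160, 17, 327424, 11),
    (273319, 105672, 324912, 13, 325840, 10, 326328, 6),
    (162112, 144758, 324984, 7, 325392, 2, 326944, 14),
    (147734, 519382, 325024, 4, 325584, 18, 326304, 6),
    (291329, 235399, 325056, 13, 325624, 7, 326416, 9),
    (25576, 243257, 325096, 5, 325832, 1, 326120, 10),
    (237001, 239283, 326048, 3, 326600, 12, 327296, 9),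
    (402148, 495147, 326776, 13, 326872, 13, 329024, 2)]"],
    simp only: q19_def B19_def eval_simps cong: eval_congs, simp_all)

lemma triangles_19_12: "triangle_system q19 B19 252 336641"
  by (rule triangle_system_extend[OF triangles_19_11, where rows =
   "[(449418, 205842, 329344, 16, 335712, 2, 336640, 15),
    (507732, 131392, 329664, 5, 331152, 1, 333456, 6),
    (470318, 44723, 329872, 11, 333128, 17, 335584, 5),
    (165314, 218697, 330000, 13, 330592, 11, 335688, 12),
    (416652, 509022, 330016, 8, 330256, 5, 334080, 9),
    (6599, 123920, 330272, 6, 331360, 9, 334432, 0),
    (113301, 463948, 330880, 8, 335560, 1, 336416, 7),
    (336594, 146171, 330976, 11, 333792, 11, 334496, 2),
    (182154, 309235, 331264, 15, 334216, 18, 335488, 8),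
    (395157, 437302, 331552, 13, 331776, 9, 334272, 10),
    (64291, 52010, 332240, 7, 333680, 1, 334800, 15),
    (215848, 467521, 332416, 7, 334048, 7, 336496, 0),
    (263761, 22610, 332496, 12, 335568, 12, 335808, 16),
    (20601, 368514, 332592, 16, 333472, 18, 333952, 11),
    (314177, 174410, 332616, 9, 333056, 3, 333360, 1),
    (210123, 292357, 332784, 18, 335040, 5, 336592, 5),
    (362641, 261965, 332912, 1, 333584, 8, 336256, 6),
    (503378, 377988, 333192, 3, 335696, 14, 336352, 0),
    (237863, 349204, 333248, 10, 334224, 9, 335752, 4),
    (426074, 480700, 333448, 6, 333504, 10, 334000, 15),
    (218874, 431553, 334152, 5, 334576, 2, 336560, 13)]"],
    simp only: q19_def B19_def eval_simps cong: eval_congs, simp_all)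

lemma triangles_19_13: "triangle_system q19 B19 273 340417"
  by (rule triangle_system_extend[OF triangles_19_12, where rows =
   "[(227999, 362088, 336736, 11, 337064, 18, 338504, 12),
    (359458, 109907, 336784, 14, 339832, 1, 339952, 16),
    (205238, 35971, 336800, 7, 337224, 6, 338320, 4),
    (58967, 62190, 336960, 9, 338788, 11, 339792, 6),
    (203611, 450892, 337008, 10, 339088, 4, 339172, 9),
    (298291, 503165, 337072, 17, 339584, 16, 339904, 18),
    (327088, 247977, 337192, 3, 337288, 17, 337408, 2),
    (332418, 432454, 337248, 0, 338404, 3, 339160, 18),
    (31251, 211761, 337312, 18, 338480, 11, 338856, 7),
    (345096, 262961, 337344, 11, 339748, 0, 340192, 13),
    (18739, 288207, 337384, 0, 339368, 5, 339400, 12),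
    (176437, 16705, 337448, 4, 337952, 12, 338672, 14),
    (238029, 248147, 337488, 16, 337640, 18, 339352, 1),
    (460405, 60201, 337544, 18, 337872, 18, 340416, 5),
    (267411, 149125, 337696, 6, 338360, 4, 338744, 4),
    (172477, 157510, 337720, 3, 338248, 9, 338272, 12),
    (183533, 143767, 337832, 17, 337840, 16, 338704, 7),
    (63267, 258169, 337912, 4, 339752, 8, 340096, 0),
    (302330, 489432, 338224, 0, 338896, 6, 338992, 11),
    (262631, 45870, 338392, 2, 338432, 18, 339620, 4),
    (77867, 498023, 338752, 10, 339232, 8, 339448, 9)]"],
    simp only: q19_def B19_def eval_simps cong: eval_congs, simp_all)

lemma triangles_19_14: "triangle_system q19 B19 294 343697"
  by (rule triangle_system_extend[OF triangles_19_13, where rows =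
   "[(154824, 57621, 340456, 11, 340696, 16, 342824, 8),
    (490033, 179218, 340552, 6, 340864, 8, 343416, 11),
    (374504, 227251, 340752, 2, 341176, 13, 343000, 16),
    (261197, 84530, 340792, 14, 342436, 6, 343024, 12),
    (361103, 238769, 340824, 9, 341280, 15, 341400, 4),
    (311092, 373371, 340904, 3, 340936, 8, 341988, 11),
    (55261, 443882, 340992, 4, 341992, 9, 343288, 17),
    (334444, 230464, 341072, 17, 342360, 5, 342640, 1),
    (236169, 517630, 341220, 11, 341728, 10, 342944, 18),
    (447950, 107713, 341304, 9, 342248, 11, 343524, 14),
    (469994, 241753, 341312, 9, 343456, 1, 343672, 13),
    (421158, 517857, 341336, 17, 342448, 13, 343376, 3),
    (146106, 311680, 341352, 3, 342096, 16, 342920, 12),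
    (282814, 199152, 341360, 15, 342160, 12, 342336, 13),
    (362997, 234909, 341412, 11, 341952, 7, 343248, 6),
    (384762, 383810, 341656, 7, 341672, 3, 343344, 0),
    (188858, 86269, 341704, 13, 342692, 0, 343204, 7),
    (97698, 249134, 341712, 11, 342680, 15, 342928, 9),
    (325069, 474706, 341784, 16, 342520, 14, 342616, 4),
    (520647, 104546, 341976, 8, 342176, 1, 343012, 6),
    (179134, 215834, 342628, 5, 343144, 10, 343696, 18)]"],
    simp only: q19_def B19_def eval_simps cong: eval_congs, simp_all)

lemma triangles_19_15: "triangle_system q19 B19 315 348513"
  by (rule triangle_system_extend[OF triangles_19_14, where rows =
   "[(251849, 381469, 343736, 16, 345536, 5, 347048, 15),
    (445529, 198993, 343780, 3, 347272, 15, 348132, 9),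
    (301156, 182029, 343936, 14, 346144, 3, 346440, 9),
    (69178, 313507, 343960, 0, 346064, 11, 347712, 7),
    (345768, 78388, 343972, 9, 345344, 7, 347184, 8),
    (329344, 164447, 344032, 16, 345872, 0, 347824, 9),
    (97570, 496014, 344448, 6, 344976, 15, 345672, 11),
    (409644, 149843, 344832, 9, 347848, 0, 348224, 14),
    (235045, 401362, 345120, 16, 346992, 1, 347008, 15),
    (69894, 95465, 345152, 10, 346944, 5, 348096, 7),
    (47549, 104506, 345200, 14, 347104, 10, 348288, 9),
    (460053, 390887, 345392, 15, 347556, 1, 348512, 4),
    (393594, 403522, 345584, 18, 346584, 5, 348064, 12),
    (329717, 120663, 345648, 7, 346176, 18, 347232, 2),
    (484138, 60989, 345696, 5, 346608, 8, 347208, 1),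
    (353100, 491781, 345760, 13, 346320, 11, 346840, 13),
    (103516, 219743, 345888, 16, 346528, 14, 347352, 1),
    (44065, 296284, 345920, 12, 347136, 11, 347320, 17),
    (406346, 446107, 346404, 13, 347044, 10, 347856, 3),
    (285270, 147541, 346408, 8, 346504, 15, 348048, 16),
    (120058, 187303, 347032, 3, 347616, 0, 347896, 14)]"],
    simp only: q19_def B19_def eval_simps cong: eval_congs, simp_all)

lemma triangles_19_16: "triangle_system q19 B19 336 351785"
  by (rule triangle_system_extend[OF triangles_19_15, where rows =
   "[(508856, 191102, 348560, 14, 350344, 14, 350804, 15),
    (51434, 272164, 348608, 16, 349344, 1, 349904, 15),
    (168257, 501298, 348720, 11, 349092, 11, 350576, 9),
    (483969, 323936, 348904, 11, 349992, 5, 351336, 17),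
    (12010, 203506, 348984, 6, 349976, 17, 351536, 11),
    (253263, 335474, 349032, 1, 350048, 8, 350156, 9),
    (452911, 165414, 349040, 14, 349616, 4, 351048, 4),
    (282507, 316260, 349264, 13, 349472, 4, 351168, 5),
    (420346, 215623, 349280, 9, 349860, 9, 351784, 4),
    (181916, 14564, 349544, 3, 351120, 16, 351632, 10),
    (384102, 97303, 349588, 2, 349884, 13, 350884, 3),
    (512990, 231800, 349604, 9, 350024, 5, 351136, 3),
    (24627, 414983, 349608, 7, 349760, 13, 350956, 5),
    (178959, 458120, 349628, 3, 351084, 9, 351480, 15),
    (135246, 172706, 349640, 5, 351468, 6, 351560, 18),
    (109320, 399000, 349660, 16, 350192, 0, 351624, 11),
    (423914, 346614, 349872, 14, 350124, 8, 351596, 8),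
    (403962, 30856, 350000, 2, 350304, 18, 351112, 0),
    (478403, 177962, 350112, 8, 350168, 0, 351072, 8),
    (394547, 154015, 350480, 1, 350832, 17, 350940, 13),
    (139882, 389665, 351228, 2, 351528, 14, 351648, 3)]"],
    simp only: q19_def B19_def eval_simps cong: eval_congs, simp_all)

lemma triangles_19_17: "triangle_system q19 B19 357 354809"
  by (rule triangle_system_extend[OF triangles_19_16, where rows =
   "[(265052, 405374, 351836, 1, 353472, 14, 354072, 13),
    (353223, 423096, 351888, 5, 353944, 7, 354724, 9),
    (187686, 363777, 351916, 17, 352104, 7, 353700, 16),
    (344416, 446978, 351928, 17, 354084, 17, 354184, 18),
    (8456, 37408, 351956, 17, 353920, 5, 354464, 7),
    (450423, 431440, 351972, 5, 352168, 7, 354232, 2),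
    (496137, 451372, 351976, 9, 352016, 6, 352656, 12),
    (39868, 310220, 351984, 14, 353904, 14, 354576, 11),
    (131884, 201596, 351996, 17, 352928, 8, 354664, 18),
    (298960, 407155, 352056, 11, 353008, 9, 354784, 0),
    (275537, 148676, 352064, 5, 352148, 1, 354128, 10),
    (128561, 521432, 352128, 6, 353088, 7, 354736, 7),
    (425725, 373659, 352208, 6, 353224, 9, 354728, 1),
    (193898, 340163, 352236, 11, 353192, 1, 353876, 4),
    (432131, 142802, 352512, 1, 353040, 6, 353636, 3),
    (127952, 355922, 352560, 0, 353248, 11, 354276, 10),
    (490443, 403463, 352768, 3, 353780, 0, 354448, 2),
    (300213, 452321, 353000, 9, 354228, 17, 354688, 18),
    (520089, 79046, 353648, 16, 353992, 18, 354544, 8),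
    (265563, 275442, 354036, 3, 354048, 4, 354808, 13),
    (513189, 387342, 354164, 15, 354240, 0, 354400, 12)]"],
    simp only: q19_def B19_def eval_simps cong: eval_congs, simp_all)

lemma triangles_19_18: "triangle_system q19 B19 378 357337"
  by (rule triangle_system_extend[OF triangles_19_17, where rows =
   "[(185934, 123141, 354832, 5, 356952, 11, 357028, 16),
    (436686, 63926, 354900, 17, 355096, 0, 355144, 2),
    (158214, 510870, 354904, 8, 355552, 6, 356180, 18),
    (437920, 303642, 354944, 16, 355120, 14, 355164, 17),
    (500214, 311328, 354992, 0, 355984, 1, 356928, 15),
    (518709, 386889, 355024, 0, 355244, 1, 355620, 8),
    (427587, 442767, 355108, 0, 356012, 3, 357120, 17),
    (325855, 217334, 355192, 10, 355800, 14, 357264, 14),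
    (296671, 171008, 355216, 10, 356296, 17, 356880, 6),
    (275418, 362195, 355252, 0, 355888, 11, 356148, 16),
    (515806, 70707, 355256, 5, 355496, 3, 356272, 2),
    (461788, 513819, 355288, 14, 356316, 6, 356448, 10),
    (41663, 69208, 355304, 7, 355948, 15, 357216, 17),
    (343625, 230760, 355492, 7, 355744, 11, 356696, 14),
    (272933, 59968, 355528, 15, 355704, 13, 356248, 0),
    (514946, 412911, 355812, 11, 356196, 5, 356784, 13),
    (346874, 488382, 355880, 14, 356080, 7, 356672, 0),
    (13520, 469781, 355912, 4, 356284, 8, 357228, 17),
    (202719, 43, 355932, 3, 356032, 12, 357336, 9),
    (177501, 214771, 356220, 2, 356964, 1, 357156, 4),
    (205622, 151707, 356352, 18, 356664, 10, 357280, 0)]"],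
    simp only: q19_def B19_def eval_simps cong: eval_congs, simp_all)

lemma triangles_19_19: "triangle_system q19 B19 399 360021"
  by (rule triangle_system_extend[OF triangles_19_18, where rows =
   "[(295544, 294499, 357488, 10, 358800, 12, 359712, 7),
    (493606, 453537, 357576, 11, 357680, 9, 359628, 0),
    (207498, 29474, 357600, 12, 358952, 12, 359784, 2),
    (136212, 97722, 357624, 17, 357752, 1, 360000, 3),
    (30734, 194769, 357632, 2, 359256, 16, 359296, 5),
    (10023, 301043, 357668, 12, 358704, 18, 358868, 9),
    (179243, 93861, 357748, 1, 358268, 18, 359744, 16),
    (224170, 294203, 357776, 4, 358656, 12, 359764, 6),
    (216036, 22843, 357792, 18, 358528, 4, 358840, 9),
    (420366, 353402, 357812, 4, 358464, 7, 359904, 15),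
    (256370, 233689, 357860, 12, 358208, 17, 358292, 2),
    (515998, 120329, 357936, 18, 358576, 5, 359636, 0),
    (178915, 467777, 357968, 2, 358888, 15, 359356, 2),
    (346351, 102130, 358060, 7, 358176, 4, 359924, 6),
    (239998, 257159, 358104, 2, 359368, 14, 360020, 4),
    (427236, 428520, 358228, 3, 358624, 6, 358884, 9),
    (289847, 330590, 358232, 6, 358352, 8, 358984, 18),
    (84991, 44303, 358512, 0, 359092, 13, 359224, 13),
    (272804, 62076, 358608, 1, 359792, 18, 359928, 3),
    (414861, 364407, 358828, 3, 359152, 1, 359336, 17),
    (178370, 304067, 359504, 14, 359616, 12, 359952, 8)]"],
    simp only: q19_def B19_def eval_simps cong: eval_congs, simp_all)

lemma triangles_19_20: "triangle_system q19 B19 420 364673"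
  by (rule triangle_system_extend[OF triangles_19_19, where rows =
   "[(438116, 120020, 360036, 7, 362800, 18, 363592, 3),
    (117268, 135613, 360040, 10, 362368, 4, 363088, 14),
    (470891, 78557, 360048, 10, 363464, 8, 364360, 3),
    (214400, 79050, 360064, 2, 362720, 0, 363664, 0),
    (480736, 483344, 360100, 18, 360136, 15, 360180, 10),
    (167935, 95037, 360112, 10, 362792, 8, 364184, 1),
    (94594, 336940, 360156, 7, 360404, 10, 364520, 0),
    (156556, 439690, 360288, 8, 362128, 3, 362896, 18),
    (13400, 509102, 360312, 12, 361536, 2, 363488, 17),
    (32032, 224964, 360372, 2, 362032, 10, 364424, 5),
    (335946, 69173, 360424, 15, 362464, 0, 362984, 14),
    (334637, 212022, 360444, 4, 361824, 4, 362448, 18),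
    (286861, 38877, 361680, 17, 362672, 15, 362848, 6),
    (37052, 300154, 361728, 14, 362624, 11, 363440, 4),
    (113120, 215302, 362144, 1, 363944, 15, 364672, 8),
    (77514, 416068, 362256, 7, 363392, 5, 364608, 15),
    (3569, 53373, 362528, 8, 363928, 18, 363984, 13),
    (410141, 479822, 362888, 8, 364200, 5, 364528, 9),
    (480382, 41453, 362912, 7, 363328, 14, 364448, 11),
    (97566, 44493, 363152, 9, 363840, 12, 363880, 6),
    (77016, 148921, 363568, 2, 363792, 17, 364312, 9)]"],
    simp only: q19_def B19_def eval_simps cong: eval_congs, simp_all)

lemma triangles_19_21: "triangle_system q19 B19 441 367565"
  by (rule triangle_system_extend[OF triangles_19_20, where rows =
   "[(426259, 459, 364800, 15, 365240, 17, 366144, 18),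
    (246694, 121390, 364872, 13, 365400, 15, 366032, 5),
    (521555, 453853, 364960, 11, 366068, 6, 367476, 7),
    (468209, 287389, 365104, 8, 366952, 18, 367256, 9),
    (146104, 22979, 365152, 16, 367280, 14, 367564, 9),
    (102215, 475346, 365192, 6, 367000, 17, 367056, 4),
    (361120, 234694, 365200, 6, 365664, 0, 365760, 11),
    (287438, 16504, 365272, 3, 366452, 2, 366960, 13),
    (444740, 425343, 365440, 1, 365712, 8, 367252, 18),
    (135897, 287353, 365480, 17, 366528, 8, 366564, 4),
    (138089, 365167, 365568, 15, 366048, 12, 366384, 14),
    (371476, 370139, 365648, 2, 367092, 1, 367552, 6),
    (482462, 457089, 365880, 7, 366304, 14, 367400, 12),
    (409511, 323529, 365912, 2, 366824, 0, 367208, 2),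
    (179710, 276060, 365924, 10, 366244, 17, 367384, 10),
    (356034, 421928, 365976, 3, 365992, 0, 366072, 10),
    (519547, 433568, 366112, 15, 367396, 12, 367432, 2),
    (46076, 447866, 366192, 1, 366336, 8, 367016, 11),
    (334132, 447312, 366372, 0, 367012, 8, 367024, 18),
    (426067, 328310, 366516, 13, 367048, 12, 367268, 13),
    (153251, 186723, 367072, 9, 367312, 15, 367540, 14)]"],
    simp only: q19_def B19_def eval_simps cong: eval_congs, simp_all)

lemma triangles_19_22: "triangle_system q19 B19 462 371029"
  by (rule triangle_system_extend[OF triangles_19_21, where rows =
   "[(313074, 76995, 367576, 12, 368484, 8, 369152, 11),
    (138518, 290857, 367588, 1, 367908, 7, 370376, 17),
    (53930, 368549, 367768, 5, 367864, 6, 370672, 8),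
    (8582, 294977, 367780, 10, 369536, 11, 369744, 14),
    (275137, 517271, 367860, 9, 367944, 12, 368992, 17),
    (323588, 502340, 367968, 11, 368008, 4, 369392, 4),
    (236653, 98663, 368032, 18, 369296, 10, 370664, 11),
    (453715, 250213, 368088, 13, 368632, 6, 370088, 11),
    (320591, 491584, 368100, 18, 368704, 6, 370472, 16),
    (90873, 261377, 368168, 5, 369848, 17, 369856, 12),
    (24414, 517965, 368320, 18, 370528, 7, 370644, 17),
    (488338, 504676, 368360, 1, 369040, 4, 370824, 10),
    (434428, 15998, 368368, 16, 370592, 7, 370960, 8),
    (28802, 246256, 368400, 5, 369608, 17, 370400, 3),
    (187265, 255908, 368440, 10, 370280, 15, 370456, 11),
    (143172, 381496, 368448, 17, 369616, 6, 370688, 7),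
    (356981, 248300, 368496, 16, 369904, 14, 370032, 0),
    (378925, 196077, 368592, 5, 370020, 5, 371028, 8),
    (178220, 431888, 369760, 1, 370144, 2, 370768, 4),
    (117534, 430905, 370128, 2, 370468, 18, 370576, 16),
    (63618, 361637, 370208, 6, 370616, 12, 371000, 3)]"],
    simp only: q19_def B19_def eval_simps cong: eval_congs, simp_all)

lemma triangles_19_23: "triangle_system q19 B19 483 373585"
  by (rule triangle_system_extend[OF triangles_19_22, where rows =
   "[(329660, 71240, 371072, 8, 372408, 8, 373144, 6),
    (260114, 514872, 371108, 13, 372040, 18, 372152, 14),
    (348316, 90874, 371112, 9, 372296, 15, 373168, 15),
    (242583, 295677, 371152, 10, 372104, 11, 372196, 14),
    (347028, 279696, 371168, 4, 372436, 9, 373008, 17),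
    (114642, 401733, 371192, 7, 371424, 7, 372076, 9),
    (33824, 329657, 371232, 1, 372536, 11, 372604, 9),
    (446251, 41109, 371304, 5, 371564, 8, 373264, 15),
    (288824, 46371, 371408, 2, 371684, 8, 373360, 16),
    (187486, 413048, 371528, 16, 371688, 5, 372680, 17),
    (229144, 174836, 371536, 7, 372220, 11, 373544, 4),
    (308996, 473239, 371548, 2, 372160, 12, 372544, 17),
    (351694, 210685, 371592, 16, 372060, 17, 372648, 3),
    (74340, 166060, 371600, 8, 372084, 3, 373584, 10),
    (184413, 91573, 371628, 4, 371660, 15, 372440, 10),
    (284309, 17179, 371776, 8, 372644, 13, 372724, 17),
    (6410, 444774, 371816, 11, 372048, 0, 372524, 4),
    (139922, 304557, 372140, 7, 372344, 10, 372452, 2),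
    (339397, 320346, 372496, 8, 373456, 3, 373472, 17),
    (224068, 98471, 372896, 5, 373216, 0, 373424, 9),
    (347247, 518645, 373192, 0, 373348, 6, 373528, 17)]"],
    simp only: q19_def B19_def eval_simps cong: eval_congs, simp_all)

lemma triangles_19_24: "triangle_system q19 B19 504 375597"
  by (rule triangle_system_extend[OF triangles_19_23, where rows =
   "[(314207, 94109, 373620, 18, 373648, 11, 374512, 16),
    (441572, 323952, 373664, 18, 374676, 11, 374704, 1),
    (426520, 440218, 373716, 1, 373720, 8, 374776, 15),
    (221811, 333351, 373732, 10, 373928, 15, 375252, 11),
    (227124, 81224, 373792, 11, 374008, 4, 374736, 0),
    (17501, 49408, 373872, 6, 374320, 4, 374344, 3),
    (378878, 235236, 373936, 11, 374380, 16, 375476, 6),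
    (66467, 70132, 373968, 0, 374272, 14, 374500, 12),
    (378796, 377937, 373984, 18, 374268, 15, 374960, 4),
    (429903, 22635, 374056, 11, 374488, 18, 374632, 15),
    (422590, 329977, 374136, 10, 374728, 16, 375120, 10),
    (379932, 87614, 374160, 15, 375156, 1, 375456, 12),
    (90990, 213814, 374200, 8, 375076, 10, 375508, 5),
    (35199, 283060, 374208, 3, 374748, 7, 375412, 18),
    (352027, 7229, 374244, 9, 374456, 0, 375468, 12),
    (259875, 34659, 374544, 1, 375416, 15, 375596, 17),
    (158507, 322931, 374616, 8, 374656, 1, 374716, 7),
    (217906, 149800, 374628, 15, 375244, 11, 375296, 3),
    (326152, 222361, 374640, 1, 374912, 15, 375392, 9),
    (4609, 113227, 374816, 11, 375440, 4, 375512, 11),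
    (513846, 491672, 375088, 0, 375112, 4, 375584, 3)]"],
    simp only: q19_def B19_def eval_simps cong: eval_congs, simp_all)

lemma triangles_19_25: "triangle_system q19 B19 525 378705"
  by (rule triangle_system_extend[OF triangles_19_24, where rows =
   "[(230364, 179487, 375604, 5, 376768, 1, 377992, 3),
    (240286, 344024, 375640, 8, 375980, 7, 378216, 9),
    (442156, 319703, 375676, 9, 376408, 0, 376556, 3),
    (407147, 304510, 375680, 5, 375928, 17, 376128, 13),
    (208519, 44336, 375716, 12, 376684, 3, 378576, 16),
    (99740, 258750, 375728, 4, 375988, 16, 376540, 13),
    (301957, 340630, 375740, 11, 376284, 3, 378672, 8),
    (262535, 110134, 375752, 3, 376176, 0, 376792, 3),
    (48448, 335143, 375772, 8, 377248, 1, 378072, 5),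
    (123927, 308551, 375796, 9, 376488, 17, 377728, 17),
    (389876, 447752, 375808, 11, 378224, 10, 378520, 7),
    (153458, 398332, 375880, 7, 376420, 15, 378320, 2),
    (112792, 351242, 375968, 13, 376376, 8, 377936, 18),
    (463878, 45058, 376012, 1, 376576, 11, 376624, 0),
    (497600, 230274, 376240, 8, 376568, 2, 378000, 2),
    (145820, 224428, 376308, 11, 378096, 11, 378592, 8),
    (485604, 79203, 376384, 7, 377184, 7, 377952, 16),
    (183677, 209851, 376424, 8, 377424, 4, 378664, 6),
    (374205, 307370, 376472, 1, 376736, 3, 378624, 14),
    (34, 13593, 376528, 2, 376612, 7, 378176, 14),
    (131017, 461543, 376816, 7, 377808, 5, 378704, 17)]"],
    simp only: q19_def B19_def eval_simps cong: eval_congs, simp_all)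

lemma triangles_19_26: "triangle_system q19 B19 546 381313"
  by (rule triangle_system_extend[OF triangles_19_25, where rows =
   "[(506498, 404658, 378760, 3, 379304, 10, 380656, 4),
    (159992, 229771, 378864, 9, 379016, 16, 379860, 18),
    (9756, 198162, 378976, 9, 379344, 15, 380848, 10),
    (46523, 452750, 379040, 15, 379072, 11, 379804, 3),
    (507406, 341266, 379200, 8, 379300, 6, 380600, 2),
    (216764, 463588, 379224, 6, 380160, 10, 380920, 4),
    (276327, 517719, 379236, 11, 379288, 2, 379828, 18),
    (477306, 320682, 379264, 16, 380152, 5, 380536, 11),
    (304280, 88349, 379360, 11, 379744, 1, 380620, 13),
    (35833, 372486, 379424, 12, 379640, 3, 380352, 0),
    (425330, 438767, 379504, 18, 379636, 5, 380304, 2),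
    (360749, 60252, 379568, 6, 380056, 18, 381120, 17),
    (244816, 140353, 379672, 9, 379756, 7, 380560, 6),
    (308495, 161304, 379684, 17, 380256, 18, 380552, 15),
    (263647, 248851, 379864, 3, 379968, 1, 380072, 6),
    (21095, 504484, 380196, 16, 380688, 16, 380724, 1),
    (268694, 374784, 380240, 15, 380388, 12, 381216, 7),
    (415259, 35609, 380400, 12, 380496, 14, 381072, 0),
    (485791, 450034, 380512, 4, 380532, 11, 380824, 1),
    (220749, 440015, 380772, 15, 380872, 14, 381312, 7),
    (469015, 333202, 380896, 10, 380908, 4, 381088, 4)]"],
    simp only: q19_def B19_def eval_simps cong: eval_congs, simp_all)

lemma triangles_19_27: "triangle_system q19 B19 567 383897"
  by (rule triangle_system_extend[OF triangles_19_26, where rows =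
   "[(52545, 516647, 381352, 12, 381616, 1, 383668, 13),
    (35330, 273427, 381360, 15, 381608, 13, 383560, 10),
    (301063, 347396, 381408, 0, 382440, 1, 382776, 0),
    (145106, 512932, 381456, 11, 383128, 9, 383868, 3),
    (512359, 446828, 381504, 8, 383272, 2, 383800, 0),
    (362186, 350022, 381528, 10, 381648, 11, 382152, 14),
    (371183, 452557, 381544, 12, 382824, 7, 383700, 10),
    (299693, 342634, 381568, 6, 382692, 9, 383828, 16),
    (104279, 431217, 381736, 18, 382080, 2, 382420, 13),
    (302085, 208401, 381744, 17, 382716, 13, 383720, 5),
    (52965, 150137, 381768, 10, 382392, 17, 382696, 18),
    (231170, 379656, 381856, 0, 382280, 18, 383268, 14),
    (105496, 237317, 381876, 5, 382636, 4, 382944, 2),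
    (254979, 115083, 381888, 15, 382316, 11, 382928, 14),
    (13678, 376809, 381924, 2, 382848, 12, 383608, 13),
    (160087, 300839, 381928, 15, 382820, 15, 383716, 2),
    (289147, 72354, 382016, 3, 382884, 16, 383472, 10),
    (194599, 411630, 382104, 11, 383660, 2, 383672, 0),
    (151983, 362198, 382128, 6, 383328, 11, 383896, 6),
    (146881, 309498, 382176, 2, 383444, 16, 383464, 17),
    (39212, 36712, 383436, 7, 383488, 6, 383680, 16)]"],
    simp only: q19_def B19_def eval_simps cong: eval_congs, simp_all)

lemma triangles_19_28: "triangle_system q19 B19 588 386917"
  by (rule triangle_system_extend[OF triangles_19_27, where rows =
   "[(354703, 216431, 383908, 8, 385736, 15, 386508, 16),
    (235799, 261439, 383932, 16, 384888, 8, 385840, 0),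
    (420068, 311280, 383944, 7, 385568, 3, 386160, 12),
    (168494, 10047, 383964, 10, 385712, 9, 386080, 3),
    (30635, 440553, 384144, 2, 386256, 1, 386440, 2),
    (144644, 466919, 384172, 10, 385312, 8, 385600, 2),
    (415223, 186848, 384192, 16, 384984, 13, 385832, 5),
    (366016, 253836, 384216, 4, 384492, 5, 386448, 6),
    (62029, 381759, 384272, 15, 384792, 18, 384828, 0),
    (114263, 265965, 384288, 14, 384420, 1, 386680, 4),
    (237181, 49883, 384380, 15, 385024, 12, 386916, 16),
    (322594, 458386, 384384, 16, 384848, 10, 384928, 10),
    (78531, 111588, 384404, 0, 386024, 5, 386176, 7),
    (132614, 348562, 384464, 11, 386544, 11, 386848, 13),
    (35275, 314062, 384544, 15, 386032, 8, 386396, 18),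
    (438340, 274622, 384700, 16, 385000, 12, 385344, 17),
    (403806, 496237, 384712, 16, 384940, 10, 385216, 4),
    (489061, 383310, 384732, 0, 386296, 13, 386764, 11),
    (375207, 204838, 384972, 9, 386484, 10, 386772, 15),
    (285773, 10228, 385888, 10, 386200, 14, 386744, 12),
    (305976, 496934, 385984, 7, 386248, 13, 386880, 12)]"],
    simp only: q19_def B19_def eval_simps cong: eval_congs, simp_all)

lemma triangles_19_29: "triangle_system q19 B19 609 389069"
  by (rule triangle_system_extend[OF triangles_19_28, where rows =
   "[(318234, 13763, 386928, 10, 387560, 3, 388048, 4),
    (154927, 407412, 387040, 4, 387624, 8, 387764, 14),
    (216040, 55461, 387064, 11, 387728, 11, 387904, 2),
    (361226, 448393, 387240, 18, 388808, 16, 389008, 16),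
    (47183, 330252, 387272, 6, 387720, 18, 388368, 17),
    (351394, 33334, 387368, 13, 387556, 7, 389048, 6),
    (343914, 80835, 387400, 9, 388060, 11, 388256, 18),
    (141209, 469565, 387424, 6, 388404, 0, 388936, 5),
    (53267, 306763, 387464, 1, 387796, 9, 388436, 6),
    (196359, 497574, 387508, 8, 388888, 2, 389024, 11),
    (58996, 165469, 387512, 5, 387856, 18, 388168, 11),
    (77152, 182550, 387544, 7, 388084, 18, 388828, 2),
    (473746, 431278, 387568, 7, 388232, 10, 388464, 2),
    (317813, 227735, 387656, 12, 388600, 0, 388664, 14),
    (407587, 339088, 387776, 6, 388240, 4, 388312, 17),
    (302441, 176890, 387812, 11, 388624, 12, 388784, 18),
    (179756, 515317, 387816, 3, 388864, 15, 389036, 1),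
    (504713, 291649, 387824, 0, 388504, 7, 388956, 18),
    (505809, 469255, 387896, 15, 388760, 13, 388972, 6),
    (208454, 508014, 387940, 5, 388028, 13, 389068, 13),
    (233542, 315098, 388328, 9, 388456, 9, 388572, 4)]"],
    simp only: q19_def B19_def eval_simps cong: eval_congs, simp_all)

lemma triangles_19_30: "triangle_system q19 B19 630 391881"
  by (rule triangle_system_extend[OF triangles_19_29, where rows =
   "[(114042, 452558, 389080, 11, 390568, 15, 391644, 10),
    (511914, 283995, 389092, 16, 389704, 15, 390384, 13),
    (391058, 174792, 389096, 6, 389424, 3, 390136, 3),
    (432550, 168906, 389104, 2, 390740, 4, 391712, 0),
    (464346, 87491, 389376, 13, 389864, 5, 391696, 5),
    (73858, 192778, 389560, 1, 390552, 18, 390820, 5),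
    (238239, 170414, 389680, 14, 390804, 1, 391880, 7),
    (180602, 479286, 389752, 15, 389904, 4, 391512, 6),
    (215901, 31855, 389804, 12, 390524, 15, 391552, 6),
    (381088, 131444, 389816, 14, 390280, 1, 391248, 10),
    (447428, 159999, 389844, 5, 389992, 7, 390144, 2),
    (219754, 454097, 389848, 18, 390992, 18, 391384, 7),
    (599, 372043, 389860, 12, 390376, 12, 390880, 3),
    (509522, 403625, 390000, 16, 390288, 2, 391844, 4),
    (342259, 451664, 390076, 0, 390952, 5, 391828, 3),
    (423644, 15338, 390216, 1, 390808, 16, 391328, 10),
    (469735, 100737, 390432, 0, 391056, 12, 391672, 15),
    (190264, 511582, 390756, 13, 390984, 14, 391536, 13),
    (107513, 515261, 390844, 10, 390960, 11, 391456, 10),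
    (22470, 510310, 391008, 3, 391068, 17, 391488, 17),
    (66389, 292075, 391020, 5, 391548, 13, 391660, 13)]"],
    simp only: q19_def B19_def eval_simps cong: eval_congs, simp_all)

lemma triangles_19_31: "triangle_system q19 B19 651 397185"
  by (rule triangle_system_extend[OF triangles_19_30, where rows =
   "[(343739, 206257, 391888, 2, 392620, 11, 397184, 1),
    (350344, 448438, 391904, 5, 392440, 1, 392544, 0),
    (21757, 196038, 391928, 16, 392296, 9, 392932, 1),
    (26006, 485393, 391936, 15, 392412, 11, 392660, 6),
    (45326, 292346, 391976, 15, 392436, 4, 393196, 14),
    (476832, 457263, 392008, 5, 392564, 11, 395584, 15),
    (81515, 238280, 392072, 2, 392148, 7, 392380, 0),
    (485978, 431895, 392108, 8, 392320, 7, 396544, 4),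
    (229935, 38592, 392120, 17, 393124, 8, 395840, 15),
    (462620, 41892, 392128, 0, 392936, 8, 393148, 8),
    (195611, 205540, 392168, 7, 392280, 15, 393048, 14),
    (145921, 443261, 392224, 1, 392344, 2, 392664, 14),
    (396101, 82882, 392368, 2, 392784, 5, 393128, 2),
    (278203, 189498, 392488, 15, 392896, 8, 394560, 15),
    (166291, 372563, 392520, 18, 392628, 10, 393168, 2),
    (241843, 245426, 392540, 5, 392888, 5, 397088, 15),
    (290367, 82856, 392592, 1, 396192, 18, 396736, 0),
    (105205, 320762, 392640, 0, 392820, 9, 397120, 7),
    (359063, 367447, 392744, 13, 392956, 2, 396704, 8),
    (506784, 266106, 392848, 18, 392992, 9, 396416, 1),
    (499355, 516471, 392920, 12, 393064, 13, 396320, 5)]"],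
    simp only: q19_def B19_def eval_simps cong: eval_congs, simp_all)

lemma triangles_19_32: "triangle_system q19 B19 672 404433"
  by (rule triangle_system_extend[OF triangles_19_31, where rows =
   "[(226278, 459120, 397472, 9, 398224, 3, 400256, 3),
    (126146, 471177, 397856, 10, 403856, 6, 404200, 17),
    (296703, 494658, 398176, 14, 400576, 10, 401792, 6),
    (390818, 172891, 398400, 11, 398544, 6, 400704, 14),
    (69365, 267278, 398464, 13, 404040, 13, 404432, 1),
    (517181, 506755, 398592, 11, 401936, 10, 402928, 13),
    (488847, 198128, 398848, 4, 399424, 18, 404048, 8),
    (357073, 444948, 399232, 7, 402416, 3, 402608, 16),
    (45330, 345951, 399392, 13, 402176, 2, 404336, 4),
    (6860, 74672, 399808, 2, 402728, 4, 404424, 17),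
    (506363, 511499, 400352, 13, 402128, 11, 402336, 8),
    (86507, 106348, 400480, 13, 403104, 11, 403488, 4),
    (406716, 163496, 401024, 3, 403424, 7, 404328, 10),
    (501766, 11458, 401120, 16, 403088, 11, 404128, 5),
    (392516, 300149, 401152, 2, 401344, 2, 401696, 6),
    (93333, 248946, 402032, 13, 402880, 9, 403080, 2),
    (233602, 472262, 402464, 6, 402768, 1, 403328, 9),
    (429840, 393748, 402496, 3, 403808, 9, 403968, 10),
    (235565, 101898, 402560, 11, 402920, 7, 404064, 12),
    (282547, 423300, 402824, 8, 403216, 2, 404160, 18),
    (191679, 211473, 403664, 0, 403944, 6, 404240, 1)]"],
    simp only: q19_def B19_def eval_simps cong: eval_congs, simp_all)

lemma triangles_19_33: "triangle_system q19 B19 693 408745"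
  by (rule triangle_system_extend[OF triangles_19_32, where rows =
   "[(477878, 27991, 404448, 18, 407208, 9, 407240, 4),
    (393742, 227753, 404528, 12, 405712, 5, 407872, 8),
    (173119, 94373, 404672, 2, 406176, 11, 408640, 10),
    (113496, 498151, 404752, 1, 406440, 14, 408456, 4),
    (326508, 494116, 404904, 3, 405056, 4, 408032, 11),
    (73886, 314519, 404936, 13, 406600, 6, 407712, 3),
    (431705, 188826, 404960, 10, 406472, 16, 407368, 14),
    (397035, 202482, 405120, 3, 407248, 15, 407536, 14),
    (302650, 308033, 405192, 4, 407376, 2, 408232, 2),
    (467003, 170770, 405200, 10, 405328, 0, 408480, 2),
    (372303, 465377, 405296, 0, 406848, 1, 407104, 10),
    (180444, 356635, 405384, 13, 407216, 1, 408464, 0),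
    (100739, 199475, 405832, 2, 406256, 11, 406912, 4),
    (494781, 202525, 405896, 4, 406304, 0, 408008, 10),
    (322418, 127557, 406160, 11, 407296, 3, 407440, 3),
    (262975, 322467, 406248, 10, 407456, 2, 408416, 16),
    (97216, 228497, 406528, 11, 406608, 2, 406888, 14),
    (217874, 419158, 407056, 16, 407976, 6, 408320, 4),
    (226249, 20602, 407168, 18, 407648, 2, 407744, 13),
    (110162, 16087, 407432, 18, 407936, 10, 408744, 8),
    (304999, 505204, 407784, 4, 407984, 10, 408512, 4)]"],
    simp only: q19_def B19_def eval_simps cong: eval_congs, simp_all)

lemma triangles_19_34: "triangle_system q19 B19 714 413313"
  by (rule triangle_system_extend[OF triangles_19_33, where rows =
   "[(173334, 463979, 408752, 13, 412320, 17, 413312, 17),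
    (300874, 99811, 408784, 10, 410240, 1, 410560, 5),
    (283173, 308169, 408800, 18, 409224, 14, 412808, 0),
    (236727, 163081, 409064, 8, 411272, 9, 412640, 10),
    (187704, 228768, 409128, 14, 409544, 7, 412136, 4),
    (120624, 230987, 409232, 11, 410368, 13, 413272, 18),
    (392719, 169787, 409248, 6, 410128, 6, 410928, 1),
    (155484, 108203, 409280, 16, 411024, 3, 412944, 4),
    (183608, 264809, 409568, 13, 411824, 4, 413092, 1),
    (208787, 144343, 410528, 10, 411904, 7, 413032, 2),
    (448236, 345820, 410832, 12, 411424, 4, 411680, 18),
    (16935, 34687, 410848, 17, 412064, 7, 412832, 0),
    (178039, 126673, 410960, 5, 412992, 7, 413152, 4),
    (417637, 57506, 411016, 6, 412904, 14, 413240, 9),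
    (378191, 62050, 411072, 16, 411856, 1, 412240, 5),
    (166868, 150040, 411184, 9, 412048, 6, 412144, 4),
    (84294, 405050, 411280, 17, 411872, 16, 412120, 0),
    (55844, 240569, 411952, 5, 412616, 2, 413056, 12),
    (495747, 320167, 412040, 13, 412352, 1, 413176, 5),
    (308589, 340748, 412232, 1, 412376, 1, 412816, 17),
    (212933, 412817, 412400, 7, 412448, 7, 412472, 5)]"],
    simp only: q19_def B19_def eval_simps cong: eval_congs, simp_all)

lemma triangles_19_35: "triangle_system q19 B19 735 416513"
  by (rule triangle_system_extend[OF triangles_19_34, where rows =
   "[(448389, 148988, 413348, 11, 413520, 13, 416368, 10),
    (508043, 145800, 413440, 10, 413480, 6, 416432, 16),
    (488155, 236766, 413576, 1, 413952, 13, 415680, 12),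
    (285369, 285515, 413656, 8, 416200, 15, 416424, 2),
    (466498, 134451, 413672, 6, 415040, 1, 415064, 2),
    (360650, 484, 414000, 7, 414024, 0, 414632, 5),
    (386756, 396494, 414032, 6, 415184, 18, 416176, 4),
    (341371, 403329, 414112, 11, 415528, 9, 416104, 15),
    (41258, 318503, 414208, 15, 414720, 9, 416500, 9),
    (424763, 163446, 414344, 16, 416148, 11, 416340, 15),
    (78937, 236420, 414352, 5, 415124, 13, 416320, 7),
    (322286, 24957, 414392, 18, 414400, 15, 414712, 1),
    (111205, 266362, 414440, 16, 416464, 2, 416512, 17),
    (435380, 147844, 414480, 10, 415104, 5, 416456, 7),
    (153642, 119089, 414552, 14, 414864, 1, 416504, 13),
    (79163, 311452, 414564, 7, 415672, 0, 416384, 3),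
    (371834, 136280, 414640, 18, 415128, 16, 415568, 11),
    (355234, 160139, 414992, 18, 415396, 11, 416248, 7),
    (266385, 478602, 415140, 15, 415536, 4, 416288, 3),
    (50151, 179708, 415152, 8, 415200, 12, 415476, 17),
    (387182, 383124, 415744, 18, 416032, 1, 416088, 3)]"],
    simp only: q19_def B19_def eval_simps cong: eval_congs, simp_all)

lemma triangles_19_36: "triangle_system q19 B19 756 420209"
  by (rule triangle_system_extend[OF triangles_19_35, where rows =
   "[(283578, 490370, 416560, 11, 416880, 0, 418784, 13),
    (36230, 283764, 416656, 6, 418192, 9, 419704, 10),
    (160641, 464551, 416744, 3, 417400, 8, 420160, 18),
    (385200, 479712, 416752, 16, 419536, 14, 419976, 16),
    (286202, 91558, 416856, 11, 417104, 13, 419824, 4),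
    (167859, 199443, 416896, 10, 417160, 1, 417256, 9),
    (419487, 208615, 416968, 8, 417120, 10, 419172, 7),
    (229988, 375395, 417016, 6, 417264, 15, 419392, 9),
    (230139, 412045, 417060, 9, 419344, 9, 419528, 18),
    (34048, 442487, 417144, 5, 417360, 15, 419136, 8),
    (147214, 457961, 417168, 10, 417208, 10, 419776, 11),
    (397341, 128979, 417184, 8, 417204, 18, 417688, 11),
    (202652, 93562, 417416, 1, 417424, 3, 418304, 15),
    (522392, 304152, 417460, 17, 418048, 16, 419816, 7),
    (34393, 311740, 417496, 2, 417700, 6, 419000, 18),
    (356700, 297505, 417636, 8, 419104, 11, 419620, 2),
    (35411, 265828, 417648, 13, 418768, 15, 420208, 0),
    (493687, 212820, 417784, 18, 418240, 11, 419680, 4),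
    (245723, 92357, 418912, 1, 419504, 12, 419768, 5),
    (54088, 359886, 418952, 4, 419056, 10, 419840, 16),
    (114092, 296625, 419128, 2, 419236, 8, 419656, 2)]"],
    simp only: q19_def B19_def eval_simps cong: eval_congs, simp_all)

lemma triangles_19_37: "triangle_system q19 B19 777 422849"
  by (rule triangle_system_extend[OF triangles_19_36, where rows =
   "[(39029, 53574, 420224, 0, 420836, 7, 422608, 14),
    (484579, 87638, 420248, 16, 420752, 15, 421832, 13),
    (93139, 442965, 420260, 12, 420500, 17, 420820, 3),
    (270998, 454313, 420384, 6, 421780, 11, 422504, 1),
    (222908, 362804, 420440, 11, 420600, 14, 421168, 5),
    (318380, 518489, 420504, 7, 420952, 9, 422032, 1),
    (432256, 118434, 420680, 6, 421760, 12, 422736, 4),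
    (493645, 247103, 420728, 2, 421684, 8, 422488, 17),
    (103220, 218951, 420744, 7, 421492, 18, 422232, 5),
    (260587, 500245, 420768, 7, 421264, 11, 421304, 7),
    (495416, 443006, 420800, 16, 421720, 1, 422656, 8),
    (383193, 144848, 420824, 6, 421280, 17, 422848, 15),
    (242046, 202579, 420840, 2, 420992, 3, 421448, 17),
    (104446, 316697, 420976, 18, 421360, 0, 421592, 7),
    (173984, 276665, 421028, 16, 421588, 12, 421688, 0),
    (4323, 247705, 421088, 15, 421192, 18, 421732, 13),
    (248242, 382612, 421156, 16, 422272, 18, 422344, 1),
    (128417, 1715, 421348, 2, 422416, 15, 422704, 6),
    (117090, 6610, 421352, 6, 422548, 3, 422624, 0),
    (380278, 95520, 421696, 3, 422648, 13, 422776, 0),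
    (483131, 418119, 422296, 7, 422600, 1, 422772, 11)]"],
    simp only: q19_def B19_def eval_simps cong: eval_congs, simp_all)

lemma triangles_19_38: "triangle_system q19 B19 798 425381"
  by (rule triangle_system_extend[OF triangles_19_37, where rows =
   "[(331329, 484181, 422896, 13, 423384, 12, 424816, 8),
    (194187, 364331, 423016, 14, 423264, 4, 423540, 3),
    (94344, 306689, 423064, 12, 424376, 7, 424952, 0),
    (32768, 474638, 423076, 1, 423160, 14, 423544, 11),
    (394821, 256694, 423112, 3, 423472, 5, 423696, 9),
    (55255, 358600, 423168, 5, 423520, 0, 423856, 4),
    (76915, 343341, 423396, 7, 424136, 11, 424432, 14),
    (424720, 503604, 423584, 4, 423616, 12, 425300, 7),
    (353106, 508966, 423604, 17, 424664, 3, 425320, 15),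
    (132599, 314278, 423608, 17, 424408, 17, 424904, 4),
    (263112, 342496, 423640, 5, 424544, 0, 425380, 8),
    (181830, 354637, 423656, 8, 423792, 15, 423844, 14),
    (325128, 178307, 423732, 12, 424000, 12, 425248, 12),
    (448209, 244617, 423828, 16, 424632, 17, 424768, 9),
    (322834, 520172, 423968, 5, 424448, 2, 424868, 7),
    (390748, 183479, 424104, 16, 425008, 14, 425140, 2),
    (259988, 443732, 424240, 6, 424640, 7, 425040, 17),
    (462473, 426138, 424264, 7, 424592, 17, 424760, 0),
    (67776, 427889, 424288, 10, 424660, 8, 425188, 7),
    (267152, 112004, 424308, 9, 424688, 14, 425268, 3),
    (509011, 342821, 424328, 5, 424680, 14, 425280, 18)]"],
    simp only: q19_def B19_def eval_simps cong: eval_congs, simp_all)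

lemma triangles_19_39: "triangle_system q19 B19 819 430937"
  by (rule triangle_system_extend[OF triangles_19_38, where rows =
   "[(55046, 293075, 425440, 16, 427040, 7, 428616, 0),
    (409969, 324520, 425464, 10, 429104, 9, 430496, 13),
    (331840, 519387, 425488, 0, 425720, 11, 428448, 8),
    (367760, 176660, 425504, 11, 427904, 9, 430672, 3),
    (2303, 368161, 425528, 7, 427712, 16, 429792, 17),
    (479269, 518867, 425680, 14, 425888, 7, 430016, 5),
    (7880, 432273, 425696, 2, 429152, 14, 430480, 5),
    (270561, 382500, 425728, 0, 428640, 6, 430936, 17),
    (503603, 326878, 425800, 1, 425908, 2, 430712, 12),
    (385761, 116179, 425824, 4, 428368, 13, 429872, 7),
    (244562, 133389, 425844, 5, 425956, 16, 429200, 5),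
    (439002, 109677, 425864, 4, 428424, 10, 430064, 4),
    (264713, 431809, 425872, 10, 429192, 3, 429600, 0),
    (66244, 81994, 426752, 18, 427664, 2, 430912, 13),
    (200689, 409770, 426944, 16, 428240, 10, 430752, 0),
    (187239, 157951, 427264, 5, 429008, 5, 430640, 17),
    (473062, 197979, 427616, 9, 428528, 17, 429696, 14),
    (516513, 203739, 428256, 5, 428928, 1, 429136, 5),
    (240417, 221427, 428336, 6, 430408, 14, 430416, 6),
    (390899, 441334, 429296, 17, 429984, 1, 430208, 4),
    (231913, 509685, 429424, 10, 429584, 14, 430384, 13)]"],
    simp only: q19_def B19_def eval_simps cong: eval_congs, simp_all)

lemma triangles_19_40: "triangle_system q19 B19 840 434833"
  by (rule triangle_system_extend[OF triangles_19_39, where rows =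
   "[(251311, 309783, 431000, 2, 431344, 18, 434072, 10),
    (373634, 109228, 431056, 18, 431104, 18, 433600, 4),
    (171030, 329446, 431072, 0, 432488, 7, 433184, 4),
    (346028, 97748, 431176, 1, 432768, 7, 434304, 15),
    (134617, 494425, 431240, 10, 432888, 6, 433936, 18),
    (435021, 316927, 431248, 7, 431288, 15, 432416, 11),
    (151797, 392911, 431332, 4, 434128, 13, 434768, 2),
    (464048, 410936, 431416, 6, 432536, 4, 434024, 6),
    (521658, 133993, 431444, 11, 431460, 17, 432440, 4),
    (79888, 518938, 431508, 5, 432056, 9, 433240, 10),
    (323135, 89460, 431524, 3, 433744, 6, 433952, 11),
    (524054, 306092, 431536, 9, 431568, 0, 433112, 9),
    (509138, 349886, 431584, 16, 431864, 5, 433528, 13),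
    (350073, 416921, 431700, 15, 431744, 12, 432608, 8),
    (442693, 523663, 431716, 12, 431908, 6, 432724, 16),
    (333844, 340275, 431896, 15, 433704, 5, 434004, 3),
    (381270, 370879, 432032, 8, 433544, 3, 434824, 1),
    (274383, 115230, 432128, 17, 432512, 15, 434760, 10),
    (518869, 203076, 432560, 1, 433264, 5, 434624, 2),
    (376410, 511487, 433056, 12, 434576, 13, 434784, 5),
    (178386, 413370, 433664, 11, 433984, 9, 434832, 5)]"],
    simp only: q19_def B19_def eval_simps cong: eval_congs, simp_all)

lemma triangles_19_41: "triangle_system q19 B19 861 437945"
  by (rule triangle_system_extend[OF triangles_19_40, where rows =
   "[(120484, 247320, 434848, 7, 435816, 3, 437756, 6),
    (387773, 154791, 434928, 4, 435280, 0, 437360, 15),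
    (167047, 476996, 435008, 13, 436956, 10, 437312, 7),
    (269710, 54818, 435144, 10, 435632, 2, 436960, 18),
    (268662, 435557, 435152, 6, 435336, 3, 436512, 13),
    (415832, 384306, 435168, 17, 436632, 6, 437496, 9),
    (443115, 519566, 435272, 15, 436196, 14, 436888, 5),
    (460886, 106773, 435296, 4, 436048, 3, 437676, 2),
    (518696, 134656, 435344, 4, 436496, 14, 436924, 3),
    (125974, 124057, 435392, 14, 435556, 8, 436836, 14),
    (225955, 33620, 435416, 0, 437100, 17, 437108, 13),
    (88903, 312883, 435560, 16, 435744, 17, 437744, 1),
    (372927, 246959, 435568, 16, 436644, 18, 436936, 8),
    (252069, 31476, 435704, 3, 436104, 18, 437600, 2),
    (421066, 483141, 435812, 14, 436040, 8, 437944, 9),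
    (314124, 171387, 435876, 18, 436980, 0, 437400, 10),
    (382756, 153743, 436016, 0, 436128, 9, 437224, 6),
    (370608, 143858, 436304, 9, 436912, 4, 437204, 8),
    (127365, 501860, 436464, 2, 437064, 18, 437576, 14),
    (513823, 306975, 436820, 17, 437136, 16, 437596, 4),
    (153103, 411036, 436884, 12, 436944, 17, 436992, 4)]"],
    simp only: q19_def B19_def eval_simps cong: eval_congs, simp_all)

lemma triangles_19_42: "triangle_system q19 B19 882 440545"
  by (rule triangle_system_extend[OF triangles_19_41, where rows =
   "[(60666, 345560, 437988, 13, 439804, 15, 440384, 8),
    (133248, 168699, 438012, 6, 439600, 5, 439688, 10),
    (445210, 428468, 438032, 15, 438140, 0, 439712, 2),
    (176529, 467451, 438068, 5, 438896, 18, 439328, 8),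
    (428848, 461366, 438080, 15, 438848, 7, 440312, 2),
    (364082, 235245, 438144, 11, 440116, 18, 440544, 0),
    (378046, 214457, 438164, 1, 439360, 1, 439400, 15),
    (436698, 83219, 438184, 12, 439424, 7, 440128, 12),
    (194956, 160141, 438236, 2, 440212, 2, 440240, 13),
    (239080, 448930, 438252, 18, 438960, 3, 439064, 4),
    (186443, 41312, 438260, 15, 438656, 3, 440448, 8),
    (233924, 358764, 438368, 14, 439136, 7, 439552, 2),
    (453226, 418018, 438432, 16, 439648, 2, 439880, 17),
    (34077, 217473, 438560, 13, 438728, 2, 440148, 7),
    (32335, 7279, 438704, 15, 439176, 0, 439504, 5),
    (42143, 368568, 438800, 11, 439724, 16, 439924, 3),
    (315292, 160422, 438952, 10, 439220, 15, 440308, 10),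
    (503838, 283951, 439200, 3, 439916, 6, 440040, 16),
    (392257, 65040, 439224, 3, 439978, 1, 440216, 18),
    (220581, 314465, 439252, 6, 439460, 3, 439660, 7),
    (176521, 282335, 439268, 12, 439624, 2, 439928, 10)]"],
    simp only: q19_def B19_def eval_simps cong: eval_congs, simp_all)

lemma triangles_19_43: "triangle_system q19 B19 903 443361"
  by (rule triangle_system_extend[OF triangles_19_42, where rows =
   "[(393417, 506454, 440612, 5, 441336, 15, 442092, 10),
    (469920, 475843, 440648, 9, 441960, 12, 442148, 7),
    (240407, 146210, 440656, 13, 441572, 4, 442112, 2),
    (434591, 307986, 440672, 7, 440808, 8, 442160, 4),
    (169558, 268600, 440712, 3, 441084, 10, 441392, 1),
    (408709, 306498, 440720, 7, 441464, 8, 441920, 7),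
    (247379, 184720, 440788, 11, 441016, 9, 441344, 10),
    (261804, 407758, 440816, 5, 441440, 11, 443168, 13),
    (2002, 437450, 440880, 8, 441308, 18, 442076, 5),
    (356882, 16617, 440912, 6, 441788, 15, 442228, 6),
    (16180, 275574, 440948, 16, 441120, 7, 443152, 9),
    (35932, 44268, 440976, 13, 441688, 12, 441776, 7),
    (168898, 323031, 441024, 5, 441322, 10, 442100, 18),
    (355373, 371796, 441132, 16, 441820, 10, 442496, 3),
    (211086, 443345, 441176, 9, 441264, 0, 441764, 0),
    (48439, 376466, 441188, 17, 442004, 10, 442044, 18),
    (14940, 106870, 441416, 11, 441504, 7, 442136, 14),
    (104400, 382540, 441548, 7, 441888, 7, 442220, 11),
    (268963, 128328, 441752, 3, 442152, 17, 443360, 16),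
    (338236, 205141, 441808, 1, 442256, 6, 442340, 2),
    (437581, 493537, 441980, 8, 441984, 6, 442192, 0)]"],
    simp only: q19_def B19_def eval_simps cong: eval_congs, simp_all)

lemma triangles_19_44: "triangle_system q19 B19 924 446385"
  by (rule triangle_system_extend[OF triangles_19_43, where rows =
   "[(121570, 108837, 443488, 12, 445152, 13, 445768, 11),
    (221454, 194402, 443536, 16, 445604, 9, 445776, 4),
    (451483, 176776, 443584, 13, 445304, 18, 445992, 4),
    (55466, 46827, 443624, 7, 445128, 4, 445744, 17),
    (328013, 58525, 443664, 6, 444208, 1, 444704, 12),
    (210719, 252319, 443680, 14, 443712, 12, 443736, 10),
    (488372, 8608, 443800, 17, 444032, 6, 445880, 17),
    (104804, 304023, 443816, 15, 445792, 6, 446272, 7),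
    (467194, 333646, 443848, 16, 444552, 13, 446136, 0),
    (41384, 403708, 443856, 14, 445912, 14, 446296, 18),
    (513334, 186021, 444056, 2, 444576, 0, 446356, 17),
    (491025, 410744, 444072, 18, 445376, 11, 446376, 7),
    (51403, 20301, 444104, 16, 445092, 16, 446384, 14),
    (153010, 30582, 444112, 16, 445040, 2, 445220, 3),
    (345565, 492973, 444160, 0, 445320, 12, 446292, 11),
    (49798, 166058, 444184, 8, 444944, 17, 445096, 7),
    (315749, 30378, 444880, 4, 445080, 17, 445832, 4),
    (155946, 508978, 445032, 9, 445616, 2, 445928, 15),
    (60303, 140540, 445056, 10, 446072, 8, 446312, 10),
    (461298, 415908, 445136, 7, 445412, 14, 445684, 12),
    (169784, 136884, 445224, 8, 445868, 18, 446372, 2)]"],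
    simp only: q19_def B19_def eval_simps cong: eval_congs, simp_all)

lemma triangles_19_45: "triangle_system q19 B19 945 449185"
  by (rule triangle_system_extend[OF triangles_19_44, where rows =
   "[(11986, 232694, 446452, 8, 448170, 14, 448384, 8),
    (484841, 130978, 446456, 5, 448072, 10, 448840, 15),
    (81665, 347772, 446464, 18, 448180, 13, 448320, 9),
    (430099, 385674, 446832, 13, 447960, 8, 448456, 9),
    (24577, 44633, 446888, 5, 447816, 17, 449184, 1),
    (21878, 315997, 446920, 17, 447088, 16, 448952, 12),
    (97118, 92632, 447080, 13, 447976, 4, 448252, 15),
    (39111, 138796, 447144, 15, 447368, 12, 449168, 8),
    (95539, 389682, 447184, 1, 447352, 11, 448212, 18),
    (281798, 105778, 447268, 1, 447656, 9, 448444, 11),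
    (170857, 299552, 447312, 3, 448048, 6, 448816, 6),
    (258468, 397591, 447464, 9, 447640, 2, 447956, 15),
    (364299, 27559, 447472, 10, 448476, 16, 448688, 5),
    (202586, 358500, 447652, 7, 447972, 17, 448720, 5),
    (6391, 70093, 447780, 4, 447880, 5, 448928, 18),
    (64932, 79626, 447792, 18, 448680, 5, 448940, 16),
    (411617, 142003, 447928, 3, 448160, 2, 448576, 4),
    (269229, 90059, 448096, 9, 448808, 2, 449120, 9),
    (155113, 387559, 448232, 15, 448308, 1, 448912, 6),
    (357062, 44485, 448312, 15, 448848, 0, 448884, 12),
    (174953, 358108, 448368, 0, 448736, 9, 449160, 4)]"],
    simp only: q19_def B19_def eval_simps cong: eval_congs, simp_all)

lemma triangles_19_46: "triangle_system q19 B19 966 450945"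
  by (rule triangle_system_extend[OF triangles_19_45, where rows =
   "[(326306, 368432, 449208, 18, 450304, 4, 450400, 16),
    (34816, 55386, 449236, 17, 450196, 15, 450248, 5),
    (251498, 349426, 449240, 17, 449252, 3, 449916, 16),
    (20360, 44603, 449256, 11, 450752, 10, 450848, 2),
    (217381, 288627, 449324, 3, 449428, 3, 449708, 8),
    (149999, 460603, 449344, 7, 449444, 12, 450424, 13),
    (370703, 508790, 449384, 7, 449808, 11, 449896, 12),
    (413609, 42229, 449402, 8, 450028, 15, 450152, 12),
    (260603, 476199, 449404, 17, 449672, 14, 449776, 10),
    (471754, 116479, 449408, 12, 449500, 4, 450296, 16),
    (19652, 212610, 449456, 18, 449616, 2, 450560, 8),
    (60085, 275539, 449466, 1, 449892, 0, 450880, 0),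
    (522517, 165065, 449468, 1, 449968, 9, 450010, 15),
    (161406, 125376, 449480, 12, 449768, 14, 450928, 17),
    (388076, 137503, 449514, 17, 450340, 11, 450420, 18),
    (397568, 202980, 449696, 2, 449880, 8, 450944, 3),
    (514063, 353647, 449740, 17, 450012, 12, 450272, 11),
    (138822, 507342, 449764, 8, 450160, 12, 450394, 0),
    (515770, 359452, 449856, 1, 450112, 10, 450282, 10),
    (440836, 128981, 450064, 11, 450212, 10, 450556, 10),
    (371329, 242596, 450284, 0, 450484, 16, 450488, 8)]"],
    simp only: q19_def B19_def eval_simps cong: eval_congs, simp_all)

lemma triangles_19_47: "triangle_system q19 B19 987 453837"
  by (rule triangle_system_extend[OF triangles_19_46, where rows =
   "[(381513, 328266, 450992, 3, 451932, 14, 453488, 4),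
    (7987, 197093, 451024, 13, 451160, 12, 452500, 1),
    (443058, 19863, 451104, 3, 452312, 7, 453080, 2),
    (57752, 301039, 451184, 11, 452436, 7, 452596, 12),
    (341148, 476433, 451200, 17, 451616, 13, 453104, 10),
    (470600, 179529, 451240, 0, 451752, 2, 452324, 12),
    (409657, 452858, 451272, 11, 452216, 14, 453480, 2),
    (33740, 520253, 451408, 12, 453168, 12, 453428, 16),
    (133550, 317099, 451464, 1, 452984, 11, 453460, 4),
    (80557, 492746, 451472, 1, 452096, 9, 452600, 17),
    (520530, 176775, 451488, 15, 451544, 13, 453000, 11),
    (432374, 118619, 451560, 1, 452776, 9, 453044, 1),
    (519131, 263916, 451736, 1, 452864, 10, 453836, 18),
    (334458, 159519, 451936, 18, 452440, 13, 453552, 0),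
    (333545, 439016, 451956, 6, 452080, 0, 452268, 6),
    (305909, 207602, 452000, 14, 452408, 8, 452520, 8),
    (433809, 432999, 452144, 5, 452528, 14, 453264, 11),
    (447581, 38206, 452168, 18, 453290, 17, 453348, 15),
    (12785, 223854, 452308, 15, 452736, 3, 453776, 17),
    (43496, 33872, 453048, 10, 453200, 6, 453624, 17),
    (287963, 265967, 453280, 14, 453600, 0, 453728, 12)]"],
    simp only: q19_def B19_def eval_simps cong: eval_congs, simp_all)

lemma triangles_19_48: "triangle_system q19 B19 1008 456041"
  by (rule triangle_system_extend[OF triangles_19_47, where rows =
   "[(128969, 283307, 453860, 1, 454496, 7, 454616, 11),
    (389074, 342072, 453864, 6, 454572, 11, 455624, 1),
    (289642, 44127, 453872, 2, 454096, 14, 454592, 10),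
    (348372, 181847, 453920, 9, 454992, 18, 455576, 9),
    (483301, 22557, 453944, 7, 454652, 1, 455864, 3),
    (325680, 504807, 453972, 16, 455328, 8, 455824, 14),
    (257324, 193237, 453976, 0, 454132, 2, 454448, 1),
    (103444, 256926, 454000, 4, 454362, 13, 455952, 11),
    (22536, 466347, 454016, 0, 454074, 4, 455512, 8),
    (134269, 432769, 454112, 11, 455168, 12, 455992, 12),
    (60040, 200280, 454244, 0, 455056, 10, 455588, 5),
    (151405, 361170, 454296, 13, 454832, 13, 455908, 0),
    (165975, 232624, 454308, 0, 454560, 17, 455816, 14),
    (221353, 272826, 454320, 8, 454604, 6, 455632, 13),
    (199301, 82049, 454378, 18, 455480, 2, 455760, 0),
    (298141, 463718, 454424, 3, 455912, 13, 456040, 6),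
    (264003, 441444, 454536, 1, 454952, 10, 455776, 18),
    (40797, 82454, 454580, 1, 454720, 16, 456020, 9),
    (136972, 323524, 454584, 4, 454864, 2, 455312, 6),
    (279896, 212555, 455008, 10, 455660, 8, 455668, 10),
    (410201, 344748, 455380, 9, 455400, 5, 455644, 9)]"],
    simp only: q19_def B19_def eval_simps cong: eval_congs, simp_all)

lemma triangles_19_49: "triangle_system q19 B19 1029 457977"
  by (rule triangle_system_extend[OF triangles_19_48, where rows =
   "[(292082, 433197, 456060, 4, 456160, 11, 456256, 18),
    (256079, 112316, 456064, 4, 457184, 17, 457632, 2),
    (457608, 494088, 456124, 9, 456426, 13, 457472, 4),
    (240630, 277209, 456136, 8, 457016, 4, 457936, 5),
    (4275, 508457, 456144, 12, 456992, 18, 457760, 8),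
    (303774, 464001, 456172, 16, 456410, 14, 457832, 15),
    (363902, 434588, 456180, 12, 456584, 15, 457948, 5),
    (134723, 34336, 456224, 1, 457416, 7, 457440, 11),
    (512339, 288003, 456276, 13, 456392, 8, 457392, 7),
    (426042, 86525, 456304, 15, 456800, 16, 457976, 14),
    (296864, 412588, 456344, 5, 457508, 10, 457592, 0),
    (498948, 340345, 456360, 3, 456704, 0, 456840, 14),
    (351946, 259137, 456436, 4, 456888, 0, 457644, 16),
    (300483, 170135, 456472, 9, 457136, 7, 457724, 12),
    (515734, 377559, 456496, 11, 456700, 2, 457712, 6),
    (415582, 327388, 456618, 16, 456652, 12, 456976, 8),
    (159472, 337013, 457060, 4, 457084, 17, 457328, 6),
    (311395, 358190, 457108, 4, 457160, 14, 457464, 8),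
    (403069, 269240, 457128, 17, 457792, 13, 457904, 8),
    (329691, 508880, 457344, 10, 457552, 0, 457972, 7),
    (504584, 432143, 457434, 15, 457436, 0, 457816, 17)]"],
    simp only: q19_def B19_def eval_simps cong: eval_congs, simp_all)

lemma triangles_19_50: "triangle_system q19 B19 1050 463601"
  by (rule triangle_system_extend[OF triangles_19_49, where rows =
   "[(210481, 404836, 457984, 15, 458580, 9, 461312, 7),
    (80, 458769, 458056, 12, 458144, 0, 458176, 9),
    (122690, 459012, 458076, 2, 458472, 18, 458664, 6),
    (597, 328378, 458080, 5, 459328, 13, 463456, 8),
    (44931, 166283, 458090, 6, 461872, 13, 463520, 16),
    (271787, 312699, 458120, 0, 458168, 0, 461200, 10),
    (48702, 151587, 458128, 7, 458424, 9, 463504, 6),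
    (342751, 248884, 458200, 9, 458240, 18, 459520, 4),
    (304468, 168645, 458280, 4, 458528, 16, 458740, 8),
    (393146, 190489, 458312, 6, 461584, 14, 462976, 9),
    (368087, 284029, 458444, 13, 460672, 16, 461904, 5),
    (466340, 359577, 458492, 6, 461056, 18, 462256, 4),
    (229701, 40185, 458552, 5, 461104, 4, 463248, 3),
    (377170, 303008, 458618, 4, 458714, 0, 462640, 15),
    (173459, 360046, 458620, 14, 458732, 13, 463152, 16),
    (360472, 77944, 458682, 15, 458696, 3, 462688, 9),
    (95094, 248838, 458752, 14, 463296, 14, 463440, 5),
    (278575, 199013, 459904, 14, 460384, 13, 461824, 14),
    (460982, 468329, 460288, 14, 461456, 7, 461504, 8),
    (234976, 252781, 460864, 15, 460928, 0, 463600, 7),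
    (125604, 54702, 461216, 1, 463200, 1, 463264, 14)]"],
    simp only: q19_def B19_def eval_simps cong: eval_congs, simp_all)

lemma triangles_19_51: "triangle_system q19 B19 1071 468241"
  by (rule triangle_system_extend[OF triangles_19_50, where rows =
   "[(147434, 277904, 463728, 1, 468112, 6, 468152, 8),
    (91511, 447061, 463872, 5, 465632, 17, 468064, 6),
    (363117, 272581, 463944, 0, 467072, 6, 467504, 5),
    (112140, 367289, 464112, 2, 465264, 9, 466048, 4),
    (194951, 84863, 464144, 9, 466096, 10, 467296, 16),
    (400502, 275365, 464216, 0, 464976, 5, 467824, 0),
    (198083, 23403, 464296, 5, 465512, 6, 466392, 12),
    (95173, 1480, 464328, 18, 466120, 9, 467392, 17),
    (358319, 513417, 464336, 0, 465424, 9, 468048, 13),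
    (39027, 361097, 464400, 14, 465688, 9, 467968, 7),
    (108469, 509847, 464488, 5, 464856, 10, 466272, 8),
    (360757, 50779, 464584, 14, 464640, 8, 465088, 9),
    (281464, 281177, 464608, 2, 466224, 17, 467776, 6),
    (317109, 395795, 464712, 9, 465184, 2, 466408, 9),
    (141185, 268242, 464720, 7, 464736, 13, 467592, 3),
    (96145, 454513, 464776, 16, 466912, 10, 467888, 18),
    (288573, 340733, 465128, 5, 466512, 7, 466592, 7),
    (184724, 351724, 465304, 7, 467344, 13, 468240, 12),
    (485246, 172347, 465320, 12, 466752, 18, 467920, 14),
    (197081, 473256, 465496, 7, 466320, 18, 466368, 11),
    (522612, 489189, 465808, 2, 466032, 2, 466704, 18)]"],
    simp only: q19_def B19_def eval_simps cong: eval_congs, simp_all)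

lemma triangles_19_52: "triangle_system q19 B19 1092 470817"
  by (rule triangle_system_extend[OF triangles_19_51, where rows =
   "[(34387, 247037, 468336, 12, 468928, 9, 470144, 4),
    (201500, 169553, 468376, 8, 469988, 7, 470768, 7),
    (249487, 180443, 468400, 2, 468568, 16, 469348, 12),
    (374487, 103466, 468496, 3, 469376, 16, 470416, 2),
    (245840, 351699, 468512, 3, 469672, 2, 470512, 6),
    (441726, 273292, 468544, 0, 469456, 14, 469944, 7),
    (257637, 498735, 468608, 7, 469604, 10, 470740, 13),
    (363709, 167843, 468648, 8, 468728, 14, 469840, 13),
    (35900, 229162, 468680, 4, 468880, 1, 469396, 12),
    (142780, 238047, 468920, 14, 469752, 8, 470264, 4),
    (270960, 376093, 468968, 10, 469680, 10, 469952, 16),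
    (340997, 306819, 468976, 0, 469264, 18, 470816, 4),
    (21013, 74515, 469152, 0, 470180, 1, 470712, 17),
    (97469, 394188, 469184, 14, 469896, 2, 470452, 11),
    (317667, 439104, 469400, 6, 470488, 6, 470624, 9),
    (3802, 89844, 469520, 1, 470504, 6, 470744, 1),
    (511253, 295228, 469616, 1, 469992, 18, 470216, 8),
    (117286, 114479, 469748, 15, 469868, 18, 469964, 10),
    (382120, 230642, 469808, 3, 470308, 13, 470476, 14),
    (494172, 302733, 470128, 2, 470708, 10, 470732, 7),
    (83560, 432136, 470368, 4, 470392, 9, 470636, 8)]"],
    simp only: q19_def B19_def eval_simps cong: eval_congs, simp_all)

lemma triangles_19_53: "triangle_system q19 B19 1113 473525"
  by (rule triangle_system_extend[OF triangles_19_52, where rows =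
   "[(147371, 206148, 470868, 8, 471760, 15, 472228, 9),
    (523313, 284855, 470884, 7, 471800, 12, 472264, 11),
    (156937, 292172, 470896, 4, 472692, 12, 473200, 17),
    (201425, 269130, 470936, 15, 472876, 18, 473488, 13),
    (293651, 454237, 470948, 16, 472020, 12, 472392, 2),
    (34614, 146616, 470984, 7, 471992, 7, 472312, 4),
    (68823, 148830, 471040, 18, 471328, 8, 473380, 13),
    (340601, 429040, 471184, 8, 472048, 8, 472932, 9),
    (60103, 25335, 471200, 18, 471752, 13, 472464, 8),
    (180412, 346364, 471400, 0, 471520, 5, 472696, 5),
    (514483, 77655, 471424, 5, 472440, 8, 473392, 7),
    (383085, 128377, 471496, 12, 471664, 17, 473504, 10),
    (285531, 425468, 471640, 16, 471796, 10, 472916, 1),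
    (460467, 22195, 471680, 12, 472536, 7, 472648, 8),
    (88444, 142375, 471704, 4, 472548, 9, 472864, 12),
    (75325, 448198, 471888, 9, 471988, 13, 472672, 18),
    (285617, 319020, 472368, 7, 472512, 4, 472768, 13),
    (180042, 325957, 472560, 3, 472748, 5, 472788, 0),
    (514, 23458, 472720, 9, 473464, 1, 473480, 17),
    (150949, 307324, 472804, 2, 472984, 1, 473288, 15),
    (394426, 241591, 472936, 3, 472944, 5, 473524, 1)]"],
    simp only: q19_def B19_def eval_simps cong: eval_congs, simp_all)

lemma triangles_19_54: "triangle_system q19 B19 1134 476305"
  by (rule triangle_system_extend[OF triangles_19_53, where rows =
   "[(307660, 167891, 473536, 6, 473872, 14, 474860, 15),
    (397483, 284942, 473572, 10, 474424, 11, 475016, 9),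
    (315158, 249253, 473576, 17, 474160, 15, 475064, 0),
    (357219, 89883, 473640, 0, 473736, 14, 474568, 5),
    (172588, 327003, 473648, 6, 475060, 3, 475968, 3),
    (492851, 361942, 473720, 12, 473804, 5, 474612, 6),
    (348326, 308928, 473888, 10, 474456, 11, 476128, 13),
    (355133, 250488, 473900, 15, 474256, 14, 474520, 7),
    (124231, 89519, 473908, 8, 474788, 1, 474824, 14),
    (467936, 114920, 473920, 17, 474468, 3, 474496, 8),
    (225695, 435525, 473968, 16, 474304, 8, 475024, 3),
    (406966, 457542, 474004, 15, 474344, 10, 475648, 17),
    (114933, 11888, 474024, 12, 474832, 17, 474848, 3),
    (259945, 412724, 474100, 15, 474104, 1, 475084, 7),
    (477986, 227940, 474248, 11, 476256, 0, 476304, 6),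
    (134823, 171940, 474284, 11, 475000, 16, 475920, 17),
    (107263, 172073, 474292, 11, 474420, 11, 475392, 11),
    (277635, 296574, 474400, 11, 474772, 15, 474868, 17),
    (348683, 164632, 474544, 17, 474656, 8, 474776, 18),
    (505706, 250141, 474592, 7, 474712, 9, 475584, 2),
    (117249, 468550, 474604, 3, 474920, 12, 475072, 3)]"],
    simp only: q19_def B19_def eval_simps cong: eval_congs, simp_all)

lemma triangles_19_55: "triangle_system q19 B19 1155 479425"
  by (rule triangle_system_extend[OF triangles_19_54, where rows =
   "[(92869, 398181, 476320, 5, 476624, 18, 477952, 14),
    (407644, 428561, 476448, 10, 476840, 16, 478000, 0),
    (353183, 158540, 476528, 6, 478384, 6, 478952, 10),
    (28636, 38865, 476544, 14, 478864, 7, 478904, 0),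
    (189889, 353522, 476584, 8, 478048, 1, 479104, 14),
    (32294, 447557, 476592, 18, 476976, 6, 477120, 1),
    (271025, 402164, 476688, 7, 478320, 1, 478816, 14),
    (267542, 18636, 476872, 13, 478164, 11, 478760, 10),
    (48377, 414239, 477008, 18, 477376, 4, 478132, 9),
    (201707, 118220, 477072, 3, 478504, 5, 479140, 8),
    (355369, 495270, 477320, 16, 478600, 16, 479224, 3),
    (303575, 89171, 477344, 16, 477864, 11, 479376, 17),
    (455111, 519671, 477552, 14, 478416, 18, 478960, 17),
    (399816, 80768, 477664, 5, 478336, 5, 479424, 13),
    (394994, 9017, 477728, 13, 478720, 7, 479064, 16),
    (347364, 8547, 477844, 14, 477904, 9, 479200, 7),
    (143582, 154195, 477872, 0, 478192, 8, 478856, 11),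
    (149597, 226414, 477920, 8, 478456, 17, 479076, 6),
    (454902, 139414, 478032, 11, 478560, 0, 479028, 7),
    (391463, 284117, 478096, 16, 478432, 3, 478464, 16),
    (470609, 6053, 479080, 11, 479088, 9, 479184, 17)]"],
    simp only: q19_def B19_def eval_simps cong: eval_congs, simp_all)

lemma triangles_19_56: "triangle_system q19 B19 1176 482009"
  by (rule triangle_system_extend[OF triangles_19_55, where rows =
   "[(361503, 245679, 479552, 0, 480184, 15, 481488, 18),
    (295635, 119569, 479600, 0, 480848, 4, 481962, 3),
    (310155, 292232, 479664, 9, 481008, 0, 481584, 7),
    (67603, 407805, 479688, 5, 480368, 15, 481936, 10),
    (54712, 435130, 479912, 13, 480384, 4, 480960, 4),
    (291739, 67397, 479952, 13, 481088, 3, 481504, 1),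
    (113018, 18176, 479992, 2, 480952, 8, 481888, 12),
    (20993, 462563, 480024, 13, 480548, 10, 481572, 8),
    (501166, 310536, 480048, 14, 481864, 12, 481928, 18),
    (508320, 157696, 480232, 0, 480408, 17, 480456, 12),
    (400571, 416158, 480320, 8, 481040, 14, 481272, 0),
    (188088, 175033, 480432, 5, 481152, 15, 481232, 7),
    (311691, 184525, 480464, 12, 481080, 0, 481912, 17),
    (378409, 108310, 480592, 1, 481632, 4, 481652, 4),
    (507999, 124578, 480682, 10, 481172, 0, 481448, 3),
    (125993, 95798, 480696, 4, 480808, 14, 481984, 16),
    (269616, 406438, 480884, 13, 480888, 4, 481872, 3),
    (460038, 509668, 480996, 6, 481128, 0, 481312, 1),
    (277069, 524221, 481192, 11, 481776, 2, 481964, 9),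
    (260328, 345379, 481244, 5, 481480, 18, 482008, 4),
    (371928, 358506, 481720, 16, 481792, 10, 481972, 7)]"],
    simp only: q19_def B19_def eval_simps cong: eval_congs, simp_all)

lemma triangles_19_57: "triangle_system q19 B19 1197 484417"
  by (rule triangle_system_extend[OF triangles_19_56, where rows =
   "[(37071, 103034, 482024, 17, 482576, 6, 483164, 10),
    (37850, 124375, 482044, 10, 482624, 9, 483064, 11),
    (413466, 416195, 482064, 9, 482724, 11, 482900, 8),
    (11768, 207335, 482080, 7, 482272, 10, 484416, 12),
    (177475, 427398, 482092, 3, 482768, 15, 483520, 4),
    (485167, 25389, 482100, 8, 482520, 12, 483760, 17),
    (317174, 194064, 482200, 11, 482916, 4, 483256, 7),
    (406507, 375744, 482212, 1, 482872, 4, 484336, 16),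
    (50568, 89247, 482216, 4, 482760, 3, 483904, 13),
    (180116, 350378, 482224, 1, 482496, 11, 482592, 12),
    (185643, 467232, 482268, 9, 482532, 15, 482708, 18),
    (231040, 135187, 482352, 0, 482440, 6, 484144, 10),
    (204813, 431182, 482516, 8, 482980, 8, 482992, 14),
    (142833, 119454, 482536, 11, 482644, 14, 484096, 14),
    (348810, 379113, 482672, 5, 483328, 10, 483992, 17),
    (229391, 180854, 482794, 0, 483928, 4, 483944, 3),
    (252587, 459287, 482804, 6, 483132, 13, 484136, 13),
    (73626, 171999, 482808, 2, 483096, 18, 483648, 5),
    (502330, 390259, 482848, 10, 483024, 4, 483324, 1),
    (127442, 213109, 483016, 15, 484040, 18, 484256, 1),
    (467970, 405112, 483192, 15, 483228, 8, 484016, 14)]"],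
    simp only: q19_def B19_def eval_simps cong: eval_congs, simp_all)

lemma triangles_19_58: "triangle_system q19 B19 1218 486381"
  by (rule triangle_system_extend[OF triangles_19_57, where rows =
   "[(184578, 181665, 484552, 12, 486268, 6, 486368, 2),
    (502987, 117837, 484724, 13, 485068, 14, 485176, 1),
    (96841, 273843, 484752, 3, 485368, 3, 485968, 18),
    (262659, 269098, 484780, 3, 485816, 3, 485824, 1),
    (346185, 380890, 484788, 5, 484820, 11, 485728, 16),
    (354925, 511129, 484812, 16, 485008, 0, 485076, 17),
    (187591, 428332, 484824, 14, 485600, 2, 485936, 8),
    (451238, 130644, 484864, 16, 485328, 5, 486308, 15),
    (298379, 500279, 484904, 8, 485872, 1, 486176, 8),
    (495424, 171526, 484912, 12, 485232, 18, 485248, 14),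
    (512264, 111528, 484936, 18, 485208, 6, 485440, 9),
    (8435, 319908, 484960, 8, 486272, 6, 486380, 15),
    (8176, 89823, 484984, 1, 485024, 5, 486058, 13),
    (350768, 162954, 485152, 8, 485220, 7, 486364, 6),
    (151487, 77048, 485184, 11, 486116, 14, 486256, 15),
    (204303, 183039, 485204, 6, 486244, 1, 486312, 14),
    (165776, 453609, 485284, 1, 486296, 0, 486378, 18),
    (50036, 286145, 485344, 12, 485860, 0, 486008, 0),
    (53377, 118689, 485544, 9, 485672, 14, 485848, 14),
    (241397, 124734, 485632, 0, 486060, 3, 486160, 16),
    (285811, 422229, 485668, 16, 486188, 7, 486200, 5)]"],
    simp only: q19_def B19_def eval_simps cong: eval_congs, simp_all)

lemma triangles_19_59: "triangle_system q19 B19 1239 488441"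
  by (rule triangle_system_extend[OF triangles_19_58, where rows =
   "[(319609, 29351, 486448, 1, 486832, 14, 488096, 10),
    (353758, 56160, 486472, 3, 486976, 1, 488256, 3),
    (73639, 143874, 486544, 4, 486592, 2, 487752, 2),
    (143728, 102919, 486572, 10, 486780, 1, 487380, 15),
    (76751, 329239, 486604, 9, 487112, 7, 487840, 11),
    (25584, 1239, 486616, 5, 487324, 18, 488148, 16),
    (252859, 161380, 486688, 17, 487396, 16, 488428, 3),
    (489068, 273504, 486720, 14, 487204, 18, 487816, 1),
    (341493, 174463, 486808, 11, 487312, 10, 487720, 18),
    (315252, 303691, 486838, 18, 487228, 9, 487338, 4),
    (458018, 424121, 486844, 13, 488368, 16, 488440, 13),
    (166377, 230652, 486864, 7, 486904, 15, 487130, 11),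
    (242694, 342377, 487060, 3, 487340, 18, 488224, 7),
    (321127, 324865, 487076, 1, 487728, 7, 487864, 13),
    (187362, 485661, 487088, 18, 488360, 9, 488400, 6),
    (306145, 374794, 487120, 17, 487192, 12, 487216, 2),
    (129949, 84959, 487146, 4, 487258, 4, 487912, 18),
    (82664, 305004, 487160, 2, 488244, 8, 488280, 0),
    (122024, 324575, 487208, 17, 487920, 18, 488108, 18),
    (266091, 235371, 487284, 7, 487420, 9, 487760, 1),
    (4041, 46093, 487408, 11, 487896, 16, 487936, 3)]"],
    simp only: q19_def B19_def eval_simps cong: eval_congs, simp_all)

lemma triangles_19_60: "triangle_system q19 B19 1260 490457"
  by (rule triangle_system_extend[OF triangles_19_59, where rows =
   "[(39911, 199009, 488628, 12, 489712, 6, 489840, 18),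
    (360742, 415699, 488640, 3, 488892, 8, 489264, 12),
    (31663, 76116, 488676, 4, 489044, 17, 489178, 11),
    (167566, 317270, 488680, 11, 489184, 12, 490384, 13),
    (213503, 251405, 488760, 13, 488792, 16, 490356, 18),
    (105692, 206604, 488788, 11, 489760, 3, 489948, 12),
    (221044, 329521, 488804, 8, 489322, 3, 489428, 5),
    (446022, 118803, 488808, 16, 488928, 15, 489296, 11),
    (92376, 381261, 488832, 2, 490204, 17, 490288, 10),
    (154242, 385292, 488852, 12, 489552, 18, 489816, 5),
    (172892, 118620, 489060, 1, 489936, 1, 490444, 3),
    (64653, 406100, 489288, 16, 490208, 15, 490456, 4),
    (47022, 200856, 489324, 16, 490148, 17, 490332, 9),
    (460823, 252680, 489336, 14, 489376, 14, 490400, 16),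
    (240458, 518775, 489352, 15, 489420, 14, 490410, 10),
    (208830, 238372, 489360, 0, 489372, 7, 489472, 17),
    (292600, 29347, 489400, 4, 490202, 18, 490346, 10),
    (380354, 201485, 489432, 17, 489448, 17, 490068, 3),
    (193616, 54822, 489608, 17, 489952, 0, 490192, 15),
    (81506, 368463, 489704, 8, 489928, 17, 490420, 2),
    (241898, 340943, 489972, 0, 490360, 1, 490432, 11)]"],
    simp only: q19_def B19_def eval_simps cong: eval_congs, simp_all)

lemma triangles_19_61: "triangle_system q19 B19 1281 494993"
  by (rule triangle_system_extend[OF triangles_19_60, where rows =
   "[(51525, 483661, 490492, 17, 490800, 15, 490944, 17),
    (341156, 483045, 490600, 12, 490744, 12, 491192, 16),
    (321961, 70322, 490672, 7, 491180, 14, 494992, 18),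
    (416725, 426618, 490696, 3, 491488, 4, 494112, 5),
    (101911, 366840, 490720, 17, 490888, 16, 490992, 7),
    (397248, 456685, 490732, 13, 491100, 13, 494192, 10),
    (29861, 14475, 490788, 9, 491364, 10, 492128, 5),
    (108208, 353531, 490844, 7, 493760, 0, 494336, 12),
    (104422, 399690, 490868, 13, 491004, 7, 492320, 1),
    (160497, 32457, 490924, 5, 492544, 1, 492704, 2),
    (227677, 190658, 491048, 9, 491382, 3, 494000, 14),
    (417688, 503274, 491116, 4, 491296, 10, 494304, 1),
    (234337, 306531, 491144, 9, 491260, 11, 491412, 17),
    (323604, 227599, 491178, 0, 491220, 10, 494032, 6),
    (472753, 55576, 491248, 7, 491508, 4, 492736, 12),
    (124308, 393680, 491348, 0, 492912, 5, 494576, 10),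
    (204710, 71648, 491376, 2, 493704, 17, 494624, 12),
    (96166, 267173, 491464, 7, 491776, 5, 492416, 12),
    (82053, 258975, 491482, 9, 493728, 17, 494984, 8),
    (269838, 407353, 492928, 8, 493928, 9, 494048, 0),
    (91375, 90048, 494184, 15, 494568, 4, 494704, 3)]"],
    simp only: q19_def B19_def eval_simps cong: eval_congs, simp_all)

lemma triangles_19_62: "triangle_system q19 B19 1302 497961"
  by (rule triangle_system_extend[OF triangles_19_61, where rows =
   "[(397670, 87684, 495080, 15, 497100, 12, 497124, 11),
    (106104, 99412, 495088, 9, 496704, 4, 497608, 10),
    (436514, 249260, 495176, 9, 496864, 18, 497616, 3),
    (173534, 130939, 495264, 18, 496256, 10, 497088, 11),
    (5636, 282550, 495288, 12, 496292, 7, 496768, 8),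
    (416350, 275215, 495336, 15, 495584, 16, 496072, 6),
    (298160, 244177, 495344, 4, 496232, 13, 497452, 8),
    (519004, 517766, 495376, 17, 496384, 3, 496848, 14),
    (265209, 280529, 495448, 5, 496936, 14, 497816, 4),
    (456781, 341201, 495464, 5, 496456, 13, 497632, 13),
    (213331, 170595, 495512, 17, 496280, 3, 496420, 6),
    (81440, 411422, 495616, 13, 496000, 2, 497272, 4),
    (112644, 43693, 495936, 13, 496424, 14, 497080, 1),
    (26798, 152902, 496096, 1, 497440, 10, 497644, 1),
    (131074, 365367, 496216, 12, 497056, 14, 497464, 3),
    (203772, 181809, 496304, 5, 497312, 11, 497960, 3),
    (261896, 370123, 496464, 5, 496520, 6, 496792, 18),
    (252810, 301536, 496480, 6, 497076, 3, 497380, 15),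
    (144536, 388167, 497004, 10, 497492, 5, 497520, 6),
    (512770, 507241, 497016, 2, 497584, 2, 497728, 11),
    (459333, 255357, 497108, 15, 497232, 18, 497344, 10)]"],
    simp only: q19_def B19_def eval_simps cong: eval_congs, simp_all)

lemma triangles_19_63: "triangle_system q19 B19 1323 500481"
  by (rule triangle_system_extend[OF triangles_19_62, where rows =
   "[(421336, 203286, 497968, 16, 498584, 4, 499628, 10),
    (312875, 325774, 497992, 17, 499400, 18, 499548, 0),
    (279634, 309046, 498056, 12, 499480, 12, 500240, 13),
    (115557, 33795, 498080, 7, 498124, 14, 499696, 13),
    (130598, 104569, 498100, 11, 498388, 13, 500336, 4),
    (147137, 189992, 498104, 18, 499572, 1, 500032, 7),
    (431781, 419829, 498112, 8, 499636, 9, 499712, 3),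
    (104282, 303149, 498160, 11, 499152, 0, 500480, 11),
    (445999, 113798, 498216, 17, 498860, 15, 500176, 14),
    (60946, 161781, 498248, 15, 498916, 7, 500392, 15),
    (130530, 467929, 498408, 1, 498520, 8, 499112, 9),
    (67200, 47984, 498496, 2, 498608, 18, 499328, 6),
    (426886, 513148, 498560, 0, 499424, 12, 499592, 3),
    (212002, 385968, 498600, 12, 498832, 13, 500000, 9),
    (95608, 243932, 498652, 18, 499056, 3, 500256, 2),
    (231519, 89141, 498676, 7, 499492, 17, 499496, 7),
    (43027, 450853, 498768, 15, 499120, 14, 499368, 5),
    (226437, 450582, 498784, 17, 499044, 17, 500328, 17),
    (126080, 308634, 498868, 2, 498976, 16, 499364, 8),
    (367226, 129995, 498892, 10, 499288, 8, 499660, 14),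
    (337852, 285252, 499108, 17, 499436, 16, 500400, 18)]"],
    simp only: q19_def B19_def eval_simps cong: eval_congs, simp_all)

lemma triangles_19_64: "triangle_system q19 B19 1344 503259"
  by (rule triangle_system_extend[OF triangles_19_63, where rows =
   "[(211205, 482532, 500520, 17, 501112, 8, 503124, 7),
    (364890, 492611, 500552, 17, 502696, 1, 503226, 14),
    (214983, 387653, 500576, 15, 501040, 8, 503092, 4),
    (108854, 45452, 500624, 14, 500936, 15, 501652, 1),
    (492517, 98627, 500672, 12, 501428, 8, 501440, 18),
    (420209, 344506, 500720, 13, 501364, 14, 502856, 14),
    (427330, 475878, 500944, 17, 501392, 9, 501588, 12),
    (159087, 148957, 501136, 18, 501232, 0, 503216, 18),
    (78678, 305252, 501204, 2, 501960, 2, 502208, 3),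
    (481707, 443454, 501328, 13, 502016, 18, 503056, 17),
    (100451, 44674, 501368, 5, 502640, 15, 502748, 14),
    (197517, 405259, 501384, 11, 502112, 13, 502572, 7),
    (167936, 450473, 501408, 12, 501704, 18, 501728, 9),
    (199329, 65431, 501476, 3, 501712, 18, 502052, 5),
    (77571, 516766, 501560, 16, 502088, 11, 502160, 3),
    (335021, 168022, 501656, 11, 502716, 5, 502880, 13),
    (211920, 85606, 501792, 0, 502248, 7, 502616, 14),
    (212212, 207346, 501888, 11, 502628, 13, 503258, 0),
    (24313, 89, 501936, 8, 502652, 11, 502676, 1),
    (392040, 217018, 502772, 7, 502920, 7, 502956, 6),
    (146002, 389370, 503024, 6, 503152, 6, 503164, 6)]"],
    simp only: q19_def B19_def eval_simps cong: eval_congs, simp_all)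

lemma triangles_19_65: "triangle_system q19 B19 1365 505253"
  by (rule triangle_system_extend[OF triangles_19_64, where rows =
   "[(464878, 428010, 503260, 10, 504512, 3, 504820, 6),
    (158407, 89180, 503264, 16, 503984, 10, 505172, 6),
    (371269, 236806, 503274, 18, 503732, 7, 504392, 6),
    (33852, 330147, 503284, 2, 503592, 3, 503872, 3),
    (417502, 206579, 503384, 0, 503408, 3, 504400, 2),
    (408674, 507175, 503396, 15, 503632, 0, 504640, 1),
    (353159, 230588, 503400, 8, 503644, 14, 504676, 4),
    (59930, 323113, 503424, 2, 503672, 2, 503804, 12),
    (461091, 15519, 503472, 3, 503744, 2, 504740, 13),
    (522315, 60555, 503482, 11, 503544, 15, 503660, 6),
    (451298, 469892, 503540, 2, 505192, 12, 505252, 0),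
    (73853, 427362, 503576, 9, 503658, 18, 505236, 9),
    (43164, 254887, 503624, 13, 503712, 16, 503736, 0),
    (384724, 127163, 503696, 8, 504524, 7, 504704, 17),
    (212382, 475828, 504136, 16, 504480, 11, 505024, 13),
    (249846, 40181, 504200, 17, 504320, 5, 504912, 7),
    (212542, 26553, 504280, 7, 504608, 12, 505152, 2),
    (41192, 317013, 504304, 11, 504776, 18, 504824, 14),
    (438847, 61874, 504440, 3, 504504, 0, 504552, 6),
    (95859, 302406, 504464, 8, 504632, 17, 505072, 17),
    (65642, 378388, 504728, 1, 504752, 15, 504832, 1)]"],
    simp only: q19_def B19_def eval_simps cong: eval_congs, simp_all)

lemma triangles_19_66: "triangle_system q19 B19 1386 507233"
  by (rule triangle_system_extend[OF triangles_19_65, where rows =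
   "[(15278, 5771, 505276, 3, 506168, 6, 506816, 7),
    (289492, 323865, 505312, 15, 505428, 13, 506968, 11),
    (403331, 385416, 505360, 9, 506360, 1, 506784, 1),
    (475269, 143135, 505472, 8, 505492, 7, 505706, 15),
    (363849, 300538, 505512, 2, 505760, 14, 506276, 9),
    (354912, 73410, 505520, 10, 506196, 2, 506704, 0),
    (501325, 409828, 505532, 18, 505640, 9, 507032, 5),
    (421567, 26583, 505552, 13, 506556, 12, 506808, 12),
    (134984, 67560, 505580, 2, 506264, 3, 507116, 13),
    (426287, 223626, 505592, 5, 505828, 16, 505952, 17),
    (278537, 397803, 505690, 2, 506520, 8, 506720, 6),
    (333974, 352773, 505720, 14, 506568, 11, 507104, 1),
    (458189, 198561, 505744, 1, 506604, 14, 507088, 1),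
    (522547, 125151, 505770, 12, 506716, 10, 506796, 11),
    (437058, 259353, 505772, 9, 506536, 6, 506612, 2),
    (17595, 159140, 505804, 7, 506016, 16, 507228, 4),
    (154421, 204661, 505812, 5, 506760, 15, 507128, 7),
    (190189, 362634, 505840, 15, 506384, 10, 506804, 17),
    (408937, 452346, 506096, 14, 506660, 1, 507208, 6),
    (489002, 230306, 506348, 4, 507172, 6, 507232, 15),
    (102955, 470970, 506456, 6, 506496, 10, 506836, 6)]"],
    simp only: q19_def B19_def eval_simps cong: eval_congs, simp_all)

lemma triangles_19_67: "triangle_system q19 B19 1407 510177"
  by (rule triangle_system_extend[OF triangles_19_66, where rows =
   "[(459416, 447841, 507242, 7, 509584, 7, 509672, 11),
    (144108, 241116, 507244, 13, 507562, 3, 509136, 12),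
    (204493, 123121, 507272, 7, 507884, 5, 509680, 0),
    (390624, 114987, 507308, 11, 507772, 4, 507872, 7),
    (252585, 387456, 507376, 8, 507388, 17, 507796, 9),
    (81952, 302051, 507440, 13, 507508, 3, 507836, 9),
    (265868, 280747, 507464, 13, 507620, 12, 509872, 2),
    (36976, 3454, 507472, 15, 509344, 4, 509400, 14),
    (173949, 202771, 507484, 0, 509320, 11, 509440, 15),
    (33734, 375683, 507512, 7, 507752, 11, 507824, 18),
    (67409, 450236, 507536, 3, 510128, 2, 510160, 14),
    (321852, 345151, 507552, 3, 509416, 15, 509984, 9),
    (412440, 411972, 507632, 7, 507904, 18, 509624, 17),
    (126074, 212727, 507644, 17, 508544, 17, 509632, 0),
    (149225, 204975, 507664, 18, 507700, 0, 509904, 3),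
    (352352, 136504, 507704, 0, 508288, 2, 509800, 6),
    (361025, 478128, 507732, 5, 507848, 14, 508832, 5),
    (352169, 222653, 507766, 6, 509728, 6, 510176, 6),
    (65534, 344446, 507882, 10, 508752, 12, 509896, 7),
    (210119, 344608, 508480, 5, 508672, 0, 510016, 11),
    (151816, 463467, 508528, 4, 508640, 18, 509784, 14)]"],
    simp only: q19_def B19_def eval_simps cong: eval_congs, simp_all)

lemma triangles_19_68: "triangle_system q19 B19 1428 512853"
  by (rule triangle_system_extend[OF triangles_19_67, where rows =
   "[(19003, 485501, 510208, 17, 510392, 5, 511056, 5),
    (247262, 522225, 510248, 4, 510608, 13, 512256, 13),
    (175049, 104791, 510256, 18, 511916, 2, 512752, 12),
    (524185, 94034, 510328, 2, 511880, 13, 512648, 11),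
    (516139, 116117, 510352, 10, 511204, 16, 511396, 6),
    (90943, 320254, 510584, 12, 511284, 9, 511600, 7),
    (1599, 503794, 510648, 5, 510872, 6, 511588, 3),
    (327180, 293828, 510680, 0, 511380, 1, 512512, 6),
    (392313, 170763, 510692, 5, 510976, 2, 512128, 10),
    (124535, 346931, 510752, 18, 511780, 6, 511924, 15),
    (29754, 201898, 510764, 1, 511836, 12, 512584, 5),
    (372023, 395453, 510832, 11, 511316, 1, 512784, 16),
    (73301, 100743, 510888, 14, 511452, 9, 512064, 10),
    (8956, 186285, 510968, 17, 511296, 0, 511744, 9),
    (428003, 272753, 511024, 5, 511432, 2, 511696, 12),
    (12572, 379457, 511168, 1, 511400, 3, 511984, 9),
    (31379, 93216, 511192, 9, 511440, 9, 512304, 5),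
    (95530, 191052, 511264, 12, 511572, 9, 511592, 17),
    (209956, 410089, 511456, 14, 511976, 8, 512852, 5),
    (251932, 376031, 511656, 9, 512560, 18, 512704, 8),
    (452207, 348000, 511768, 7, 511936, 8, 512724, 18)]"],
    simp only: q19_def B19_def eval_simps cong: eval_congs, simp_all)

lemma triangles_19_69: "triangle_system q19 B19 1449 515377"
  by (rule triangle_system_extend[OF triangles_19_68, where rows =
   "[(308146, 12262, 512916, 9, 513756, 16, 515066, 9),
    (241194, 452760, 512920, 7, 512932, 7, 515160, 2),
    (406683, 446044, 513016, 14, 514624, 3, 514896, 3),
    (393459, 365818, 513024, 2, 513408, 0, 514416, 13),
    (464444, 335346, 513120, 12, 514780, 13, 515136, 14),
    (102336, 61186, 513252, 11, 515292, 7, 515320, 2),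
    (513998, 264158, 513364, 3, 514388, 5, 514922, 4),
    (505133, 325347, 513468, 16, 513780, 7, 515104, 13),
    (347092, 349182, 513480, 7, 514288, 12, 515008, 2),
    (358920, 206867, 513488, 11, 513744, 14, 513928, 6),
    (455937, 520418, 513500, 3, 513648, 13, 515176, 17),
    (12596, 428539, 513514, 2, 513636, 16, 515376, 12),
    (521367, 263845, 513700, 0, 514360, 14, 515200, 16),
    (143824, 156124, 513724, 14, 513962, 10, 514548, 15),
    (417221, 368445, 513864, 1, 514392, 5, 515068, 8),
    (133122, 317484, 513884, 11, 514644, 14, 514784, 16),
    (287190, 337295, 513898, 4, 514504, 2, 515000, 5),
    (173748, 385130, 513996, 5, 514852, 12, 514888, 3),
    (307586, 377270, 514184, 0, 514432, 16, 515248, 11),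
    (424090, 150656, 514576, 2, 514648, 10, 514840, 0),
    (357446, 232843, 514592, 13, 514996, 4, 515236, 14)]"],
    simp only: q19_def B19_def eval_simps cong: eval_congs, simp_all)

lemma triangles_19_70: "triangle_system q19 B19 1470 517869"
  by (rule triangle_system_extend[OF triangles_19_69, where rows =
   "[(36455, 397636, 515400, 5, 516928, 2, 517624, 11),
    (166545, 9041, 515434, 6, 516704, 10, 517840, 7),
    (171474, 443613, 515444, 9, 517480, 0, 517856, 14),
    (490173, 308457, 515464, 16, 515754, 2, 517488, 11),
    (256238, 61664, 515472, 2, 515578, 9, 517120, 1),
    (292509, 312612, 515520, 15, 516952, 9, 517304, 5),
    (17292, 384007, 515632, 12, 516004, 10, 516880, 17),
    (39158, 248456, 515656, 12, 516058, 2, 516896, 18),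
    (412640, 177303, 515664, 5, 517716, 17, 517800, 8),
    (353352, 373133, 515676, 7, 516792, 9, 517780, 13),
    (377200, 495208, 515680, 10, 516008, 11, 517664, 6),
    (405308, 486217, 515692, 8, 515700, 18, 517280, 9),
    (432088, 271153, 515704, 8, 515924, 11, 517832, 1),
    (217647, 27550, 515756, 2, 516608, 9, 516680, 14),
    (397738, 487481, 515822, 16, 517032, 11, 517040, 18),
    (287326, 423371, 515944, 15, 515964, 3, 517312, 17),
    (451125, 34969, 516060, 6, 517796, 5, 517868, 18),
    (218495, 488344, 516088, 10, 516512, 12, 517736, 7),
    (85958, 19688, 516432, 11, 516592, 2, 517504, 3),
    (476609, 301351, 516544, 4, 516744, 16, 517584, 12),
    (27200, 393604, 516824, 15, 517192, 17, 517760, 1)]"],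
    simp only: q19_def B19_def eval_simps cong: eval_congs, simp_all)

lemma triangles_19_71: "triangle_system q19 B19 1491 520105"
  by (rule triangle_system_extend[OF triangles_19_70, where rows =
   "[(357232, 1075, 517928, 15, 518068, 8, 518864, 17),
    (311261, 71663, 517984, 1, 519472, 18, 519680, 13),
    (146828, 253670, 517996, 5, 519376, 8, 519908, 6),
    (352823, 189175, 518032, 0, 518648, 6, 518936, 11),
    (338610, 134972, 518116, 16, 518948, 2, 519628, 18),
    (98224, 444844, 518240, 0, 519520, 0, 520048, 13),
    (109558, 432061, 518304, 1, 519056, 5, 520104, 2),
    (522462, 68811, 518416, 15, 519004, 16, 519968, 4),
    (27063, 454938, 518456, 1, 519084, 11, 519256, 10),
    (328387, 34724, 518484, 12, 518856, 16, 519568, 6),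
    (343884, 485528, 518500, 17, 519608, 11, 519918, 18),
    (115023, 20821, 518504, 5, 518820, 2, 519676, 4),
    (28483, 155349, 518568, 17, 518644, 9, 518890, 8),
    (522479, 228997, 518744, 12, 519816, 16, 520000, 18),
    (514100, 315348, 518844, 0, 519988, 11, 520064, 17),
    (411023, 69837, 518880, 4, 519280, 1, 519772, 2),
    (241235, 309576, 518892, 15, 519616, 5, 519850, 17),
    (159079, 75851, 518900, 14, 519852, 1, 519860, 18),
    (391104, 390665, 519128, 10, 519980, 2, 520036, 0),
    (197842, 265731, 519296, 15, 519504, 13, 519800, 1),
    (308170, 353449, 519728, 17, 519752, 10, 519864, 7)]"],
    simp only: q19_def B19_def eval_simps cong: eval_congs, simp_all)

lemma triangles_19_72: "triangle_system q19 B19 1512 522569"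
  by (rule triangle_system_extend[OF triangles_19_71, where rows =
   "[(44190, 472376, 520112, 2, 521824, 10, 522166, 8),
    (270452, 75027, 520184, 4, 521328, 0, 521578, 0),
    (118307, 211891, 520288, 1, 521132, 17, 521768, 11),
    (269210, 119213, 520336, 2, 520792, 14, 521968, 9),
    (412808, 67996, 520352, 18, 521076, 1, 521898, 16),
    (481836, 486775, 520512, 17, 520960, 4, 522106, 12),
    (363139, 343837, 520552, 13, 520880, 12, 521652, 10),
    (365728, 118131, 520560, 12, 522000, 4, 522536, 12),
    (330981, 516104, 520656, 7, 521912, 6, 522088, 5),
    (28145, 880, 520696, 5, 521056, 9, 522408, 4),
    (454523, 14684, 520736, 18, 521712, 14, 521974, 11),
    (220225, 57154, 520804, 0, 521032, 6, 521728, 8),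
    (363076, 449134, 520856, 1, 521956, 9, 522496, 13),
    (178515, 70101, 520952, 12, 521460, 9, 522220, 17),
    (257580, 295615, 521096, 5, 522184, 15, 522440, 4),
    (166960, 257802, 521164, 12, 521588, 17, 522148, 8),
    (33033, 38485, 521368, 13, 521776, 4, 522112, 5),
    (444330, 227027, 521380, 14, 522170, 8, 522232, 15),
    (287526, 151263, 521440, 17, 521508, 18, 521808, 2),
    (31092, 383911, 521544, 8, 521688, 9, 522568, 9),
    (93284, 4250, 521888, 14, 522048, 2, 522192, 5)]"],
    simp only: q19_def B19_def eval_simps cong: eval_congs, simp_all)

lemma triangles_19_73: "triangle_system q19 B19 1533 524285"
  by (rule triangle_system_extend[OF triangles_19_72, where rows =
   "[(291427, 147508, 522592, 17, 522792, 11, 523904, 6),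
    (144610, 438739, 522668, 11, 524092, 3, 524124, 16),
    (418677, 314883, 522700, 9, 523092, 12, 523706, 3),
    (2595, 182011, 522736, 15, 523312, 17, 523448, 8),
    (375277, 257167, 522752, 14, 522968, 17, 523492, 15),
    (235299, 62717, 522800, 17, 523604, 17, 523944, 0),
    (351214, 69153, 522824, 16, 523002, 18, 523444, 4),
    (426912, 68793, 522848, 18, 523226, 0, 524284, 5),
    (442090, 434060, 522872, 9, 523242, 9, 523408, 14),
    (346879, 303504, 522888, 1, 523684, 17, 524112, 17),
    (425341, 503580, 522944, 7, 523436, 2, 523696, 13),
    (512362, 268528, 523040, 12, 524128, 11, 524138, 5),
    (451922, 84561, 523052, 14, 523774, 17, 524152, 1),
    (461730, 164345, 523064, 13, 523608, 18, 523768, 11),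
    (158397, 99251, 523108, 10, 523756, 5, 523832, 16),
    (19845, 404750, 523126, 6, 523792, 1, 524192, 13),
    (452050, 158535, 523208, 12, 523940, 12, 523984, 12),
    (449270, 60329, 523576, 3, 523928, 14, 524056, 13),
    (517203, 97209, 523672, 6, 524024, 5, 524254, 11),
    (88728, 277057, 523754, 13, 524010, 17, 524236, 4),
    (127361, 14200, 523964, 10, 524188, 13, 524212, 15)]"],
    simp only: q19_def B19_def eval_simps cong: eval_congs, simp_all)

theorem theorem5:
  fixes n :: nat
  assumes "n \<in> {7, 13, 19}"
    and "CARD('a::finite_field) = 2 ^ n"
  shows "\<exists>D :: 'a set set set.
    f2_vector_space.triangle_design f2_scale D \<and>
    balanced D \<and>
    (\<forall>a. a \<noteq> 0 \<longrightarrow> invariant_under (\<lambda>x. a * x) D) \<and>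
    (\<forall>\<sigma> \<in> field_automorphisms. invariant_under \<sigma> D)"
proof -
  \<comment> \<open>The counts solve \<open>N * 18 * n = 2 ^ n - 2\<close>: the right-hand sides are
    \<open>126 = 18 * 7\<close>, \<open>8190 = 35 * 18 * 13\<close> and
    \<open>524286 = 1533 * 18 * 19\<close>.\<close>
  consider "n = 7" | "n = 13" | "n = 19" using assms(1) by blast
  then show ?thesis
  proof cases
    case 1
    then show ?thesis
      using exists_design[OF _ _ length_B7 self_dual_normal_7 triangles_7] assms(2) by simp
  next
    case 2
    then show ?thesis
      using exists_design[OF _ _ length_B13 self_dual_normal_13 triangles_13] assms(2) by simp
  next
    case 3
    then show ?thesis
      using exists_design[OF _ _ length_B19 self_dual_normal_19 triangles_19_73] assms(2) by simp
  qed
qed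

end
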